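(* Let $(M,F)$ be an $n$-dimensional Finsler manifold. Then $F$ has isotropic Berwald scalar curvature $\mathsf{e}$ (that is, $\mathsf{e}=\pi^*c$ for some $c\in C^\infty(M)$) if and only if $F$ has weakly isotropic $S$-curvature, and in that case $$S=\frac{1}{n-1}\,\mathsf{e}+\pi^*\xi(\mathbf{G})$$ for some $\xi\in\Omega^1(M)$. In both cases the mean Berwald curvature $\mathbf{E}$ is isotropic. Moreover, the following equation holds on $SM$: $$\mathrm{tr}[\tilde R]=\pi^*d\xi+\frac{1}{n-1}\,d\mathsf{e}\wedge\omega^n .$$
   Context: Indices: $i,j,k,l,p,q$ run over $1,\dots,n$; $\alpha,\beta,\gamma,\mu$ run over $1,\dots,n-1$; $\bar\alpha:=n+\alpha$; repeated indices are summed; $n\ge 2$. Finsler setup. $F:TM\to[0,\infty)$ is continuous, smooth on $TM\setminus 0$, positively $1$-homogeneous in $y$, and $g_{ij}=\frac12[F^2]_{y^iy^j}$ is positive definite on $TM\setminus0$. $SM=\{(x,y)\in TM: F(x,y)=1\}$ with projection $\pi:SM\to M$; objects on $TM\setminus 0$ that are $0$-homogeneous in $y$ are regarded as objects on $SM$. Spray coefficients $G^i=\frac14 g^{il}([F^2]_{x^ky^l}y^k-[F^2]_{x^l})$, $N^i_k=\partial G^i/\partial y^k$, $\frac{\delta}{\delta x^i}=\frac{\partial}{\partial x^i}-N^k_i\frac{\partial}{\partial y^k}$, $\delta y^i=dy^i+N^i_kdx^k$. A local adapted frame of $T(SM)$ is $\mathbf{e}_i=u_i^j\frac{\delta}{\delta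 x^j}$, $\mathbf{e}_{\bar\alpha}=-u_\alpha^jF\frac{\partial}{\partial y^j}$, where $g_{kl}u^k_iu^l_j=\delta_{ij}$ and $u_n^i=y^i/F$; its dual coframe is $\omega^i,\omega^{\bar\alpha}$. Thus $\mathbf{e}_n=\mathbf{G}=\frac{y^i}{F}\frac{\delta}{\delta x^i}$ is the Reeb field and $\omega^n=F_{y^i}dx^i$ is the Hilbert form. $H(SM)$ is the bundle spanned by $\mathbf{e}_1,\dots,\mathbf{e}_n$. Chern connection. $\nabla^{\rm Ch}\mathbf{e}_i=\omega_i^j\otimes\mathbf{e}_j$ on $H(SM)$ is determined by $d\omega^i=\omega^j\wedge\omega^i_j$ and $\omega^i_j+\omega^j_i=-2H_{ij}$, where $H_{ij}=H_{ij\gamma}\omega^{\bar\gamma}$, $H_{ij\gamma}=-A_{pqk}u_i^pu_j^qu_\gamma^k$, $A_{pqk}=\frac14F[F^2]_{y^py^qy^k}$; moreover $\omega^n_\alpha=-\omega^\alpha_n=\omega^{\bar\alpha}$, $\omega^n_n=0$. Its curvature forms are $\Omega^i_j=d\omega^i_j-\omega^k_j\wedge\omega^i_k=\frac12R^{~i}_{j~kl}\omega^k\wedge\omega^l+P^{~i}_{j~k\gamma}\omega^k\wedge\omega^{\bar\gamma}$. The Landsberg curvature has components $L^{~i}_{j~\gamma}=L^i_{j\gamma}=-P^{~i}_{j~n\gamma}$. Berwald connection. Its connection forms are $\tilde\omega^i_j=\omega^i_j-L^i_{j\alpha}\omega^\alpha$ (in natural coordinates, $\frac{\partial^2G^i}{\partial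 y^j\partial y^k}dx^k$), with curvature forms $\tilde\Omega^i_j=d\tilde\omega^i_j-\tilde\omega^k_j\wedge\tilde\omega^i_k=\frac12\tilde R^{~i}_{j~kl}\omega^k\wedge\omega^l+\tilde P^{~i}_{j~k\gamma}\omega^k\wedge\omega^{\bar\gamma}$. The $hh$-part is $\tilde R$, and $\mathrm{tr}[\tilde R]=\frac12\tilde R^{~i}_{i~kl}\omega^k\wedge\omega^l$. The mean Berwald curvature is $\mathbf{E}=\mathrm{tr}\tilde P=\tilde P^{~i}_{i~\gamma\mu}\omega^\gamma\wedge\omega^{\bar\mu}=:E_{\gamma\mu}\omega^\gamma\wedge\omega^{\bar\mu}$, and the Berwald scalar curvature is the function $\mathsf{e}=\mathrm{tr}\,\mathbf{E}=\sum_\gamma E_{\gamma\gamma}$ on $SM$. $\mathbf{E}$ is isotropic if $E_{\alpha\beta}=\frac{1}{n-1}(\pi^*c)\,\delta_{\alpha\beta}$ for some $c\in C^\infty(M)$. $S$-curvature. Fix a volume form $dV_M=\sigma(x)\,dx^1\wedge\cdots\wedge dx^n$, $\sigma>0$, on $M$ (a positive density if $M$ is not orientable). The distortion is $\tau=\ln\frac{\sqrt{\det(g_{ij})}}{\sigma(x)}$, and $S:=\mathbf{G}(\tau)$ is a function on $SM$, called the $S$-curvature. $F$ has weakly isotropic $S$-curvature if $S=\frac{1}{n-1}\pi^*c+\pi^*\xi(\mathbf{G})$ for some $c\in C^\infty(M)$ and $\xi\in\Omega^1(M)$. (In coordinates $\pi^*\xi(\mathbf{G})=\xi_iy^i/F$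 for $\xi=\xi_i dx^i$.) *)

theory Defs
  imports "HOL-Analysis.Analysis"
begin

section \<open>Smooth maps and exterior calculus on open subsets of normed spaces\<close>

fun diff_upto :: "nat \<Rightarrow> ('a::real_normed_vector) set \<Rightarrow> ('a \<Rightarrow> 'b::real_normed_vector) \<Rightarrow> bool" where
  "diff_upto 0 S f \<longleftrightarrow> continuous_on S f"
| "diff_upto (Suc k) S f \<longleftrightarrow>
     (\<forall>x\<in>S. f differentiable (at x)) \<and>
     (\<forall>v. diff_upto k S (\<lambda>x. frechet_derivative f (at x) v))"

definition smooth_on :: "('a::real_normed_vector) set \<Rightarrow> ('a \<Rightarrow> 'b::real_normed_vector) \<Rightarrow> bool" where
  "smooth_on S f \<longleftrightarrow> (\<forall>k. diff_upto k S f)"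

text \<open>A differential 1-form is a map \<open>z \<mapsto> (X \<mapsto> \<omega> z X)\<close> and a 2-form a map
  \<open>z \<mapsto> (X \<mapsto> Y \<mapsto> \<beta> z X Y)\<close>. The normalisation is \<open>(a \<and> b)(X,Y) = a(X) b(Y) - a(Y) b(X)\<close>
  and \<open>d\<omega>(X,Y) = X(\<omega>(Y)) - Y(\<omega>(X))\<close> for constant fields \<open>X, Y\<close>, so that \<open>d(f dx) = df \<and> dx\<close>.\<close>

definition wedge :: "('v \<Rightarrow> real) \<Rightarrow> ('v \<Rightarrow> real) \<Rightarrow> 'v \<Rightarrow> 'v \<Rightarrow> real" where
  "wedge a b X Y = a X * b Y - a Y * b X"

definition ext_deriv ::
  "('v::real_normed_vector \<Rightarrow> 'v \<Rightarrow> real) \<Rightarrow> 'v \<Rightarrow> 'v \<Rightarrow> 'v \<Rightarrow> real" where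
  "ext_deriv \<omega> z X Y =
     frechet_derivative (\<lambda>w. \<omega> w Y) (at z) X - frechet_derivative (\<lambda>w. \<omega> w X) (at z) Y"

section \<open>Smooth manifolds, tangent vectors, tensors\<close>

text \<open>The manifold is a whole type of points (Hausdorff and second countable through its type
  class) together with a smooth atlas, whose members are pairs of a domain and a coordinate map.\<close>

type_synonym ('m, 'n) chart = "'m set \<times> ('m \<Rightarrow> real^'n)"

definition chart_inv :: "('m, 'n) chart \<Rightarrow> real^'n \<Rightarrow> 'm" where
  "chart_inv \<kappa> = inv_into (fst \<kappa>) (snd \<kappa>)"

definition chart_img :: "('m, 'n) chart \<Rightarrow> (real^'n) set" where
  "chart_img \<kappa> = snd \<kappa> ` fst \<kappa>"

definition is_chart :: "('m::topological_space, 'n::finite) chart \<Rightarrow> bool" where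
  "is_chart \<kappa> \<longleftrightarrow> open (fst \<kappa>) \<and> open (chart_img \<kappa>) \<and>
     homeomorphism (fst \<kappa>) (chart_img \<kappa>) (snd \<kappa>) (chart_inv \<kappa>)"

definition transition :: "('m, 'n) chart \<Rightarrow> ('m, 'n) chart \<Rightarrow> real^'n \<Rightarrow> real^'n" where
  "transition \<kappa> \<kappa>' = snd \<kappa>' \<circ> chart_inv \<kappa>"

definition smooth_atlas ::
  "('m::{t2_space, second_countable_topology}, 'n::finite) chart set \<Rightarrow> bool" where
  "smooth_atlas A \<longleftrightarrow>
     (\<forall>\<kappa>\<in>A. is_chart \<kappa>) \<and> (\<Union>\<kappa>\<in>A. fst \<kappa>) = UNIV \<and>
     (\<forall>\<kappa>\<in>A. \<forall>\<kappa>'\<in>A. smooth_on (snd \<kappa> ` (fst \<kappa> \<inter> fst \<kappa>')) (transition \<kappa> \<kappa>'))"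

definition smooth_fun :: "('m, 'n::finite) chart set \<Rightarrow> ('m \<Rightarrow> real) \<Rightarrow> bool" where
  "smooth_fun A c \<longleftrightarrow> (\<forall>\<kappa>\<in>A. smooth_on (chart_img \<kappa>) (c \<circ> chart_inv \<kappa>))"

text \<open>A tangent vector at \<open>p\<close> is the family of its coordinate vectors in the charts around \<open>p\<close>,
  related by the Jacobians of the transition maps (and 0 for the remaining charts).\<close>

type_synonym ('m, 'n) tvec = "('m, 'n) chart \<Rightarrow> real^'n"

definition tangent_space ::
  "('m, 'n::finite) chart set \<Rightarrow> 'm \<Rightarrow> ('m, 'n) tvec set" where
  "tangent_space A p = {v.
     (\<forall>\<kappa>. \<not> (\<kappa> \<in> A \<and> p \<in> fst \<kappa>) \<longrightarrow> v \<kappa> = 0) \<and>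
     (\<forall>\<kappa>\<in>A. \<forall>\<kappa>'\<in>A. p \<in> fst \<kappa> \<inter> fst \<kappa>' \<longrightarrow>
        v \<kappa>' = frechet_derivative (transition \<kappa> \<kappa>') (at (snd \<kappa> p)) (v \<kappa>))}"

definition tvec_of ::
  "('m, 'n::finite) chart set \<Rightarrow> ('m, 'n) chart \<Rightarrow> 'm \<Rightarrow> real^'n \<Rightarrow> ('m, 'n) tvec" where
  "tvec_of A \<kappa> p y = (\<lambda>\<kappa>'. if \<kappa>' \<in> A \<and> p \<in> fst \<kappa>'
     then frechet_derivative (transition \<kappa> \<kappa>') (at (snd \<kappa> p)) y else 0)"

lemma tangent_space_eq_tvec_of:
  assumes "\<kappa> \<in> A" "p \<in> fst \<kappa>" "v \<in> tangent_space A p"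
  shows "v = tvec_of A \<kappa> p (v \<kappa>)"
proof (rule ext)
  fix a
  show "v a = tvec_of A \<kappa> p (v \<kappa>) a"
  proof (cases "a \<in> A \<and> p \<in> fst a")
    case True
    then have "p \<in> fst \<kappa> \<inter> fst a" using assms(2) by blast
    with True assms(1,3) have "v a = frechet_derivative (transition \<kappa> a) (at (snd \<kappa> p)) (v \<kappa>)"
      unfolding tangent_space_def mem_Collect_eq by blast
    with True show ?thesis by (simp only: tvec_of_def if_True simp_thms)
  next
    case False
    with assms(3) have "v a = 0" unfolding tangent_space_def mem_Collect_eq by blast
    with False show ?thesis by (simp only: tvec_of_def if_False)
  qed
qed

lemma tvec_of_in_tangent_space:
  assumes A: "smooth_atlas A" and k: "\<kappa> \<in> A" "p \<in> fst \<kappa>"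
  shows "tvec_of A \<kappa> p y \<in> tangent_space A p"
    and "tvec_of A \<kappa> p y \<kappa> = y"
proof -
  have chart: "is_chart a" if "a \<in> A" for a
    using A that by (auto simp: smooth_atlas_def)
  have inv: "chart_inv a (snd a q) = q" if "a \<in> A" "q \<in> fst a" for a q
    using chart[OF that(1)] that(2) by (auto simp: is_chart_def homeomorphism_def)
  have opn: "open (snd a ` (fst a \<inter> W))" if "a \<in> A" "open W" for a W
  proof -
    have h: "homeomorphism (fst a) (chart_img a) (snd a) (chart_inv a)"
      and o: "open (fst a)" "open (chart_img a)"
      using chart[OF that(1)] by (auto simp: is_chart_def)
    have "openin (top_of_set (fst a)) (fst a \<inter> W)"
      using that(2) by (simp add: openin_open_Int)
    then have "openin (top_of_set (chart_img a)) (snd a ` (fst a \<inter> W))"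
      by (rule homeomorphism_imp_open_map[OF h])
    then show ?thesis using o(2) by (rule openin_open_trans)
  qed
  have diff: "transition a b differentiable (at (snd a p))"
    if "a \<in> A" "b \<in> A" "p \<in> fst a" "p \<in> fst b" for a b
  proof -
    have "diff_upto (Suc 0) (snd a ` (fst a \<inter> fst b)) (transition a b)"
      using A that unfolding smooth_atlas_def smooth_on_def by blast
    then have "\<forall>x\<in>snd a ` (fst a \<inter> fst b). transition a b differentiable (at x)"
      unfolding diff_upto.simps by (rule conjunct1)
    then show ?thesis using that by blast
  qed
  have cocycle: "frechet_derivative (transition b c) (at (snd b p))
        (frechet_derivative (transition a b) (at (snd a p)) y)
      = frechet_derivative (transition a c) (at (snd a p)) y"
    if m: "a \<in> A" "b \<in> A" "c \<in> A" and q: "p \<in> fst a" "p \<in> fst b" "p \<in> fst c" for a b c y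
  proof -
    have e: "transition a b (snd a p) = snd b p"
      using inv[OF m(1) q(1)] by (simp add: transition_def)
    have d1: "(transition a b has_derivative frechet_derivative (transition a b) (at (snd a p)))
        (at (snd a p))"
      using diff[OF m(1,2) q(1,2)] by (simp add: frechet_derivative_works)
    have d2: "(transition b c has_derivative frechet_derivative (transition b c) (at (snd b p)))
        (at (transition a b (snd a p)))"
      using diff[OF m(2,3) q(2,3)] by (simp add: frechet_derivative_works e)
    have d3: "((\<lambda>x. transition b c (transition a b x)) has_derivative
        (\<lambda>h. frechet_derivative (transition b c) (at (snd b p))
          (frechet_derivative (transition a b) (at (snd a p)) h))) (at (snd a p))"
      using has_derivative_compose[OF d1 d2] .
    have "open (fst b)" using chart[OF m(2)] by (simp add: is_chart_def)
    then have o: "open (snd a ` (fst a \<inter> fst b))" by (rule opn[OF m(1)])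
    have "(transition a c has_derivative
        (\<lambda>h. frechet_derivative (transition b c) (at (snd b p))
          (frechet_derivative (transition a b) (at (snd a p)) h))) (at (snd a p))"
      by (rule has_derivative_transform_within_open[OF d3 o])
        (use q m in \<open>auto simp: transition_def inv simp del: split_paired_All\<close>)
    from fun_cong[OF frechet_derivative_at[OF this], of y] show ?thesis .
  qed
  show "tvec_of A \<kappa> p y \<in> tangent_space A p"
    unfolding tangent_space_def mem_Collect_eq
  proof (intro conjI allI ballI impI)
    fix a assume "\<not> (a \<in> A \<and> p \<in> fst a)"
    then show "tvec_of A \<kappa> p y a = 0" unfolding tvec_of_def by (rule if_not_P)
  next
    fix a b assume ab: "a \<in> A" "b \<in> A" "p \<in> fst a \<inter> fst b"
    have "p \<in> fst a" "p \<in> fst b" using ab(3) by blast+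
    note abp = ab(1,2) this
    have "tvec_of A \<kappa> p y c = frechet_derivative (transition \<kappa> c) (at (snd \<kappa> p)) y"
      if "c \<in> A" "p \<in> fst c" for c
      unfolding tvec_of_def using that by (simp only: simp_thms if_True)
    note e = this[OF abp(1,3)] this[OF abp(2,4)]
    show "tvec_of A \<kappa> p y b
        = frechet_derivative (transition a b) (at (snd a p)) (tvec_of A \<kappa> p y a)"
      unfolding e using cocycle[OF k(1) abp(1,2) k(2) abp(3,4), of y] by (rule sym)
  qed
  have "open (fst \<kappa>)" using chart[OF k(1)] by (simp add: is_chart_def)
  then have o: "open (snd \<kappa> ` (fst \<kappa> \<inter> fst \<kappa>))" by (rule opn[OF k(1)])
  have "(transition \<kappa> \<kappa> has_derivative (\<lambda>h. h)) (at (snd \<kappa> p))"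
    by (rule has_derivative_transform_within_open[OF has_derivative_ident o])
      (use k in \<open>auto simp: transition_def inv\<close>)
  from fun_cong[OF frechet_derivative_at[OF this], of y] show "tvec_of A \<kappa> p y \<kappa> = y"
    using k by (simp only: tvec_of_def simp_thms if_True)
qed

text \<open>Functions on \<open>TM\<close>, which includes 1-forms, in the induced coordinates \<open>(x, y)\<close>.\<close>

definition tm_rep ::
  "('m, 'n::finite) chart set \<Rightarrow> ('m \<Rightarrow> ('m, 'n) tvec \<Rightarrow> real) \<Rightarrow> ('m, 'n) chart
     \<Rightarrow> (real^'n) \<times> (real^'n) \<Rightarrow> real" where
  "tm_rep A F \<kappa> z = F (chart_inv \<kappa> (fst z)) (tvec_of A \<kappa> (chart_inv \<kappa> (fst z)) (snd z))"

definition one_form ::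
  "('m, 'n::finite) chart set \<Rightarrow> ('m \<Rightarrow> ('m, 'n) tvec \<Rightarrow> real) \<Rightarrow> bool" where
  "one_form A \<xi> \<longleftrightarrow>
     (\<forall>p. \<forall>v\<in>tangent_space A p. \<forall>w\<in>tangent_space A p. \<forall>a b.
        \<xi> p (\<lambda>\<kappa>. a *\<^sub>R v \<kappa> + b *\<^sub>R w \<kappa>) = a * \<xi> p v + b * \<xi> p w) \<and>
     (\<forall>\<kappa>\<in>A. \<forall>i. smooth_on (chart_img \<kappa>) (\<lambda>x. tm_rep A \<xi> \<kappa> (x, axis i 1)))"

definition form_rep ::
  "('m, 'n::finite) chart set \<Rightarrow> ('m \<Rightarrow> ('m, 'n) tvec \<Rightarrow> real) \<Rightarrow> ('m, 'n) chart
     \<Rightarrow> real^'n \<Rightarrow> real^'n \<Rightarrow> real" where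
  "form_rep A \<xi> \<kappa> x v = tm_rep A \<xi> \<kappa> (x, v)"

text \<open>A positive smooth density \<open>\<sigma> dx\<^sup>1\<dots>dx\<^sup>n\<close>, given by its coefficient in each chart. For an
  orientable \<open>M\<close> this is the same as a volume form.\<close>

definition volume_density ::
  "('m, 'n::finite) chart set \<Rightarrow> (('m, 'n) chart \<Rightarrow> real^'n \<Rightarrow> real) \<Rightarrow> bool" where
  "volume_density A \<sigma> \<longleftrightarrow>
     (\<forall>\<kappa>\<in>A. smooth_on (chart_img \<kappa>) (\<sigma> \<kappa>) \<and> (\<forall>x\<in>chart_img \<kappa>. \<sigma> \<kappa> x > 0)) \<and>
     (\<forall>\<kappa>\<in>A. \<forall>\<kappa>'\<in>A. \<forall>x\<in>snd \<kappa> ` (fst \<kappa> \<inter> fst \<kappa>').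
        \<sigma> \<kappa> x = \<sigma> \<kappa>' (transition \<kappa> \<kappa>' x)
          * \<bar>det (matrix (frechet_derivative (transition \<kappa> \<kappa>') (at x)))\<bar>)"

section \<open>Finsler geometry in induced coordinates\<close>

text \<open>In this section \<open>f\<close> is the coordinate expression of a Finsler function and \<open>z = (x, y)\<close>.
  Tangent vectors of \<open>TM\<close> are pairs: \<open>(a, b)\<close> stands for \<open>a\<^sup>i \<partial>/\<partial>x\<^sup>i + b\<^sup>i \<partial>/\<partial>y\<^sup>i\<close>.\<close>

definition px :: "'n::finite \<Rightarrow> ((real^'n) \<times> (real^'n) \<Rightarrow> real) \<Rightarrow> (real^'n) \<times> (real^'n) \<Rightarrow> real" where
  "px i h z = frechet_derivative h (at z) (axis i 1, 0)"

definition py :: "'n::finite \<Rightarrow> ((real^'n) \<times> (real^'n) \<Rightarrow> real) \<Rightarrow> (real^'n) \<times> (real^'n) \<Rightarrow> real" where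
  "py i h z = frechet_derivative h (at z) (0, axis i 1)"

definition fund_tensor ::
  "((real^'n) \<times> (real^'n) \<Rightarrow> real) \<Rightarrow> (real^'n) \<times> (real^'n) \<Rightarrow> real^'n^('n::finite)" where
  "fund_tensor f z = (\<chi> i j. 1/2 * py j (py i (\<lambda>w. (f w)\<^sup>2)) z)"

definition finsler ::
  "('m::{t2_space, second_countable_topology}, 'n::finite) chart set
     \<Rightarrow> ('m \<Rightarrow> ('m, 'n) tvec \<Rightarrow> real) \<Rightarrow> bool" where
  "finsler A F \<longleftrightarrow>
     (\<forall>p. \<forall>v\<in>tangent_space A p. F p v \<ge> 0 \<and>
        (\<forall>t>0. F p (\<lambda>\<kappa>. t *\<^sub>R v \<kappa>) = t * F p v)) \<and>
     (\<forall>\<kappa>\<in>A. continuous_on (chart_img \<kappa> \<times> UNIV) (tm_rep A F \<kappa>) \<and>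
        smooth_on (chart_img \<kappa> \<times> (UNIV - {0})) (tm_rep A F \<kappa>) \<and>
        (\<forall>x\<in>chart_img \<kappa>. \<forall>y w. y \<noteq> 0 \<and> w \<noteq> 0 \<longrightarrow>
           w \<bullet> (fund_tensor (tm_rep A F \<kappa>) (x, y) *v w) > 0))"

definition spray ::
  "((real^'n) \<times> (real^'n) \<Rightarrow> real) \<Rightarrow> 'n::finite \<Rightarrow> (real^'n) \<times> (real^'n) \<Rightarrow> real" where
  "spray f i z = 1/4 * (\<Sum>l\<in>UNIV. matrix_inv (fund_tensor f z) $ i $ l *
     ((\<Sum>k\<in>UNIV. py l (px k (\<lambda>w. (f w)\<^sup>2)) z * snd z $ k) - px l (\<lambda>w. (f w)\<^sup>2) z))"

text \<open>\<open>nonlin f i k\<close> is \<open>N\<^sup>i\<^sub>k\<close>, and \<open>hlift f z a\<close> is \<open>a\<^sup>i \<delta>/\<delta>x\<^sup>i\<close>.\<close>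

definition nonlin ::
  "((real^'n) \<times> (real^'n) \<Rightarrow> real) \<Rightarrow> 'n::finite \<Rightarrow> 'n \<Rightarrow> (real^'n) \<times> (real^'n) \<Rightarrow> real" where
  "nonlin f i k z = py k (spray f i) z"

definition hlift ::
  "((real^'n::finite) \<times> (real^'n) \<Rightarrow> real) \<Rightarrow> (real^'n) \<times> (real^'n) \<Rightarrow> real^'n
     \<Rightarrow> (real^'n) \<times> (real^'n)" where
  "hlift f z a = (a, - (\<chi> k. \<Sum>i\<in>UNIV. nonlin f k i z * a $ i))"

definition reeb ::
  "((real^'n::finite) \<times> (real^'n) \<Rightarrow> real) \<Rightarrow> (real^'n) \<times> (real^'n) \<Rightarrow> (real^'n) \<times> (real^'n)" where
  "reeb f z = hlift f z ((1 / f z) *\<^sub>R snd z)"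

definition hilbert_form ::
  "((real^'n::finite) \<times> (real^'n) \<Rightarrow> real) \<Rightarrow> (real^'n) \<times> (real^'n)
     \<Rightarrow> (real^'n) \<times> (real^'n) \<Rightarrow> real" where
  "hilbert_form f z X = (\<Sum>i\<in>UNIV. py i f z * fst X $ i)"

subsection \<open>Adapted frames\<close>

text \<open>The index type carries no order, so the index called \<open>n\<close> is an arbitrary fixed element;
  Greek indices range over the complement of \<open>{ix_n}\<close>.\<close>

definition ix_n :: "'n::finite" where
  "ix_n = (SOME i. True)"

definition adapted ::
  "((real^'n::finite) \<times> (real^'n) \<Rightarrow> real) \<Rightarrow> (real^'n) \<times> (real^'n) \<Rightarrow> ('n \<Rightarrow> real^'n) \<Rightarrow> bool" where
  "adapted f z u \<longleftrightarrow>
     (\<forall>i j. (\<Sum>k\<in>UNIV. \<Sum>l\<in>UNIV. fund_tensor f z $ k $ l * u i $ k * u j $ l)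
        = (if i = j then 1 else 0)) \<and>
     u ix_n = (1 / f z) *\<^sub>R snd z"

definition frame_h ::
  "((real^'n::finite) \<times> (real^'n) \<Rightarrow> real) \<Rightarrow> (real^'n) \<times> (real^'n) \<Rightarrow> ('n \<Rightarrow> real^'n) \<Rightarrow> 'n
     \<Rightarrow> (real^'n) \<times> (real^'n)" where
  "frame_h f z u i = hlift f z (u i)"

definition frame_v ::
  "((real^'n::finite) \<times> (real^'n) \<Rightarrow> real) \<Rightarrow> (real^'n) \<times> (real^'n) \<Rightarrow> ('n \<Rightarrow> real^'n) \<Rightarrow> 'n
     \<Rightarrow> (real^'n) \<times> (real^'n)" where
  "frame_v f z u \<alpha> = (0, - (f z *\<^sub>R u \<alpha>))"

text \<open>The horizontal part \<open>\<omega>\<^sup>i\<close> of the dual coframe; by orthonormality of \<open>u\<close>,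
  \<open>\<omega>\<^sup>i = g\<^sub>k\<^sub>l u\<^sub>i\<^sup>k dx\<^sup>l\<close>.\<close>

definition coframe_h ::
  "((real^'n::finite) \<times> (real^'n) \<Rightarrow> real) \<Rightarrow> (real^'n) \<times> (real^'n) \<Rightarrow> ('n \<Rightarrow> real^'n) \<Rightarrow> 'n
     \<Rightarrow> (real^'n) \<times> (real^'n) \<Rightarrow> real" where
  "coframe_h f z u i X = (\<Sum>k\<in>UNIV. \<Sum>l\<in>UNIV. fund_tensor f z $ k $ l * u i $ k * fst X $ l)"

subsection \<open>Berwald connection and its curvature\<close>

text \<open>\<open>berwald_form f i j\<close> and \<open>berwald_curv f i j\<close> are the connection and curvature forms with
  upper index \<open>i\<close> and lower index \<open>j\<close>, relative to the frame \<open>\<delta>/\<delta>x\<^sup>i\<close> of \<open>H(SM)\<close>.\<close>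

definition berwald_form ::
  "((real^'n) \<times> (real^'n) \<Rightarrow> real) \<Rightarrow> 'n::finite \<Rightarrow> 'n
     \<Rightarrow> (real^'n) \<times> (real^'n) \<Rightarrow> (real^'n) \<times> (real^'n) \<Rightarrow> real" where
  "berwald_form f i j z X = (\<Sum>k\<in>UNIV. py k (py j (spray f i)) z * fst X $ k)"

definition berwald_curv ::
  "((real^'n) \<times> (real^'n) \<Rightarrow> real) \<Rightarrow> 'n::finite \<Rightarrow> 'n
     \<Rightarrow> (real^'n) \<times> (real^'n) \<Rightarrow> (real^'n) \<times> (real^'n) \<Rightarrow> (real^'n) \<times> (real^'n) \<Rightarrow> real" where
  "berwald_curv f i j z X Y =
     ext_deriv (berwald_form f i j) z X Y
       - (\<Sum>k\<in>UNIV. wedge (berwald_form f k j z) (berwald_form f i k z) X Y)"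

text \<open>The curvature forms relative to the adapted frame \<open>\<e>\<^sub>i = u\<^sub>i\<^sup>j \<delta>/\<delta>x\<^sup>j\<close>; the curvature is
  tensorial, so a frame at the single point \<open>z\<close> suffices.\<close>

definition berwald_curv_frame ::
  "((real^'n) \<times> (real^'n) \<Rightarrow> real) \<Rightarrow> (real^'n) \<times> (real^'n) \<Rightarrow> ('n \<Rightarrow> real^'n) \<Rightarrow> 'n::finite \<Rightarrow> 'n
     \<Rightarrow> (real^'n) \<times> (real^'n) \<Rightarrow> (real^'n) \<times> (real^'n) \<Rightarrow> real" where
  "berwald_curv_frame f z u i j X Y =
     (\<Sum>a\<in>UNIV. \<Sum>b\<in>UNIV.
        coframe_h f z u i (axis a 1, 0) * berwald_curv f a b z X Y * u j $ b)"

definition berwald_R ::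
  "((real^'n) \<times> (real^'n) \<Rightarrow> real) \<Rightarrow> (real^'n) \<times> (real^'n) \<Rightarrow> ('n \<Rightarrow> real^'n)
     \<Rightarrow> 'n::finite \<Rightarrow> 'n \<Rightarrow> 'n \<Rightarrow> 'n \<Rightarrow> real" where
  "berwald_R f z u i j k l = berwald_curv_frame f z u i j (frame_h f z u k) (frame_h f z u l)"

definition berwald_P ::
  "((real^'n) \<times> (real^'n) \<Rightarrow> real) \<Rightarrow> (real^'n) \<times> (real^'n) \<Rightarrow> ('n \<Rightarrow> real^'n)
     \<Rightarrow> 'n::finite \<Rightarrow> 'n \<Rightarrow> 'n \<Rightarrow> 'n \<Rightarrow> real" where
  "berwald_P f z u i j k \<gamma> = berwald_curv_frame f z u i j (frame_h f z u k) (frame_v f z u \<gamma>)"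

definition tr_R ::
  "((real^'n) \<times> (real^'n) \<Rightarrow> real) \<Rightarrow> (real^'n) \<times> (real^'n) \<Rightarrow> ('n::finite \<Rightarrow> real^'n)
     \<Rightarrow> (real^'n) \<times> (real^'n) \<Rightarrow> (real^'n) \<times> (real^'n) \<Rightarrow> real" where
  "tr_R f z u X Y = 1/2 * (\<Sum>k\<in>UNIV. \<Sum>l\<in>UNIV. (\<Sum>i\<in>UNIV. berwald_R f z u i i k l) *
     wedge (coframe_h f z u k) (coframe_h f z u l) X Y)"

definition mean_berwald ::
  "((real^'n) \<times> (real^'n) \<Rightarrow> real) \<Rightarrow> (real^'n) \<times> (real^'n) \<Rightarrow> ('n \<Rightarrow> real^'n)
     \<Rightarrow> 'n::finite \<Rightarrow> 'n \<Rightarrow> real" where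
  "mean_berwald f z u \<gamma> \<mu> = (\<Sum>i\<in>UNIV. berwald_P f z u i i \<gamma> \<mu>)"

text \<open>The trace of the mean Berwald curvature: the common value of the sum over all adapted
  frames at \<open>z\<close>.\<close>

definition berwald_scalar ::
  "((real^'n::finite) \<times> (real^'n) \<Rightarrow> real) \<Rightarrow> (real^'n) \<times> (real^'n) \<Rightarrow> real" where
  "berwald_scalar f z =
     (THE s. \<forall>u. adapted f z u \<longrightarrow> s = (\<Sum>\<gamma>\<in>UNIV - {ix_n}. mean_berwald f z u \<gamma> \<gamma>))"

subsection \<open>S-curvature\<close>

definition distortion ::
  "((real^'n::finite) \<times> (real^'n) \<Rightarrow> real) \<Rightarrow> (real^'n \<Rightarrow> real) \<Rightarrow> (real^'n) \<times> (real^'n) \<Rightarrow> real" where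
  "distortion f s z = ln (sqrt (det (fund_tensor f z)) / s (fst z))"

definition S_curv ::
  "((real^'n::finite) \<times> (real^'n) \<Rightarrow> real) \<Rightarrow> (real^'n \<Rightarrow> real) \<Rightarrow> (real^'n) \<times> (real^'n) \<Rightarrow> real" where
  "S_curv f s z = frechet_derivative (distortion f s) (at z) (reeb f z)"

section \<open>Global notions on the sphere bundle\<close>

text \<open>Functions on \<open>SM\<close> are extended 0-homogeneously to \<open>TM\<close> minus the zero section, and the forms
  on \<open>SM\<close> are restrictions of forms there to the tangent spaces of \<open>SM\<close>.\<close>

definition sphere_bundle ::
  "('m, 'n::finite) chart set \<Rightarrow> ('m \<Rightarrow> ('m, 'n) tvec \<Rightarrow> real) \<Rightarrow> ('m, 'n) chart
     \<Rightarrow> ((real^'n) \<times> (real^'n)) set" where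
  "sphere_bundle A F \<kappa> = {z. fst z \<in> chart_img \<kappa> \<and> tm_rep A F \<kappa> z = 1}"

definition sphere_tangent ::
  "((real^'n::finite) \<times> (real^'n) \<Rightarrow> real) \<Rightarrow> (real^'n) \<times> (real^'n) \<Rightarrow> ((real^'n) \<times> (real^'n)) set" where
  "sphere_tangent f z = {X. frechet_derivative f (at z) X = 0}"

text \<open>Pullback along \<open>\<pi> : SM \<rightarrow> M\<close>, in coordinates \<open>(x, y) \<mapsto> x\<close>.\<close>

definition pull1 :: "('a \<Rightarrow> 'a \<Rightarrow> real) \<Rightarrow> 'a \<times> 'a \<Rightarrow> 'a \<times> 'a \<Rightarrow> real" where
  "pull1 \<beta> z X = \<beta> (fst z) (fst X)"

definition pull2 :: "('a \<Rightarrow> 'a \<Rightarrow> 'a \<Rightarrow> real) \<Rightarrow> 'a \<times> 'a \<Rightarrow> 'a \<times> 'a \<Rightarrow> 'a \<times> 'a \<Rightarrow> real" where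
  "pull2 \<beta> z X Y = \<beta> (fst z) (fst X) (fst Y)"

definition isotropic_berwald_scalar ::
  "('m, 'n::finite) chart set \<Rightarrow> ('m \<Rightarrow> ('m, 'n) tvec \<Rightarrow> real) \<Rightarrow> bool" where
  "isotropic_berwald_scalar A F \<longleftrightarrow> (\<exists>c. smooth_fun A c \<and>
     (\<forall>\<kappa>\<in>A. \<forall>z\<in>sphere_bundle A F \<kappa>.
        berwald_scalar (tm_rep A F \<kappa>) z = c (chart_inv \<kappa> (fst z))))"

definition isotropic_mean_berwald ::
  "('m, 'n::finite) chart set \<Rightarrow> ('m \<Rightarrow> ('m, 'n) tvec \<Rightarrow> real) \<Rightarrow> bool" where
  "isotropic_mean_berwald A F \<longleftrightarrow> (\<exists>c. smooth_fun A c \<and>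
     (\<forall>\<kappa>\<in>A. \<forall>z\<in>sphere_bundle A F \<kappa>. \<forall>u. adapted (tm_rep A F \<kappa>) z u \<longrightarrow>
        (\<forall>\<alpha>\<in>UNIV - {ix_n}. \<forall>\<beta>\<in>UNIV - {ix_n}.
           mean_berwald (tm_rep A F \<kappa>) z u \<alpha> \<beta> =
             1 / (real CARD('n) - 1) * c (chart_inv \<kappa> (fst z)) * (if \<alpha> = \<beta> then 1 else 0))))"

definition weakly_isotropic_S ::
  "('m, 'n::finite) chart set \<Rightarrow> ('m \<Rightarrow> ('m, 'n) tvec \<Rightarrow> real)
     \<Rightarrow> (('m, 'n) chart \<Rightarrow> real^'n \<Rightarrow> real) \<Rightarrow> bool" where
  "weakly_isotropic_S A F \<sigma> \<longleftrightarrow> (\<exists>c \<xi>. smooth_fun A c \<and> one_form A \<xi> \<and>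
     (\<forall>\<kappa>\<in>A. \<forall>z\<in>sphere_bundle A F \<kappa>.
        S_curv (tm_rep A F \<kappa>) (\<sigma> \<kappa>) z =
          1 / (real CARD('n) - 1) * c (chart_inv \<kappa> (fst z))
            + pull1 (form_rep A \<xi> \<kappa>) z (reeb (tm_rep A F \<kappa>) z)))"

text \<open>The equation \<open>S = e/(n-1) + \<pi>\<^sup>*\<xi>(G)\<close>.\<close>

definition S_decomposition ::
  "('m, 'n::finite) chart set \<Rightarrow> ('m \<Rightarrow> ('m, 'n) tvec \<Rightarrow> real)
     \<Rightarrow> (('m, 'n) chart \<Rightarrow> real^'n \<Rightarrow> real) \<Rightarrow> ('m \<Rightarrow> ('m, 'n) tvec \<Rightarrow> real) \<Rightarrow> bool" where
  "S_decomposition A F \<sigma> \<xi> \<longleftrightarrow>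
     (\<forall>\<kappa>\<in>A. \<forall>z\<in>sphere_bundle A F \<kappa>.
        S_curv (tm_rep A F \<kappa>) (\<sigma> \<kappa>) z =
          1 / (real CARD('n) - 1) * berwald_scalar (tm_rep A F \<kappa>) z
            + pull1 (form_rep A \<xi> \<kappa>) z (reeb (tm_rep A F \<kappa>) z))"

text \<open>The equation \<open>tr R = \<pi>\<^sup>*d\<xi> + de \<and> \<omega>\<^sup>n/(n-1)\<close> of 2-forms on \<open>SM\<close>.\<close>

definition trace_equation ::
  "('m, 'n::finite) chart set \<Rightarrow> ('m \<Rightarrow> ('m, 'n) tvec \<Rightarrow> real)
     \<Rightarrow> ('m \<Rightarrow> ('m, 'n) tvec \<Rightarrow> real) \<Rightarrow> bool" where
  "trace_equation A F \<xi> \<longleftrightarrow>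
     (\<forall>\<kappa>\<in>A. \<forall>z\<in>sphere_bundle A F \<kappa>. \<forall>u. adapted (tm_rep A F \<kappa>) z u \<longrightarrow>
        (\<forall>X\<in>sphere_tangent (tm_rep A F \<kappa>) z. \<forall>Y\<in>sphere_tangent (tm_rep A F \<kappa>) z.
           tr_R (tm_rep A F \<kappa>) z u X Y =
             pull2 (ext_deriv (form_rep A \<xi> \<kappa>)) z X Y
               + 1 / (real CARD('n) - 1) *
                 wedge (frechet_derivative (berwald_scalar (tm_rep A F \<kappa>)) (at z))
                   (hilbert_form (tm_rep A F \<kappa>) z) X Y))"

end

theory Submission imports Defs begin

text \<open>Write \<open>N\<close> for the trace \<open>\<partial>G\<^sup>m/\<partial>y\<^sup>m\<close> of the nonlinear connection. The Euler-Lagrange equation of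
  \<open>F\<^sup>2\<close> gives \<open>F S = N - y\<^sup>m \<partial>\<^sub>m ln \<sigma>\<close>, and the trace of the Berwald curvature is the exterior derivative
  of \<open>\<partial>N/\<partial>y\<^sup>k dx\<^sup>k\<close>; in particular \<open>e = F g\<^sup>k\<^sup>l N\<^sub>k\<^sub>l\<close>, where \<open>N\<^sub>k\<^sub>l\<close> is the Hessian of \<open>N\<close> in \<open>y\<close>.
  Since \<open>F g\<^sup>k\<^sup>l F\<^sub>k\<^sub>l = n - 1\<close>, a decomposition \<open>N = c F/(n - 1) + \<eta>\<^sub>i(x) y\<^sup>i\<close> implies \<open>e = c\<close> and all the other
  claims; the trace equation uses that \<open>F\<close> is constant along horizontal curves.

  Conversely, if \<open>e = c\<close> then \<open>h = N - c F/(n - 1)\<close> is 1-homogeneous with \<open>g\<^sup>k\<^sup>l h\<^sub>k\<^sub>l = 0\<close>, and one has to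
  see that \<open>h\<close> is linear on each fibre. This is the argument for the equality case of Minkowski's second
  inequality: on a fibre the field \<open>V\<^sup>k = det g g\<^sup>k\<^sup>p g\<^sup>l\<^sup>q h\<^sub>p\<^sub>q h\<^sub>l\<close> is annihilated by \<open>dF\<close> and, because \<open>g\<close> is
  a Hessian, has divergence \<open>det g |h\<^sub>k\<^sub>l|\<^sup>2\<close>. Multiplying \<open>V\<close> by a cutoff function of \<open>F\<close> and integrating
  over the fibre gives \<open>h\<^sub>k\<^sub>l = 0\<close>.\<close>

subsection \<open>Smooth functions\<close>

text \<open>A 1-homogeneous function is in general not smooth on the zero section, so
  \<open>h\<close> can only be used on the punctured fibre. The cutoff must therefore vanish near
  the origin as well as near infinity; being a function of \<open>F\<close>, it contributes nothing
  to the divergence because \<open>dF(V) = 0\<close>. Homogeneity carries the result from one shell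
  to the whole fibre. A vanishing Hessian only makes the gradient locally constant: linearity needs
  the punctured fibre to be connected, hence n >= 2 (on a line, |y| is a counterexample).

  The other obstacle is to get a global 1-form. The linear form found in a chart is built from N and
  ln sigma, neither of which is invariant, but \<open>F (S - c/(n-1))\<close> is, and this
  expression serves as xi. Invariance of S needs the transformation law of the spray; it is obtained
  by characterising the spray through \<open>Gam(E_y) = E_x\<close>, E = F^2, rather than by
  transforming the coefficients G^i.

  The hypotheses concern only the level F = 1, while the calculus needs an open set; homogeneity
  moves statements between the two.\<close>

abbreviation dd :: "'a::real_normed_vector \<Rightarrow> ('a \<Rightarrow> 'b::real_normed_vector) \<Rightarrow> 'a \<Rightarrow> 'b" where
  "dd v h z \<equiv> frechet_derivative h (at z) v"

lemma dd_eqI: "(h has_derivative h') (at z) \<Longrightarrow> dd v h z = h' v"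
  using frechet_derivative_at by metis

lemma diff_upto_mono: "diff_upto (Suc k) S f \<Longrightarrow> diff_upto k S f"
proof (induction k arbitrary: f)
  case 0
  then show ?case
    by (auto intro!: differentiable_imp_continuous_on differentiable_at_imp_differentiable_on)
next
  case (Suc k)
  then show ?case unfolding diff_upto.simps(2)[of "Suc k"] diff_upto.simps(2)[of k] by blast
qed

text \<open>Openness is essential: the derivatives in \<open>diff_upto\<close> are taken in the
  whole space, so agreement on \<open>S\<close> determines them only where \<open>S\<close> is a
  neighbourhood.\<close>

lemma diff_upto_cong:
  assumes "open S"
  shows "(\<And>x. x \<in> S \<Longrightarrow> f x = g x) \<Longrightarrow> diff_upto k S f \<Longrightarrow> diff_upto k S g"
proof (induction k arbitrary: f g)
  case 0
  then show ?case using continuous_on_cong[of S S f g] by simp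
next
  case (Suc k)
  have *: "(g has_derivative frechet_derivative f (at x)) (at x)" if "x \<in> S" for x
    using has_derivative_transform_within_open[of f "frechet_derivative f (at x)" x UNIV S g]
      that Suc.prems \<open>open S\<close> frechet_derivative_works by fastforce
  then have e: "dd v f x = dd v g x" if "x \<in> S" for x v
    using dd_eqI[OF *[OF that]] by simp
  show ?case unfolding diff_upto.simps
    using * Suc.IH[OF e] Suc.prems(2) by (auto simp: differentiable_def)
qed

lemma smooth_on_cong:
  "open S \<Longrightarrow> smooth_on S f \<Longrightarrow> (\<And>x. x \<in> S \<Longrightarrow> f x = g x) \<Longrightarrow> smooth_on S g"
  unfolding smooth_on_def using diff_upto_cong[of S f g] by blast

lemma smooth_on_differentiable: "smooth_on S f \<Longrightarrow> x \<in> S \<Longrightarrow> f differentiable (at x)"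
  unfolding smooth_on_def using diff_upto.simps(2) by blast

lemma smooth_on_has_derivative:
  "smooth_on S f \<Longrightarrow> x \<in> S \<Longrightarrow> (f has_derivative frechet_derivative f (at x)) (at x)"
  using smooth_on_differentiable frechet_derivative_works by blast

lemma smooth_on_dd: "smooth_on S f \<Longrightarrow> smooth_on S (dd v f)"
  unfolding smooth_on_def using diff_upto.simps(2) by blast

lemma smooth_on_continuous: "smooth_on S f \<Longrightarrow> continuous_on S f"
  unfolding smooth_on_def using diff_upto.simps(1) by blast

lemma smooth_on_const: "smooth_on S (\<lambda>_. c)"
proof -
  have "diff_upto k S (\<lambda>_. c)" for k
    by (induction k arbitrary: c) simp_all
  then show ?thesis by (simp add: smooth_on_def)
qed

lemma smooth_on_bounded_linear:
  assumes "bounded_linear l" shows "smooth_on S l"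
proof -
  have "diff_upto k S l" for k
  proof (cases k)
    case 0 then show ?thesis using assms linear_continuous_on by auto
  next
    case (Suc m)
    have "dd v l = (\<lambda>_. l v)" for v
      using dd_eqI[OF bounded_linear_imp_has_derivative[OF assms]] by auto
    then have "diff_upto m S (dd v l)" for v
      using smooth_on_const[of S "l v"] by (simp add: smooth_on_def)
    then show ?thesis using Suc assms bounded_linear_imp_differentiable by auto
  qed
  then show ?thesis by (simp add: smooth_on_def)
qed

lemma diff_upto_add:
  assumes "open S"
  shows "diff_upto k S f \<Longrightarrow> diff_upto k S g \<Longrightarrow> diff_upto k S (\<lambda>x. f x + g x)"
proof (induction k arbitrary: f g)
  case 0 then show ?case by (simp add: continuous_on_add)
next
  case (Suc k)
  have "dd v (\<lambda>x. f x + g x) x = dd v f x + dd v g x" if "x \<in> S" for x v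
    using Suc.prems that
    by (intro dd_eqI has_derivative_add) (auto simp: frechet_derivative_works[symmetric])
  then have "diff_upto k S (dd v (\<lambda>x. f x + g x))" for v
    using diff_upto_cong[OF assms, of "\<lambda>x. dd v f x + dd v g x"] Suc by fastforce
  then show ?case using Suc.prems by auto
qed

lemma diff_upto_mult:
  fixes f g :: "'a::real_normed_vector \<Rightarrow> real"
  assumes "open S"
  shows "diff_upto k S f \<Longrightarrow> diff_upto k S g \<Longrightarrow> diff_upto k S (\<lambda>x. f x * g x)"
proof (induction k arbitrary: f g)
  case 0 then show ?case by (simp add: continuous_on_mult)
next
  case (Suc k)
  have "dd v (\<lambda>x. f x * g x) x = f x * dd v g x + dd v f x * g x" if "x \<in> S" for x v
    using Suc.prems that
    by (intro dd_eqI has_derivative_mult) (auto simp: frechet_derivative_works[symmetric])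
  \<comment> \<open>The Leibniz terms contain \<open>f\<close> and \<open>g\<close>
    undifferentiated; these have one order more than needed, so \<open>diff_upto_mono\<close> lowers
    them.\<close>
  moreover have "diff_upto k S (\<lambda>x. f x * dd v g x + dd v f x * g x)" for v
    using Suc.prems Suc.IH diff_upto_mono[of k S f] diff_upto_mono[of k S g]
    by (intro diff_upto_add[OF assms]) auto
  ultimately have "diff_upto k S (dd v (\<lambda>x. f x * g x))" for v
    using diff_upto_cong[OF assms, of "\<lambda>x. f x * dd v g x + dd v f x * g x"] by fastforce
  then show ?case using Suc.prems by auto
qed

lemma smooth_on_add:
  "open S \<Longrightarrow> smooth_on S f \<Longrightarrow> smooth_on S g \<Longrightarrow> smooth_on S (\<lambda>x. f x + g x)"
  by (simp add: smooth_on_def diff_upto_add)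

lemma smooth_on_mult:
  fixes f g :: "'a::real_normed_vector \<Rightarrow> real"
  shows "open S \<Longrightarrow> smooth_on S f \<Longrightarrow> smooth_on S g \<Longrightarrow> smooth_on S (\<lambda>x. f x * g x)"
  by (simp add: smooth_on_def diff_upto_mult)

lemma smooth_on_minus:
  fixes f :: "'a::real_normed_vector \<Rightarrow> real"
  shows "open S \<Longrightarrow> smooth_on S f \<Longrightarrow> smooth_on S (\<lambda>x. - f x)"
  using smooth_on_mult[OF _ smooth_on_const[of S "-1"], of f] by simp

lemma smooth_on_diff:
  fixes f g :: "'a::real_normed_vector \<Rightarrow> real"
  shows "open S \<Longrightarrow> smooth_on S f \<Longrightarrow> smooth_on S g \<Longrightarrow> smooth_on S (\<lambda>x. f x - g x)"
  using smooth_on_add[OF _ _ smooth_on_minus, of S f g] by simp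

lemma smooth_on_sum:
  "open S \<Longrightarrow> (\<And>i. i \<in> I \<Longrightarrow> smooth_on S (f i)) \<Longrightarrow> smooth_on S (\<lambda>x. \<Sum>i\<in>I. f i x)"
  by (induction I rule: infinite_finite_induct) (auto simp: smooth_on_const smooth_on_add)

lemma smooth_on_prod:
  fixes f :: "'i \<Rightarrow> 'a::real_normed_vector \<Rightarrow> real"
  shows "open S \<Longrightarrow> (\<And>i. i \<in> I \<Longrightarrow> smooth_on S (f i)) \<Longrightarrow> smooth_on S (\<lambda>x. \<Prod>i\<in>I. f i x)"
  by (induction I rule: infinite_finite_induct) (auto simp: smooth_on_const smooth_on_mult)

lemma smooth_on_power:
  fixes f :: "'a::real_normed_vector \<Rightarrow> real"
  shows "open S \<Longrightarrow> smooth_on S f \<Longrightarrow> smooth_on S (\<lambda>x. f x ^ k)"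
  by (induction k) (auto simp: smooth_on_const smooth_on_mult)

text \<open>The derivative of 1/f is a product of factors 1/f, 1/f and f', so each order of 1/f
  follows from the previous one.\<close>

lemma smooth_on_inverse:
  fixes f :: "'a::real_normed_vector \<Rightarrow> real"
  assumes "open S" "smooth_on S f" "\<And>x. x \<in> S \<Longrightarrow> f x \<noteq> 0"
  shows "smooth_on S (\<lambda>x. inverse (f x))"
proof -
  have "diff_upto k S (\<lambda>x. inverse (f x))" for k
  proof (induction k)
    case 0
    then show ?case using assms smooth_on_continuous by (auto intro!: continuous_on_inverse)
  next
    case (Suc k)
    have d: "((\<lambda>x. inverse (f x)) has_derivative
        (\<lambda>h. - (inverse (f x) * dd h f x * inverse (f x)))) (at x)" if "x \<in> S" for x
      using that assms by (intro Deriv.has_derivative_inverse smooth_on_has_derivative) auto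
    have "diff_upto k S (\<lambda>x. (- 1) * (inverse (f x) * dd v f x * inverse (f x)))" for v
      using assms Suc smooth_on_dd[OF assms(2)] smooth_on_const[of S "-1::real"]
      by (intro diff_upto_mult) (auto simp: smooth_on_def)
    then have "diff_upto k S (dd v (\<lambda>x. inverse (f x)))" for v
      by (rule diff_upto_cong[OF assms(1), rotated, of _ "\<lambda>x. (- 1) * (inverse (f x) * dd v f x * inverse (f x))"])
        (simp add: dd_eqI[OF d])
    then show ?case using d by (auto simp: differentiable_def)
  qed
  then show ?thesis by (simp add: smooth_on_def)
qed

lemma smooth_on_divide:
  fixes f g :: "'a::real_normed_vector \<Rightarrow> real"
  shows "open S \<Longrightarrow> smooth_on S f \<Longrightarrow> smooth_on S g \<Longrightarrow> (\<And>x. x \<in> S \<Longrightarrow> g x \<noteq> 0)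
    \<Longrightarrow> smooth_on S (\<lambda>x. f x / g x)"
  unfolding divide_inverse by (intro smooth_on_mult smooth_on_inverse)

lemma has_derivative_ln_fun:
  fixes f :: "'a::real_normed_vector \<Rightarrow> real"
  assumes "smooth_on S f" "x \<in> S" "f x > 0"
  shows "((\<lambda>x. ln (f x)) has_derivative (\<lambda>h. dd h f x / f x)) (at x)"
  using has_derivative_ln[OF assms(3) smooth_on_has_derivative[OF assms(1,2)]]
  by (simp add: divide_inverse)

text \<open>No induction is required: the derivative f'/f is already known to be smooth.\<close>

lemma smooth_on_ln:
  fixes f :: "'a::real_normed_vector \<Rightarrow> real"
  assumes "open S" "smooth_on S f" "\<And>x. x \<in> S \<Longrightarrow> f x > 0"
  shows "smooth_on S (\<lambda>x. ln (f x))"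
proof -
  have "diff_upto k S (\<lambda>x. ln (f x))" for k
  proof (cases k)
    case 0
    then show ?thesis using assms smooth_on_continuous[OF assms(2)]
      by (auto intro!: continuous_on_ln simp: less_imp_neq[symmetric])
  next
    case (Suc m)
    have "smooth_on S (dd v (\<lambda>x. ln (f x)))" for v
      by (rule smooth_on_cong[OF assms(1) smooth_on_divide[OF assms(1) smooth_on_dd[OF assms(2), of v] assms(2)]])
        (use assms(3) in \<open>auto simp: less_imp_neq[symmetric] dd_eqI[OF has_derivative_ln_fun[OF assms(2)]]\<close>)
    then show ?thesis using Suc has_derivative_ln_fun[OF assms(2)] assms(3)
      by (auto simp: differentiable_def smooth_on_def)
  qed
  then show ?thesis by (simp add: smooth_on_def)
qed

text \<open>An affine map has constant derivative, so a directional derivative of the composite is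
  again a composite, with \<open>a\<close> differentiated in the fixed direction \<open>l v\<close>;
  the induction closes without a general chain rule. Projections and slices are the cases of
  interest.\<close>

lemma smooth_on_compose_affine:
  assumes "smooth_on U a" "open V" "bounded_linear l" "\<And>z. z \<in> V \<Longrightarrow> l z + c \<in> U"
  shows "smooth_on V (\<lambda>z. a (l z + c))"
proof -
  have "diff_upto k U a \<Longrightarrow> diff_upto k V (\<lambda>z. a (l z + c))" for k
  proof (induction k arbitrary: a)
    case 0
    then have "continuous_on U a" by simp
    moreover have "continuous_on V (\<lambda>z. l z + c)"
      using assms by (intro continuous_intros linear_continuous_on)
    ultimately show ?case using assms(4) by (auto intro: continuous_on_compose2[of U a])
  next
    case (Suc k)
    have d: "((\<lambda>z. a (l z + c)) has_derivative (\<lambda>h. dd (l h) a (l z + c))) (at z)" if "z \<in> V" for z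
    proof (rule has_derivative_compose[where f = "\<lambda>z. l z + c"])
      show "((\<lambda>z. l z + c) has_derivative l) (at z)"
        using has_derivative_add[OF bounded_linear_imp_has_derivative[OF assms(3)] has_derivative_const]
        by simp
      show "(a has_derivative (\<lambda>h. dd h a (l z + c))) (at (l z + c))"
        using that Suc.prems assms(4) by (simp add: frechet_derivative_works[symmetric])
    qed
    have "diff_upto k V (dd v (\<lambda>z. a (l z + c)))" for v
      by (rule diff_upto_cong[OF assms(2), of "\<lambda>z. dd (l v) a (l z + c)"])
        (use Suc in \<open>auto simp: dd_eqI[OF d]\<close>)
    then show ?case using d by (auto simp: differentiable_def)
  qed
  then show ?thesis using assms by (simp add: smooth_on_def)
qed

lemma smooth_on_fst:
  "open U \<Longrightarrow> open V \<Longrightarrow> smooth_on U a \<Longrightarrow> smooth_on (U \<times> V) (\<lambda>z. a (fst z))"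
  using smooth_on_compose_affine[of U a "U \<times> V" fst 0]
  by (auto simp: bounded_linear_fst open_Times)

lemma smooth_on_slice:
  assumes "open U" "smooth_on (U \<times> V) a" "y \<in> V"
  shows "smooth_on U (\<lambda>x. a (x, y))"
proof -
  have "bounded_linear (\<lambda>x::'a. (x, 0::'b))"
    by (intro bounded_linear_Pair bounded_linear_ident bounded_linear_zero)
  then show ?thesis
    using smooth_on_compose_affine[OF assms(2,1), of "\<lambda>x. (x, 0)" "(0, y)"] assms(3) by simp
qed

subsection \<open>Symmetry of second derivatives\<close>

text \<open>The mean value theorem is applied twice: along \<open>v\<close> to the difference in
  direction \<open>w\<close>, then along \<open>w\<close> to the derivative obtained.\<close>

lemma second_difference_mvt:
  fixes f :: "'a::real_normed_vector \<Rightarrow> real"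
  assumes S: "smooth_on S f" and s: "s > 0"
    and sub: "\<And>a b. 0 \<le> a \<Longrightarrow> a \<le> s \<Longrightarrow> 0 \<le> b \<Longrightarrow> b \<le> s \<Longrightarrow> z + a *\<^sub>R v + b *\<^sub>R w \<in> S"
  obtains a b where "0 < a" "a < s" "0 < b" "b < s"
    "f (z + s *\<^sub>R v + s *\<^sub>R w) - f (z + s *\<^sub>R v) - f (z + s *\<^sub>R w) + f z
      = s^2 * dd w (dd v f) (z + a *\<^sub>R v + b *\<^sub>R w)"
proof -
  have lin: "linear (frechet_derivative h (at x))" if "smooth_on S h" "x \<in> S" for h :: "'a \<Rightarrow> real" and x
    using smooth_on_has_derivative[OF that] has_derivative_linear by blast
  have der: "((\<lambda>t. h (p + t *\<^sub>R q)) has_real_derivative dd q h (p + t *\<^sub>R q)) (at t)"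
    if "smooth_on S h" "p + t *\<^sub>R q \<in> S" for h p q t
  proof -
    have "((\<lambda>t. h (p + t *\<^sub>R q)) has_derivative (\<lambda>r. dd (r *\<^sub>R q) h (p + t *\<^sub>R q))) (at t)"
      by (rule has_derivative_compose[where f = "\<lambda>t. p + t *\<^sub>R q", OF _ smooth_on_has_derivative[OF that]])
        (auto intro!: derivative_eq_intros)
    moreover have "(\<lambda>r. dd (r *\<^sub>R q) h (p + t *\<^sub>R q)) = (*) (dd q h (p + t *\<^sub>R q))"
      by (rule ext) (simp add: linear_scale[OF lin[OF that]])
    ultimately show ?thesis by (simp only: has_field_derivative_def)
  qed
  define \<phi> where "\<phi> t = f ((z + s *\<^sub>R w) + t *\<^sub>R v) - f (z + t *\<^sub>R v)" for t
  have "\<exists>a>0. a < s \<and> \<phi> s - \<phi> 0 = (s - 0) * (dd v f ((z + s *\<^sub>R w) + a *\<^sub>R v) - dd v f (z + a *\<^sub>R v))"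
    unfolding \<phi>_def
  proof (rule MVT2[OF s])
    fix t assume "0 \<le> t" "t \<le> s"
    then have "z + s *\<^sub>R w + t *\<^sub>R v \<in> S" "z + t *\<^sub>R v \<in> S"
      using s sub[of t s] sub[of t 0] by (simp_all add: ac_simps)
    then show "((\<lambda>t. f (z + s *\<^sub>R w + t *\<^sub>R v) - f (z + t *\<^sub>R v)) has_real_derivative
        dd v f (z + s *\<^sub>R w + t *\<^sub>R v) - dd v f (z + t *\<^sub>R v)) (at t)"
      by (intro DERIV_diff der[OF S])
  qed
  then obtain a where a: "0 < a" "a < s"
    and 1: "\<phi> s - \<phi> 0 = s * (dd v f ((z + s *\<^sub>R w) + a *\<^sub>R v) - dd v f (z + a *\<^sub>R v))" by auto
  have "\<exists>b>0. b < s \<and> dd v f ((z + a *\<^sub>R v) + s *\<^sub>R w) - dd v f ((z + a *\<^sub>R v) + 0 *\<^sub>R w)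
      = (s - 0) * dd w (dd v f) ((z + a *\<^sub>R v) + b *\<^sub>R w)"
    by (rule MVT2[OF s]) (use a sub[of a] in \<open>auto intro!: der smooth_on_dd[OF S]\<close>)
  then obtain b where b: "0 < b" "b < s"
    and 2: "dd v f ((z + a *\<^sub>R v) + s *\<^sub>R w) - dd v f (z + a *\<^sub>R v)
      = s * dd w (dd v f) ((z + a *\<^sub>R v) + b *\<^sub>R w)" by auto
  have c: "z + s *\<^sub>R w + a *\<^sub>R v = z + a *\<^sub>R v + s *\<^sub>R w" "z + s *\<^sub>R w + s *\<^sub>R v = z + s *\<^sub>R v + s *\<^sub>R w"
    by (simp_all add: ac_simps)
  show thesis
    by (rule that[OF a b]) (use 1 2 in \<open>simp add: \<phi>_def c power2_eq_square\<close>)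
qed

text \<open>The second difference over a small parallelogram is symmetric in \<open>v\<close> and
  \<open>w\<close>, and by the mean value theorem it equals s^2 times either mixed derivative at
  some nearby point. Continuity of both derivatives does the rest.\<close>

lemma dd_commute:
  fixes f :: "'a::real_normed_vector \<Rightarrow> real"
  assumes "open S" "smooth_on S f" "z \<in> S"
  shows "dd v (dd w f) z = dd w (dd v f) z"
proof -
  let ?p = "dd w (dd v f)" and ?q = "dd v (dd w f)"
  have small: "\<exists>d>0. \<forall>a b. 0 \<le> a \<and> a \<le> d \<and> 0 \<le> b \<and> b \<le> d \<longrightarrow>
      z + a *\<^sub>R v + b *\<^sub>R w \<in> S \<and> dist (g (z + a *\<^sub>R v + b *\<^sub>R w)) (g z) < \<epsilon>"
    if e: "\<epsilon> > 0" and g: "continuous_on S g" for g :: "'a \<Rightarrow> real" and \<epsilon>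
  proof -
    have "isCont g z" using g assms(1,3) continuous_on_eq_continuous_at by blast
    then obtain r1 where r1: "r1 > 0" "\<And>x. dist x z < r1 \<Longrightarrow> dist (g x) (g z) < \<epsilon>"
      using e unfolding continuous_at_eps_delta by blast
    obtain r2 where r2: "r2 > 0" "ball z r2 \<subseteq> S"
      using assms(1,3) open_contains_ball by blast
    define r where "r = min r1 r2"
    \<comment> \<open>The summand 1 keeps the denominator positive when \<open>v\<close> and
      \<open>w\<close> are both 0.\<close>
    define d where "d = r / (2 * (norm v + norm w + 1))"
    have r: "r > 0" using r1 r2 by (simp add: r_def)
    have P: "norm v + norm w + 1 > 0" by (smt (verit) norm_ge_zero)
    have "d > 0" using r P by (simp add: d_def)
    moreover have "dist (z + a *\<^sub>R v + b *\<^sub>R w) z < r" if "0 \<le> a" "a \<le> d" "0 \<le> b" "b \<le> d" for a b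
    proof -
      have "dist (z + a *\<^sub>R v + b *\<^sub>R w) z \<le> a * norm v + b * norm w"
        using norm_triangle_ineq[of "a *\<^sub>R v" "b *\<^sub>R w"] that by (simp add: dist_norm add.assoc)
      also have "\<dots> \<le> d * norm v + d * norm w"
        using that by (intro add_mono mult_right_mono) auto
      also have "\<dots> \<le> d * (norm v + norm w + 1)"
        using \<open>d > 0\<close> by (simp add: algebra_simps)
      also have "\<dots> = r / 2" using P by (simp only: d_def) (simp add: field_simps)
      also have "\<dots> < r" using r by simp
      finally show ?thesis .
    qed
    moreover have "x \<in> S" if "dist x z < r" for x
      using r2(2) that by (auto simp: r_def dist_commute)
    ultimately show ?thesis using r1(2) by (metis r_def min_less_iff_conj)
  qed
  have "\<bar>?p z - ?q z\<bar> \<le> \<epsilon>" if "\<epsilon> > 0" for \<epsilon>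
  proof -
    have cp: "continuous_on S ?p" and cq: "continuous_on S ?q"
      using smooth_on_continuous smooth_on_dd assms(2) by blast+
    have e2: "\<epsilon> / 2 > 0" using that by simp
    obtain d1 where d1: "d1 > 0" "\<And>a b. 0 \<le> a \<and> a \<le> d1 \<and> 0 \<le> b \<and> b \<le> d1 \<Longrightarrow>
        z + a *\<^sub>R v + b *\<^sub>R w \<in> S \<and> dist (?p (z + a *\<^sub>R v + b *\<^sub>R w)) (?p z) < \<epsilon> / 2"
      using small[OF e2 cp] by blast
    obtain d2 where d2: "d2 > 0" "\<And>a b. 0 \<le> a \<and> a \<le> d2 \<and> 0 \<le> b \<and> b \<le> d2 \<Longrightarrow>
        z + a *\<^sub>R v + b *\<^sub>R w \<in> S \<and> dist (?q (z + a *\<^sub>R v + b *\<^sub>R w)) (?q z) < \<epsilon> / 2"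
      using small[OF e2 cq] by blast
    define s where "s = min d1 d2"
    have s: "s > 0" using d1 d2 by (simp add: s_def)
    obtain a b where ab: "0 < a" "a < s" "0 < b" "b < s"
      "f (z + s *\<^sub>R v + s *\<^sub>R w) - f (z + s *\<^sub>R v) - f (z + s *\<^sub>R w) + f z = s^2 * ?p (z + a *\<^sub>R v + b *\<^sub>R w)"
      using second_difference_mvt[OF assms(2) s, of z v w] d1(2) by (auto simp: s_def)
    have sub: "z + a *\<^sub>R w + b *\<^sub>R v \<in> S" if "0 \<le> a" "a \<le> s" "0 \<le> b" "b \<le> s" for a b
      using d1(2)[of b a] that by (simp add: s_def ac_simps)
    obtain a' b' where ab': "0 < a'" "a' < s" "0 < b'" "b' < s"
      "f (z + s *\<^sub>R w + s *\<^sub>R v) - f (z + s *\<^sub>R w) - f (z + s *\<^sub>R v) + f z = s^2 * ?q (z + a' *\<^sub>R w + b' *\<^sub>R v)"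
      using second_difference_mvt[OF assms(2) s, of z w v] sub by blast
    \<comment> \<open>The two second differences coincide; only the points at which the mixed
      derivatives are evaluated differ.\<close>
    have "z + s *\<^sub>R w + s *\<^sub>R v = z + s *\<^sub>R v + s *\<^sub>R w" by (simp add: ac_simps)
    then have "s^2 * ?p (z + a *\<^sub>R v + b *\<^sub>R w) = s^2 * ?q (z + a' *\<^sub>R w + b' *\<^sub>R v)"
      using ab(5) ab'(5) by (simp add: algebra_simps)
    then have "?p (z + a *\<^sub>R v + b *\<^sub>R w) = ?q (z + b' *\<^sub>R v + a' *\<^sub>R w)"
      using s by (simp add: ac_simps)
    moreover have "a \<le> d1" "b \<le> d1" "a' \<le> d2" "b' \<le> d2"
      using ab(2,4) ab'(2,4) by (simp_all add: s_def)
    ultimately show ?thesis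
      using d1(2)[of a b] d2(2)[of b' a'] ab(1,3) ab'(1,3) unfolding dist_real_def by linarith
  qed
  then show ?thesis using field_le_epsilon[of "\<bar>?p z - ?q z\<bar>" 0] by auto
qed

subsection \<open>Positive definite matrices\<close>

text \<open>\<open>matrix_inv\<close> is defined by choice, so an exhibited inverse must be
  identified with the chosen one; for square matrices a one-sided inverse suffices.\<close>

lemma matrix_inv_eqI:
  fixes A :: "real^'n::finite^'n"
  assumes "A ** B = mat 1" shows "matrix_inv A = B"
proof -
  have B: "B ** A = mat 1" using assms matrix_left_right_inverse by blast
  then have "\<exists>C. A ** C = mat 1 \<and> C ** A = mat 1" using assms by blast
  then have "A ** matrix_inv A = mat 1" unfolding matrix_inv_def by (metis (mono_tags, lifting) someI_ex)
  then show ?thesis by (metis B matrix_mul_assoc matrix_mul_lid matrix_mul_rid)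
qed

lemma matrix_inv_mult:
  fixes A :: "real^'n::finite^'n"
  assumes "det A \<noteq> 0"
  shows "A ** matrix_inv A = mat 1" "matrix_inv A ** A = mat 1"
proof -
  obtain B where "A ** B = mat 1" using assms invertible_det_nz[of A] by (auto simp: invertible_def)
  moreover from this have "matrix_inv A = B" by (rule matrix_inv_eqI)
  ultimately show "A ** matrix_inv A = mat 1" "matrix_inv A ** A = mat 1"
    by (simp_all add: matrix_left_right_inverse)
qed

lemma bilinear_sum_eq_inner:
  fixes g :: "real^'n::finite^'n"
  shows "(\<Sum>k\<in>UNIV. \<Sum>l\<in>UNIV. g $ k $ l * v $ k * w $ l) = v \<bullet> (g *v w)"
  by (simp add: inner_vec_def matrix_vector_mult_def sum_distrib_left ac_simps)

locale posdef =
  fixes g :: "real^'n::finite^'n"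
  assumes sym: "g $ i $ j = g $ j $ i"
    and pos: "w \<noteq> 0 \<Longrightarrow> w \<bullet> (g *v w) > 0"
begin

lemma inner_commute: "v \<bullet> (g *v w) = w \<bullet> (g *v v)"
  unfolding bilinear_sum_eq_inner[symmetric]
  by (subst sum.swap) (simp add: sym ac_simps)

text \<open>This provides adapted frames, whose vector at \<open>ix_n\<close> is prescribed. The
  index type is unordered, so the induction runs over finite sets of indices that always contain
  \<open>i0\<close>.\<close>

lemma gram_schmidt:
  fixes i0 :: 'n
  assumes "a \<bullet> (g *v a) = 1"
  shows "\<exists>u. (\<forall>i j. u i \<bullet> (g *v u j) = (if i = j then 1 else 0)) \<and> u i0 = a"
proof -
  have "\<exists>u. (\<forall>i\<in>insert i0 I. \<forall>j\<in>insert i0 I. u i \<bullet> (g *v u j) = (if i = j then 1 else 0)) \<and> u i0 = a"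
    for I :: "'n set"
  proof (induction I rule: finite_induct[OF finite])
    case 1
    then show ?case using assms by (intro exI[of _ "\<lambda>_. a"]) simp
  next
    case (2 m I)
    let ?J = "insert i0 I"
    show ?case
    proof (cases "m = i0")
      case True
      then have "insert i0 (insert m I) = ?J" by simp
      then show ?thesis using 2 by metis
    next
      case False
      obtain u where u: "\<And>i j. i \<in> ?J \<Longrightarrow> j \<in> ?J \<Longrightarrow> u i \<bullet> (g *v u j) = (if i = j then 1 else 0)" "u i0 = a"
        using 2 by blast
      have m: "m \<notin> ?J" using 2 False by simp
      \<comment> \<open>Fewer than n vectors cannot span, which yields the vector \<open>w\<close>
        to be orthogonalised and normalised.\<close>
      then have "card ?J < card (UNIV :: 'n set)"
        by (intro psubset_card_mono) auto
      moreover have "dim (span (u ` ?J)) \<le> card ?J"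
        by (metis card_image_le dim_le_card dim_span finite finite_imageI le_trans span_superset)
      moreover have "dim (UNIV :: (real^'n) set) = CARD('n)" by simp
      ultimately have "span (u ` ?J) \<noteq> UNIV" by (metis leD)
      then obtain w where w: "w \<notin> span (u ` ?J)" by blast
      define w' where "w' = w - (\<Sum>i\<in>?J. (w \<bullet> (g *v u i)) *\<^sub>R u i)"
      have "(\<Sum>i\<in>?J. (w \<bullet> (g *v u i)) *\<^sub>R u i) \<in> span (u ` ?J)"
        by (intro span_sum span_scale span_base) auto
      then have "w' \<noteq> 0" using w by (auto simp: w'_def)
      then have p: "w' \<bullet> (g *v w') > 0" by (rule pos)
      have orth: "w' \<bullet> (g *v u j) = 0" if "j \<in> ?J" for j
      proof -
        have "w' \<bullet> (g *v u j) = w \<bullet> (g *v u j) - (\<Sum>i\<in>?J. (w \<bullet> (g *v u i)) * (u i \<bullet> (g *v u j)))"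
          by (simp add: w'_def inner_diff_left inner_sum_left)
        also have "(\<Sum>i\<in>?J. (w \<bullet> (g *v u i)) * (u i \<bullet> (g *v u j)))
            = (\<Sum>i\<in>?J. if i = j then w \<bullet> (g *v u i) else 0)"
          using that by (intro sum.cong) (auto simp: u(1))
        also have "\<dots> = w \<bullet> (g *v u j)" using that by (subst sum.delta) auto
        finally show ?thesis by simp
      qed
      define r where "r = 1 / sqrt (w' \<bullet> (g *v w'))"
      define v where "v = r *\<^sub>R w'"
      have v1: "v \<bullet> (g *v u j) = 0" "u j \<bullet> (g *v v) = 0" if "j \<in> ?J" for j
        using orth[OF that] inner_commute[of v "u j"] by (simp_all add: v_def)
      have "v \<bullet> (g *v v) = r * r * (w' \<bullet> (g *v w'))"
        by (simp add: v_def matrix_vector_mult_scaleR)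
      also have "\<dots> = 1" using p by (simp add: r_def)
      finally have v2: "v \<bullet> (g *v v) = 1" .
      show ?thesis
        using m v1 v2 u False by (intro exI[of _ "u(m := v)"]) auto
    qed
  qed
  from this[of UNIV] show ?thesis by simp
qed

text \<open>The matrix with rows \<open>u\<^sub>i\<close> satisfies \<open>U g U\<^sup>T = 1\<close>, so \<open>U\<^sup>T U\<close> inverts \<open>g\<close>.\<close>

lemma orthonormal_frame:
  fixes u :: "'n \<Rightarrow> real^'n"
  assumes "\<And>i j. u i \<bullet> (g *v u j) = (if i = j then 1 else 0)"
  shows orthonormal_frame_inv: "(\<Sum>i\<in>UNIV. u i $ k * u i $ l) = matrix_inv g $ k $ l"
    and orthonormal_frame_dual:
      "(\<Sum>i\<in>UNIV. (\<Sum>m\<in>UNIV. g $ m $ k * u i $ m) * u i $ l) = (if k = l then 1 else 0)"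
    and orthonormal_frame_det: "det g > 0"
proof -
  define U where "U = (\<chi> i. u i)"
  have row: "(U ** g) $ i $ k = (\<Sum>m\<in>UNIV. g $ m $ k * u i $ m)" for i k
    by (simp add: U_def matrix_matrix_mult_def ac_simps)
  have 1: "(U ** g) ** transpose U = mat 1"
  proof (intro vec_eq_iff[THEN iffD2] allI)
    fix i j
    have "((U ** g) ** transpose U) $ i $ j = (\<Sum>k\<in>UNIV. \<Sum>m\<in>UNIV. g $ m $ k * u i $ m * u j $ k)"
      unfolding matrix_matrix_mult_def[of "U ** g"]
      by (simp add: row sum_distrib_right transpose_def) (simp add: U_def)
    also have "\<dots> = u i \<bullet> (g *v u j)"
      unfolding bilinear_sum_eq_inner[symmetric] by (rule sum.swap)
    finally show "((U ** g) ** transpose U) $ i $ j = mat 1 $ i $ j"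
      using assms by (simp add: mat_def)
  qed
  then have 2: "transpose U ** (U ** g) = mat 1" by (simp add: matrix_left_right_inverse)
  then have "(transpose U ** U) ** g = mat 1" by (simp add: matrix_mul_assoc)
  then have "g ** (transpose U ** U) = mat 1" by (simp add: matrix_left_right_inverse)
  then have "matrix_inv g = transpose U ** U" by (rule matrix_inv_eqI)
  then show "(\<Sum>i\<in>UNIV. u i $ k * u i $ l) = matrix_inv g $ k $ l"
    by (simp add: matrix_matrix_mult_def transpose_def U_def)
  have "(transpose U ** (U ** g)) $ l $ k = (\<Sum>i\<in>UNIV. (\<Sum>m\<in>UNIV. g $ m $ k * u i $ m) * u i $ l)"
    unfolding matrix_matrix_mult_def[of "transpose U"]
    by (simp add: row transpose_def) (simp add: U_def ac_simps)
  then show "(\<Sum>i\<in>UNIV. (\<Sum>m\<in>UNIV. g $ m $ k * u i $ m) * u i $ l) = (if k = l then 1 else 0)"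
    using 2 by (auto simp: mat_def)
  have "det U * det g * det U = 1"
    using arg_cong[OF 1, of det] by (simp add: det_mul)
  then have "(det U)\<^sup>2 * det g = 1" by (simp add: power2_eq_square ac_simps)
  then show "det g > 0"
    by (metis zero_less_mult_pos zero_less_one zero_less_power2 mult_zero_left power_zero_numeral zero_neq_one)
qed

text \<open>An orthonormal basis exists, and its matrix U satisfies (det U)^2 det g = 1; eigenvalues
  are avoided.\<close>

lemma det_pos: "det g > 0"
proof -
  define b :: "real^'n" where "b = axis undefined 1"
  have "b \<noteq> 0" by (simp add: b_def)
  then have p: "b \<bullet> (g *v b) > 0" by (rule pos)
  define a where "a = (1 / sqrt (b \<bullet> (g *v b))) *\<^sub>R b"
  have "a \<bullet> (g *v a) = 1" using p by (simp add: a_def matrix_vector_mult_scaleR)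
  from gram_schmidt[OF this] orthonormal_frame_det show ?thesis by blast
qed

lemma inv_right: "g ** matrix_inv g = mat 1" and inv_left: "matrix_inv g ** g = mat 1"
  using matrix_inv_mult[of g] det_pos by auto

lemma sum_inv:
  "(\<Sum>k\<in>UNIV. matrix_inv g $ i $ k * g $ k $ j) = (if i = j then 1 else 0)"
  "(\<Sum>k\<in>UNIV. g $ i $ k * matrix_inv g $ k $ j) = (if i = j then 1 else 0)"
  using arg_cong[OF inv_left, of "\<lambda>M. M $ i $ j"] arg_cong[OF inv_right, of "\<lambda>M. M $ i $ j"]
  by (simp_all add: matrix_matrix_mult_def mat_def)

lemma inv_sym: "matrix_inv g $ i $ j = matrix_inv g $ j $ i"
proof -
  have "transpose g = g" by (simp add: transpose_def vec_eq_iff sym)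
  then have "g ** transpose (matrix_inv g) = mat 1"
    by (metis inv_left matrix_transpose_mul transpose_mat)
  then have "matrix_inv g = transpose (matrix_inv g)" by (rule matrix_inv_eqI)
  then have "matrix_inv g $ i $ j = transpose (matrix_inv g) $ i $ j" by (rule arg_cong)
  then show ?thesis by (simp add: transpose_def)
qed

end

subsection \<open>Determinant and inverse of a smooth family of matrices\<close>

lemma smooth_on_det:
  fixes A :: "'a::real_normed_vector \<Rightarrow> real^'n::finite^'n"
  assumes "open S" "\<And>i j. smooth_on S (\<lambda>z. A z $ i $ j)"
  shows "smooth_on S (\<lambda>z. det (A z))"
  unfolding det_def
  by (intro smooth_on_sum smooth_on_mult smooth_on_prod smooth_on_const assms)

text \<open>Cramer's rule for the l-th unit vector. Its purpose is smoothness of the inverse, whose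
  entries become quotients of polynomials in the entries of \<open>A\<close>.\<close>

lemma matrix_inv_cramer:
  fixes A :: "real^'n::finite^'n"
  assumes "det A \<noteq> 0"
  shows "matrix_inv A $ k $ l = det (\<chi> i j. if j = k then (if i = l then 1 else 0) else A $ i $ j) / det A"
proof -
  have "A ** matrix_inv A = mat 1"
    using matrix_inv_mult[OF assms] by simp
  then have "A *v (\<chi> i. matrix_inv A $ i $ l) = (\<chi> i. if i = l then 1 else 0)"
    by (simp add: matrix_matrix_mult_def matrix_vector_mult_def mat_def vec_eq_iff)
  from cramer[OF assms, THEN iffD1, OF this, THEN arg_cong, of "\<lambda>v. v $ k"] show ?thesis
    by (simp cong: if_cong)
qed

lemma smooth_on_matrix_inv:
  fixes A :: "'a::real_normed_vector \<Rightarrow> real^'n::finite^'n"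
  assumes "open S" "\<And>i j. smooth_on S (\<lambda>z. A z $ i $ j)" "\<And>z. z \<in> S \<Longrightarrow> det (A z) \<noteq> 0"
  shows "smooth_on S (\<lambda>z. matrix_inv (A z) $ k $ l)"
proof (rule smooth_on_cong[OF assms(1)])
  show "smooth_on S (\<lambda>z. det (\<chi> i j. if j = k then (if i = l then 1 else 0) else A z $ i $ j) / det (A z))"
  proof (intro smooth_on_divide smooth_on_det assms)
    fix i j show "smooth_on S (\<lambda>z. (\<chi> i j. if j = k then (if i = l then 1 else 0) else A z $ i $ j) $ i $ j)"
      using assms(2) by (cases "j = k") (simp_all add: smooth_on_const)
  qed
qed (simp add: matrix_inv_cramer assms(3))

text \<open>Jacobi's formula. Differentiating row by row gives determinants in which row i is
  replaced by that of the derivative D. With B the inverse, D = (D B) A, so the new row is a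
  combination of the rows of A, and only its i-th coefficient (D B)_ii matters.\<close>

lemma dd_det:
  fixes A :: "'a::real_normed_vector \<Rightarrow> real^'n::finite^'n"
  assumes "\<And>i j. (\<lambda>z. A z $ i $ j) differentiable (at z)" "det (A z) \<noteq> 0"
  shows "dd v (\<lambda>z. det (A z)) z
    = det (A z) * (\<Sum>i\<in>UNIV. \<Sum>j\<in>UNIV. matrix_inv (A z) $ i $ j * dd v (\<lambda>z. A z $ j $ i) z)"
proof -
  define D where "D = (\<chi> i j. dd v (\<lambda>z. A z $ i $ j) z)"
  define B where "B = matrix_inv (A z)"
  have BA: "B ** A z = mat 1"
    unfolding B_def using matrix_inv_mult[OF assms(2)] by simp
  let ?P = "{p. p permutes (UNIV :: 'n set)}"
  have "((\<lambda>z. det (A z)) has_derivative (\<lambda>h. \<Sum>p\<in>?P. of_int (sign p) *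
      (\<Sum>i\<in>UNIV. dd h (\<lambda>z. A z $ i $ p i) z * (\<Prod>j\<in>UNIV - {i}. A z $ j $ p j)))) (at z)"
    unfolding det_def
    by (intro has_derivative_sum has_derivative_mult_right has_derivative_prod)
      (use assms frechet_derivative_works in blast)
  then have "dd v (\<lambda>z. det (A z)) z = (\<Sum>p\<in>?P. of_int (sign p) *
      (\<Sum>i\<in>UNIV. D $ i $ p i * (\<Prod>j\<in>UNIV - {i}. A z $ j $ p j)))"
    by (subst dd_eqI) (auto simp: D_def)
  also have "\<dots> = (\<Sum>i\<in>UNIV. \<Sum>p\<in>?P. of_int (sign p) * (D $ i $ p i * (\<Prod>j\<in>UNIV - {i}. A z $ j $ p j)))"
    unfolding sum_distrib_left by (rule sum.swap)
  also have "\<dots> = (\<Sum>i\<in>UNIV. det (\<chi> r. if r = i then D $ i else A z $ r))"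
    unfolding det_def
    by (intro sum.cong refl arg_cong2[where f = "(*)"], subst prod.remove[of UNIV]) (auto intro!: prod.cong)
  also have "\<dots> = (\<Sum>i\<in>UNIV. (D ** B) $ i $ i * det (A z))"
  proof (rule sum.cong[OF refl])
    fix i
    have row: "row m (A z) = A z $ m" for m by (simp add: row_def)
    have "(\<Sum>m\<in>UNIV. (D ** B) $ i $ m *s row m (A z)) = ((D ** B) ** A z) $ i"
      by (simp add: vec_eq_iff matrix_matrix_mult_def[of "D ** B"] row_def)
    also have "\<dots> = D $ i" by (simp add: matrix_mul_assoc[symmetric] BA)
    finally have "(\<Sum>m\<in>UNIV. (D ** B) $ i $ m *s row m (A z)) = D $ i" .
    then show "det (\<chi> r. if r = i then D $ i else A z $ r) = (D ** B) $ i $ i * det (A z)"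
      using cramer_lemma_transpose[of i "(D ** B) $ i" "A z"] by (simp add: row cong: if_cong)
  qed
  also have "\<dots> = det (A z) * (\<Sum>i\<in>UNIV. \<Sum>j\<in>UNIV. B $ j $ i * D $ i $ j)"
    by (simp add: matrix_matrix_mult_def sum_distrib_left ac_simps)
  also have "(\<Sum>i\<in>UNIV. \<Sum>j\<in>UNIV. B $ j $ i * D $ i $ j) = (\<Sum>i\<in>UNIV. \<Sum>j\<in>UNIV. B $ i $ j * D $ j $ i)"
    by (rule sum.swap)
  finally show ?thesis by (simp add: B_def D_def)
qed

subsection \<open>The divergence theorem for compactly supported fields\<close>

text \<open>By translation invariance the difference quotients of \<open>w\<close> integrate to 0.\<close>

lemma integral_dd_compact_support:
  fixes w :: "'a::euclidean_space \<Rightarrow> real"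
  assumes diff: "\<And>y. w differentiable (at y)"
    and cont: "continuous_on UNIV (dd v w)"
    and supp: "\<And>y. norm y > R \<Longrightarrow> w y = 0"
  shows "integrable lborel (dd v w)" "integral\<^sup>L lborel (dd v w) = 0"
proof -
  have der: "(w has_derivative frechet_derivative w (at y)) (at y)" for y
    using diff frechet_derivative_works by blast
  have lin: "linear (frechet_derivative w (at y))" for y
    using der has_derivative_linear by blast
  have line: "((\<lambda>t. w (y + t *\<^sub>R v)) has_real_derivative dd v w (y + t *\<^sub>R v)) (at t)" for y t
  proof -
    have "((\<lambda>t. w (y + t *\<^sub>R v)) has_derivative (\<lambda>r. dd (r *\<^sub>R v) w (y + t *\<^sub>R v))) (at t)"
      by (rule has_derivative_compose[where f = "\<lambda>t. y + t *\<^sub>R v", OF _ der])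
        (auto intro!: derivative_eq_intros)
    moreover have "(\<lambda>r. dd (r *\<^sub>R v) w (y + t *\<^sub>R v)) = (*) (dd v w (y + t *\<^sub>R v))"
      by (rule ext) (simp add: linear_scale[OF lin])
    ultimately show ?thesis by (simp only: has_field_derivative_def)
  qed
  have w0: "dd v w y = 0" if "norm y > R" for y
  proof -
    have "open {y::'a. norm y > R}"
      by (intro open_Collect_less continuous_intros)
    then have "(w has_derivative (\<lambda>_. 0)) (at y)"
      by (rule has_derivative_transform_within_open[OF has_derivative_const]) (use that supp in auto)
    from dd_eqI[OF this] show ?thesis by simp
  qed
  have "bounded (dd v w ` cball 0 R)"
    by (intro compact_imp_bounded compact_continuous_image continuous_on_subset[OF cont]) auto
  then obtain M where M: "M > 0" "\<And>y. y \<in> cball 0 R \<Longrightarrow> \<bar>dd v w y\<bar> \<le> M"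
    unfolding bounded_pos by auto
  have M: "\<bar>dd v w y\<bar> \<le> M" for y
    using M w0[of y] by (cases "norm y > R") auto
  define q where "q n y = (w (y + (1 / Suc n) *\<^sub>R v) - w y) * Suc n" for n y
  have cw: "continuous_on UNIV w"
    by (intro differentiable_imp_continuous_on differentiable_at_imp_differentiable_on diff)
  have wm[measurable]: "w \<in> borel_measurable borel"
    by (rule borel_measurable_continuous_onI[OF cw])
  have qm[measurable]: "q n \<in> borel_measurable borel" for n
    unfolding q_def by measurable
  have iw: "integrable lborel w"
  proof -
    have "integrable lborel (\<lambda>y. indicator (cball 0 R) y *\<^sub>R w y)"
      by (rule borel_integrable_compact) (auto intro: continuous_on_subset[OF cw])
    also have "(\<lambda>y. indicator (cball 0 R) y *\<^sub>R w y) = w"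
      using supp by (auto simp: indicator_def fun_eq_iff not_le[symmetric])
    finally show ?thesis .
  qed
  have tr: "integrable lborel (\<lambda>y. w (y + c))" "integral\<^sup>L lborel (\<lambda>y. w (y + c)) = integral\<^sup>L lborel w" for c
  proof -
    have "integrable (distr lborel borel ((+) c)) w" using iw by (simp add: lborel_distr_plus)
    then show "integrable lborel (\<lambda>y. w (y + c))"
      by (subst (asm) integrable_distr_eq) (auto simp: ac_simps)
    have "integral\<^sup>L lborel w = integral\<^sup>L (distr lborel borel ((+) c)) w" by (simp add: lborel_distr_plus)
    also have "\<dots> = integral\<^sup>L lborel (\<lambda>y. w (y + c))"
      by (subst integral_distr) (auto simp: ac_simps)
    finally show "integral\<^sup>L lborel (\<lambda>y. w (y + c)) = integral\<^sup>L lborel w" ..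
  qed
  have q0: "integral\<^sup>L lborel (q n) = 0" for n
    unfolding q_def using tr[of "(1 / Suc n) *\<^sub>R v"] iw
    by simp
  \<comment> \<open>Domination for the limit: by the mean value theorem each quotient is a value of
    the derivative, hence at most M. It vanishes outside the ball enlarged by |v|, as the step
    1/(n+1) is at most 1.\<close>
  have bound: "\<bar>q n y\<bar> \<le> M * indicator (cball 0 (R + norm v)) y" for n y
  proof (cases "norm y \<le> R + norm v")
    case True
    have s: "(0::real) < 1 / Suc n" by simp
    obtain t where t: "w (y + (1 / Suc n) *\<^sub>R v) - w (y + 0 *\<^sub>R v) = (1 / Suc n - 0) * dd v w (y + t *\<^sub>R v)"
      using MVT2[OF s, of "\<lambda>t. w (y + t *\<^sub>R v)" "\<lambda>t. dd v w (y + t *\<^sub>R v)"] line by blast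
    then have "q n y = dd v w (y + t *\<^sub>R v)" by (simp add: q_def)
    then show ?thesis using True M by simp
  next
    case False
    have "norm ((1 / Suc n) *\<^sub>R v) \<le> norm v" by (simp add: divide_le_eq mult_le_cancel_left1)
    then have "norm (y + (1 / Suc n) *\<^sub>R v) > R" "norm y > R"
      using False norm_diff_ineq[of y "(1 / Suc n) *\<^sub>R v"] norm_ge_zero[of v] by linarith+
    then show ?thesis using False by (simp add: q_def supp)
  qed
  have lim: "(\<lambda>n. q n y) \<longlonglongrightarrow> dd v w y" for y
  proof -
    have "((\<lambda>h. (w (y + h *\<^sub>R v) - w y) / h) \<longlongrightarrow> dd v w y) (at 0)"
      using line[of y 0] by (simp add: DERIV_def)
    moreover have "filterlim (\<lambda>n. 1 / real (Suc n)) (at 0) sequentially"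
      using LIMSEQ_inverse_real_of_nat by (auto simp: filterlim_at inverse_eq_divide simp del: of_nat_Suc)
    ultimately have "(\<lambda>n. (w (y + (1 / Suc n) *\<^sub>R v) - w y) / (1 / Suc n)) \<longlonglongrightarrow> dd v w y"
      by (rule filterlim_compose)
    then show ?thesis by (simp add: q_def)
  qed
  have dm: "dd v w \<in> borel_measurable lborel"
    using borel_measurable_continuous_onI[OF cont] by simp
  have B: "integrable lborel (\<lambda>y::'a. M * indicator (cball 0 (R + norm v)) y :: real)"
    using emeasure_lborel_cball_finite by (intro integrable_mult_right integrable_real_indicator) auto
  have *: "AE y in lborel. (\<lambda>n. q n y) \<longlonglongrightarrow> dd v w y"
    "AE y in lborel. norm (q n y) \<le> M * indicator (cball 0 (R + norm v)) y" for n
    using lim bound by simp_all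
  have qm': "q n \<in> borel_measurable lborel" for n by simp
  show "integrable lborel (dd v w)"
    by (rule integrable_dominated_convergence[OF dm qm' B *])
  have "(\<lambda>n. integral\<^sup>L lborel (q n)) \<longlonglongrightarrow> integral\<^sup>L lborel (dd v w)"
    by (rule integral_dominated_convergence[OF dm qm' B *])
  then show "integral\<^sup>L lborel (dd v w) = 0"
    by (simp add: q0 LIMSEQ_const_iff)
qed

text \<open>The divergence is nonnegative with integral 0, so it vanishes almost everywhere; by
  continuity a nonzero value would persist on a ball of positive measure.\<close>

lemma nonneg_divergence_eq_0:
  fixes W :: "'i \<Rightarrow> 'a::euclidean_space \<Rightarrow> real"
  assumes I: "finite I"
    and diff: "\<And>k y. k \<in> I \<Longrightarrow> W k differentiable (at y)"
    and cont: "\<And>k. k \<in> I \<Longrightarrow> continuous_on UNIV (dd (e k) (W k))"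
    and supp: "\<And>k y. k \<in> I \<Longrightarrow> norm y > R \<Longrightarrow> W k y = 0"
    and nonneg: "\<And>y. (\<Sum>k\<in>I. dd (e k) (W k) y) \<ge> 0"
  shows "(\<Sum>k\<in>I. dd (e k) (W k) y) = 0"
proof -
  let ?\<Phi> = "\<lambda>y. \<Sum>k\<in>I. dd (e k) (W k) y"
  have int: "integrable lborel ?\<Phi>"
    using diff cont supp by (intro Bochner_Integration.integrable_sum integral_dd_compact_support(1)) auto
  moreover have "integral\<^sup>L lborel ?\<Phi> = 0"
    using integral_dd_compact_support[OF diff cont supp] by (subst Bochner_Integration.integral_sum) auto
  ultimately have "AE y in lborel. ?\<Phi> y = 0"
    using integral_nonneg_eq_0_iff_AE[of lborel ?\<Phi>] nonneg by simp
  then have AE: "AE y in lborel. y \<notin> {y. ?\<Phi> y \<noteq> 0}" by simp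
  have "open {y. ?\<Phi> y \<noteq> 0}"
    using cont by (intro open_Collect_neq continuous_on_sum continuous_on_const)
  then have opn: "open {y. ?\<Phi> y \<noteq> 0}" "{y. ?\<Phi> y \<noteq> 0} \<in> sets lborel" by auto
  have null: "{y. ?\<Phi> y \<noteq> 0} \<in> null_sets lborel"
    using AE AE_iff_null_sets[OF opn(2)] by blast
  show ?thesis
  proof (rule ccontr)
    assume "?\<Phi> y \<noteq> 0"
    then obtain r where r: "r > 0" "ball y r \<subseteq> {y. ?\<Phi> y \<noteq> 0}"
      using opn(1) open_contains_ball by blast
    then have "ball y r \<in> null_sets lborel" using null null_sets_subset[OF null, of "ball y r"] by simp
    then show False using content_ball_pos[OF r(1), of y] by (auto simp: null_sets_def measure_def)
  qed
qed

section \<open>Rules for directional derivatives at a point of a smooth domain\<close>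

context
  fixes S :: "'a::real_normed_vector set" and z :: 'a
  assumes z: "z \<in> S"
begin

lemma dd_add:
  fixes a b :: "'a \<Rightarrow> real"
  shows "smooth_on S a \<Longrightarrow> smooth_on S b \<Longrightarrow> dd v (\<lambda>w. a w + b w) z = dd v a z + dd v b z"
  by (rule dd_eqI) (auto intro!: has_derivative_add smooth_on_has_derivative z)

lemma dd_diff:
  fixes a b :: "'a \<Rightarrow> real"
  shows "smooth_on S a \<Longrightarrow> smooth_on S b \<Longrightarrow> dd v (\<lambda>w. a w - b w) z = dd v a z - dd v b z"
  by (rule dd_eqI) (auto intro!: has_derivative_diff smooth_on_has_derivative z)

lemma dd_mult:
  fixes a b :: "'a \<Rightarrow> real"
  assumes "smooth_on S a" "smooth_on S b"
  shows "dd v (\<lambda>w. a w * b w) z = dd v a z * b z + a z * dd v b z"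
  using dd_eqI[OF has_derivative_mult[OF smooth_on_has_derivative[OF assms(1) z]
        smooth_on_has_derivative[OF assms(2) z]], of v] by simp

lemma dd_cmult:
  fixes a :: "'a \<Rightarrow> real"
  shows "smooth_on S a \<Longrightarrow> dd v (\<lambda>w. c * a w) z = c * dd v a z"
  by (rule dd_eqI) (auto intro!: has_derivative_mult_right smooth_on_has_derivative z)

lemma dd_sum:
  fixes a :: "'i \<Rightarrow> 'a \<Rightarrow> real"
  shows "(\<And>i. i \<in> I \<Longrightarrow> smooth_on S (a i)) \<Longrightarrow> dd v (\<lambda>w. \<Sum>i\<in>I. a i w) z = (\<Sum>i\<in>I. dd v (a i) z)"
  by (rule dd_eqI) (auto intro!: has_derivative_sum smooth_on_has_derivative z)

lemma dd_ln:
  fixes a :: "'a \<Rightarrow> real"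
  shows "smooth_on S a \<Longrightarrow> a z > 0 \<Longrightarrow> dd v (\<lambda>w. ln (a w)) z = dd v a z / a z"
  using dd_eqI[OF has_derivative_ln_fun[OF _ z], of a v] by simp

lemma dd_linear:
  fixes a :: "'a \<Rightarrow> 'b::real_normed_vector"
  shows "smooth_on S a \<Longrightarrow> linear (\<lambda>v. dd v a z)"
  using smooth_on_has_derivative[OF _ z] has_derivative_linear by blast

lemma dd_cong:
  assumes "open S" "smooth_on S a" "\<And>w. w \<in> S \<Longrightarrow> a w = b w"
  shows "dd v a z = dd v b z"
  using dd_eqI[OF has_derivative_transform_within_open[OF smooth_on_has_derivative[OF assms(2) z] assms(1) z assms(3)], of v]
  by simp

end

lemma dd_bounded_linear: "bounded_linear l \<Longrightarrow> dd v l z = l v"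
  by (intro dd_eqI bounded_linear_imp_has_derivative)

lemma vec_expand: "v = (\<Sum>i\<in>UNIV. v $ i *\<^sub>R axis i (1::real))"
  by (simp add: vec_eq_iff axis_def if_distrib cong: if_cong)

abbreviation eX :: "'n::finite \<Rightarrow> (real^'n) \<times> (real^'n)" where "eX i \<equiv> (axis i 1, 0)"
abbreviation eY :: "'n::finite \<Rightarrow> (real^'n) \<times> (real^'n)" where "eY i \<equiv> (0, axis i 1)"

lemma px_dd: "px i h = dd (eX i) h" by (rule ext) (simp add: px_def)
lemma py_dd: "py i h = dd (eY i) h" by (rule ext) (simp add: py_def)

lemma dd_expand:
  fixes a :: "(real^'n::finite) \<times> (real^'n) \<Rightarrow> real"
  assumes "smooth_on S a" "z \<in> S"
  shows "dd v a z = (\<Sum>i\<in>UNIV. fst v $ i * dd (eX i) a z) + (\<Sum>i\<in>UNIV. snd v $ i * dd (eY i) a z)"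
proof -
  note l = dd_linear[OF assms(2,1)]
  have "(\<Sum>i\<in>UNIV. fst v $ i *\<^sub>R eX i) + (\<Sum>i\<in>UNIV. snd v $ i *\<^sub>R eY i) = v"
    using vec_expand[of "fst v"] vec_expand[of "snd v"]
    by (simp add: prod_eq_iff fst_sum snd_sum)
  then have "dd v a z = dd ((\<Sum>i\<in>UNIV. fst v $ i *\<^sub>R eX i) + (\<Sum>i\<in>UNIV. snd v $ i *\<^sub>R eY i)) a z"
    by simp
  also have "\<dots> = (\<Sum>i\<in>UNIV. fst v $ i * dd (eX i) a z) + (\<Sum>i\<in>UNIV. snd v $ i * dd (eY i) a z)"
    by (simp only: linear_add[OF l] linear_sum[OF l] linear_scale[OF l] real_scaleR_def)
  finally show ?thesis .
qed

subsection \<open>Homogeneous functions on the slit tangent bundle\<close>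

text \<open>The degree is real because every vertical derivative lowers it by one, down to -1 for
  the Hessian of a 1-homogeneous function. Only t > 0 is allowed since Finsler functions need not be
  reversible.\<close>

definition hom :: "(real^'n::finite) set \<Rightarrow> real \<Rightarrow> ((real^'n) \<times> (real^'n) \<Rightarrow> real) \<Rightarrow> bool" where
  "hom U d h \<longleftrightarrow> (\<forall>x\<in>U. \<forall>y. y \<noteq> 0 \<longrightarrow> (\<forall>t>0. h (x, t *\<^sub>R y) = t powr d * h (x, y)))"

context
  fixes U :: "(real^'n::finite) set" and h :: "(real^'n) \<times> (real^'n) \<Rightarrow> real" and d :: real
  assumes U: "open U" and sm: "smooth_on (U \<times> (UNIV - {0})) h" and hm: "hom U d h"
begin

text \<open>The homogeneity relation is differentiated at (x, y) in the direction \<open>v\<close>;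
  the scaling acts on the vertical part only. So x-derivatives keep the degree and y-derivatives
  lose one factor t.\<close>

lemma hom_dd:
  assumes "x \<in> U" "y \<noteq> 0" "t > 0"
  shows "dd (fst v, t *\<^sub>R snd v) h (x, t *\<^sub>R y) = t powr d * dd v h (x, y)"
proof -
  have o: "open (U \<times> (UNIV - {0::real^'n}))" using U by (intro open_Times) auto
  have "((\<lambda>z. h (fst z, t *\<^sub>R snd z)) has_derivative
      (\<lambda>v. dd (fst v, t *\<^sub>R snd v) h (x, t *\<^sub>R y))) (at (x, y))"
  proof (rule has_derivative_compose[where f = "\<lambda>z. (fst z, t *\<^sub>R snd z)"])
    show "((\<lambda>z. (fst z, t *\<^sub>R snd z)) has_derivative (\<lambda>v. (fst v, t *\<^sub>R snd v))) (at (x, y))"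
      by (auto intro!: derivative_eq_intros)
    show "(h has_derivative (\<lambda>v. dd v h (x, t *\<^sub>R y))) (at (fst (x, y), t *\<^sub>R snd (x, y)))"
      using smooth_on_has_derivative[OF sm, of "(x, t *\<^sub>R y)"] assms by simp
  qed
  then have "((\<lambda>z. t powr d * h z) has_derivative
      (\<lambda>v. dd (fst v, t *\<^sub>R snd v) h (x, t *\<^sub>R y))) (at (x, y))"
  proof (rule has_derivative_transform_within_open[OF _ o])
    fix w assume "w \<in> U \<times> (UNIV - {0::real^'n})"
    then show "h (fst w, t *\<^sub>R snd w) = t powr d * h w"
      using hm[unfolded hom_def, rule_format, of "fst w" "snd w" t] assms(3) by (simp add: mem_Times_iff)
  qed (use assms in auto)
  from dd_eqI[OF this, of v] show ?thesis
    using dd_cmult[OF _ sm, of "(x, y)"] assms by simp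
qed

lemma hom_dx: "hom U d (dd (eX i) h)"
  using hom_dd[of _ _ _ "eX i"] by (simp add: hom_def)

lemma hom_dy: "hom U (d - 1) (dd (eY i) h)"
  unfolding hom_def
proof (intro ballI allI impI)
  fix x y t assume a: "x \<in> U" "y \<noteq> (0::real^'n)" "(t::real) > 0"
  have "(x, t *\<^sub>R y) \<in> U \<times> (UNIV - {0})" using a by simp
  from dd_linear[OF this sm] have "dd (t *\<^sub>R eY i) h (x, t *\<^sub>R y) = t * dd (eY i) h (x, t *\<^sub>R y)"
    by (simp only: linear_scale real_scaleR_def)
  then have "t * dd (eY i) h (x, t *\<^sub>R y) = t powr d * dd (eY i) h (x, y)"
    using hom_dd[OF a, of "eY i"] by simp
  then show "dd (eY i) h (x, t *\<^sub>R y) = t powr (d - 1) * dd (eY i) h (x, y)"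
    using a by (simp add: powr_diff field_simps)
qed

text \<open>Euler's relation, by differentiating \<open>h (x, t y)\<close> at t = 1 in two
  ways.\<close>

lemma euler:
  assumes "z \<in> U \<times> (UNIV - {0})"
  shows "(\<Sum>i\<in>UNIV. snd z $ i * dd (eY i) h z) = d * h z"
proof -
  obtain x y where zxy: "z = (x, y)" "x \<in> U" "y \<noteq> 0" using assms by auto
  have "((\<lambda>t. h (x, t *\<^sub>R y)) has_derivative (\<lambda>r. dd (0, r *\<^sub>R y) h z)) (at 1)"
    by (rule has_derivative_compose[where f = "\<lambda>t. (x, t *\<^sub>R y)"])
      (use smooth_on_has_derivative[OF sm assms] in \<open>auto intro!: derivative_eq_intros simp: zxy\<close>)
  then have "((\<lambda>t. t powr d * h z) has_derivative (\<lambda>r. dd (0, r *\<^sub>R y) h z)) (at 1)"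
    by (rule has_derivative_transform_within_open[of _ _ _ _ "{0<..}"]) (use zxy hm[unfolded hom_def, rule_format] in auto)
  moreover have "((\<lambda>t. t powr d * h z) has_derivative (\<lambda>r. r * (d * h z))) (at 1)"
    by (auto intro!: derivative_eq_intros)
  ultimately have "(\<lambda>r. dd (0, r *\<^sub>R y) h z) = (\<lambda>r. r * (d * h z))"
    by (rule has_derivative_unique)
  from fun_cong[OF this, of 1] have "dd (0, y) h z = d * h z" by simp
  then show ?thesis using dd_expand[OF sm assms, of "(0, y)"] zxy by simp
qed

end

subsection \<open>The spray of a Finsler function in coordinates\<close>

lemma sum_delta_mult:
  fixes a :: "'n::finite \<Rightarrow> real"
  shows "(\<Sum>l\<in>UNIV. (if k = l then 1 else 0) * a l) = a k"
  by (simp add: if_distrib[of "\<lambda>x. x * _"] cong: if_cong)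

text \<open>A Finsler function seen in one chart. Continuity across the zero section makes
  \<open>{y. f (x, y) < 1}\<close> an open neighbourhood of 0, on which the cutoff will
  vanish.\<close>

locale finsler_chart =
  fixes U :: "(real^'n::finite) set" and f :: "(real^'n) \<times> (real^'n) \<Rightarrow> real"
  assumes U: "open U"
    and cont: "continuous_on (U \<times> UNIV) f"
    and smooth: "smooth_on (U \<times> (UNIV - {0})) f"
    and nonneg: "x \<in> U \<Longrightarrow> f (x, y) \<ge> 0"
    and scale: "x \<in> U \<Longrightarrow> t > 0 \<Longrightarrow> f (x, t *\<^sub>R y) = t * f (x, y)"
    and pd: "x \<in> U \<Longrightarrow> y \<noteq> 0 \<Longrightarrow> w \<noteq> 0 \<Longrightarrow> w \<bullet> (fund_tensor f (x, y) *v w) > 0"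
begin

definition \<Omega> where "\<Omega> = U \<times> (UNIV - {0::real^'n})"

lemma open_\<Omega>: "open \<Omega>" unfolding \<Omega>_def using U by (intro open_Times) auto

lemma mem_\<Omega>: "z \<in> \<Omega> \<longleftrightarrow> fst z \<in> U \<and> snd z \<noteq> 0" by (auto simp: \<Omega>_def mem_Times_iff)

abbreviation C where "C a \<equiv> smooth_on \<Omega> a"

lemma smooth_fst: "smooth_on U a \<Longrightarrow> C (\<lambda>z. a (fst z))"
  unfolding \<Omega>_def using U by (intro smooth_on_fst) auto

lemma smooth_snd: "C (\<lambda>z. snd z $ k)"
  by (intro smooth_on_bounded_linear bounded_linear_compose[OF bounded_linear_vec_nth bounded_linear_snd])

lemma dd_snd: "dd v (\<lambda>z. snd z $ k) z = snd v $ k"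
  by (intro dd_bounded_linear bounded_linear_compose[OF bounded_linear_vec_nth bounded_linear_snd])

lemmas C_intros = smooth_on_add[OF open_\<Omega>] smooth_on_diff[OF open_\<Omega>] smooth_on_minus[OF open_\<Omega>]
  smooth_on_mult[OF open_\<Omega>] smooth_on_sum[OF open_\<Omega>] smooth_on_power[OF open_\<Omega>]
  smooth_on_const smooth_on_dd smooth_snd

definition E where "E w = (f w)\<^sup>2"

definition gc where "gc i j z = 1/2 * dd (eY j) (dd (eY i) E) z"

definition gi where "gi i j z = matrix_inv (fund_tensor f z) $ i $ j"

abbreviation G where "G \<equiv> spray f"

definition trN where "trN z = (\<Sum>m\<in>UNIV. dd (eY m) (G m) z)"

lemma C_f: "C f" using smooth by (simp add: \<Omega>_def)

lemma C_E: "C E" unfolding E_def[abs_def] by (intro C_intros C_f)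

lemma C_gc: "C (gc i j)" unfolding gc_def[abs_def] by (intro C_intros C_E)

lemma fund_gc: "fund_tensor f z $ i $ j = gc i j z"
  by (simp add: fund_tensor_def gc_def py_dd E_def[abs_def])

lemma gc_sym: "z \<in> \<Omega> \<Longrightarrow> gc i j z = gc j i z"
  unfolding gc_def by (simp add: dd_commute[OF open_\<Omega> C_E, of z "eY i"])

lemma posdef: "z \<in> \<Omega> \<Longrightarrow> posdef (fund_tensor f z)"
  using pd[of "fst z" "snd z"] by unfold_locales (auto simp: fund_gc mem_\<Omega> intro!: gc_sym)

lemma det_g: "z \<in> \<Omega> \<Longrightarrow> det (fund_tensor f z) > 0"
  using posdef posdef.det_pos by blast

lemma C_det: "C (\<lambda>z. det (fund_tensor f z))"
  by (intro smooth_on_det open_\<Omega>) (simp add: fund_gc C_gc)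

lemma C_gi: "C (gi i j)"
  unfolding gi_def[abs_def] using det_g
  by (intro smooth_on_matrix_inv open_\<Omega>) (auto simp: fund_gc C_gc less_imp_neq[symmetric])

lemma gi_sym: "z \<in> \<Omega> \<Longrightarrow> gi i j z = gi j i z"
  unfolding gi_def using posdef.inv_sym[OF posdef] by blast

lemma gi_gc: "z \<in> \<Omega> \<Longrightarrow> (\<Sum>k\<in>UNIV. gi i k z * gc k j z) = (if i = j then 1 else 0)"
  and gc_gi: "z \<in> \<Omega> \<Longrightarrow> (\<Sum>k\<in>UNIV. gc i k z * gi k j z) = (if i = j then 1 else 0)"
  using posdef.sum_inv[OF posdef] by (simp_all add: gi_def fund_gc)

lemma gi_solve:
  assumes "z \<in> \<Omega>" "\<And>i. (\<Sum>k\<in>UNIV. gc i k z * a k) = b i"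
  shows "a k = (\<Sum>i\<in>UNIV. gi k i z * b i)"
proof -
  have "(\<Sum>i\<in>UNIV. gi k i z * b i) = (\<Sum>i\<in>UNIV. \<Sum>l\<in>UNIV. gi k i z * gc i l z * a l)"
    by (simp add: assms(2)[symmetric] sum_distrib_left ac_simps)
  also have "\<dots> = (\<Sum>l\<in>UNIV. (\<Sum>i\<in>UNIV. gi k i z * gc i l z) * a l)"
    by (subst sum.swap) (simp add: sum_distrib_right)
  also have "\<dots> = a k" by (simp add: gi_gc assms(1) sum_delta_mult)
  finally show ?thesis ..
qed

lemma spray_eq:
  "G i z = 1/4 * (\<Sum>l\<in>UNIV. gi i l z *
     ((\<Sum>k\<in>UNIV. dd (eY l) (dd (eX k) E) z * snd z $ k) - dd (eX l) E z))"
  by (simp add: spray_def gi_def px_dd py_dd E_def[abs_def])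

lemma C_G: "C (G i)"
proof -
  have "G i = (\<lambda>z. 1/4 * (\<Sum>l\<in>UNIV. gi i l z *
     ((\<Sum>k\<in>UNIV. dd (eY l) (dd (eX k) E) z * snd z $ k) - dd (eX l) E z)))"
    by (rule ext) (rule spray_eq)
  then show ?thesis by (simp only:) (intro C_intros C_gi C_E)
qed

lemma C_trN: "C trN" unfolding trN_def[abs_def] by (intro C_intros C_G)

lemma hom_f: "hom U 1 f" using scale by (simp add: hom_def)

lemma hom_E: "hom U 2 E" using scale by (simp add: hom_def E_def power_mult_distrib)

lemmas hom_dx' = hom_dx[OF U, folded \<Omega>_def]
lemmas hom_dy' = hom_dy[OF U, folded \<Omega>_def]
lemmas euler' = euler[OF U, folded \<Omega>_def]

lemma hom_gc: "hom U 0 (gc i j)"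
  using hom_dy'[OF _ hom_dy'[OF C_E hom_E, of i], of j] C_E smooth_on_dd
  by (auto simp: hom_def gc_def)

lemma fund_scale: "x \<in> U \<Longrightarrow> y \<noteq> 0 \<Longrightarrow> t > 0 \<Longrightarrow> fund_tensor f (x, t *\<^sub>R y) = fund_tensor f (x, y)"
  using hom_gc by (simp add: vec_eq_iff fund_gc hom_def)

lemma hom_gi: "hom U 0 (gi i j)" by (simp add: hom_def gi_def fund_scale)

lemma hom_G: "hom U 2 (G i)"
  unfolding hom_def
proof (intro ballI allI impI)
  fix x y t assume a: "x \<in> U" "y \<noteq> (0::real^'n)" "(t::real) > 0"
  have 1: "dd (eX l) E (x, t *\<^sub>R y) = t\<^sup>2 * dd (eX l) E (x, y)" for l
    using hom_dx'[OF C_E hom_E, of l] a by (simp add: hom_def)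
  have 2: "dd (eY l) (dd (eX k) E) (x, t *\<^sub>R y) = t * dd (eY l) (dd (eX k) E) (x, y)" for l k
    using hom_dy'[OF smooth_on_dd[OF C_E] hom_dx'[OF C_E hom_E], of k l] a by (simp add: hom_def)
  have 3: "gi i l (x, t *\<^sub>R y) = gi i l (x, y)" for i l
    using hom_gi a by (simp add: hom_def)
  have 4: "(\<Sum>k\<in>UNIV. dd (eY l) (dd (eX k) E) (x, t *\<^sub>R y) * snd (x, t *\<^sub>R y) $ k) - dd (eX l) E (x, t *\<^sub>R y)
     = t\<^sup>2 * ((\<Sum>k\<in>UNIV. dd (eY l) (dd (eX k) E) (x, y) * snd (x, y) $ k) - dd (eX l) E (x, y))" for l
    by (simp add: 1 2 right_diff_distrib sum_distrib_left power2_eq_square ac_simps)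
  show "G i (x, t *\<^sub>R y) = t powr 2 * G i (x, y)"
    unfolding spray_eq 4 3 using a by (simp add: sum_distrib_left ac_simps)
qed

lemma euler_f: "z \<in> \<Omega> \<Longrightarrow> (\<Sum>i\<in>UNIV. snd z $ i * dd (eY i) f z) = f z"
  using euler'[OF C_f hom_f] by simp

text \<open>Positivity off the zero section is not an axiom. Euler's relation, used twice, gives F^2
  = g(y, y), and \<open>g\<close> is positive definite.\<close>

lemma f_pos: "z \<in> \<Omega> \<Longrightarrow> f z > 0"
proof -
  assume z: "z \<in> \<Omega>"
  have h1: "hom U 1 (dd (eY i) E)" for i using hom_dy'[OF C_E hom_E] by simp
  have "(\<Sum>i\<in>UNIV. snd z $ i * (\<Sum>j\<in>UNIV. snd z $ j * (2 * gc i j z))) = (\<Sum>i\<in>UNIV. snd z $ i * dd (eY i) E z)"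
    using euler'[OF smooth_on_dd[OF C_E] h1 z] by (simp add: gc_def)
  also have "\<dots> = 2 * E z" using euler'[OF C_E hom_E z] by simp
  finally have "E z = snd z \<bullet> (fund_tensor f z *v snd z)"
    unfolding bilinear_sum_eq_inner[symmetric] by (simp add: fund_gc sum_distrib_left ac_simps flip: sum_distrib_left)
  then have "E z > 0" using pd[of "fst z" "snd z" "snd z"] z by (simp add: mem_\<Omega>)
  moreover have "f z \<ge> 0" using nonneg[of "fst z" "snd z"] z by (simp add: mem_\<Omega>)
  ultimately show ?thesis by (cases "f z = 0") (simp_all add: E_def)
qed

lemma dd_E: "z \<in> \<Omega> \<Longrightarrow> dd v E z = 2 * f z * dd v f z"
  using dd_mult[OF _ C_f C_f, of z v] by (simp add: E_def[abs_def] power2_eq_square)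

lemma gc_y: "z \<in> \<Omega> \<Longrightarrow> (\<Sum>k\<in>UNIV. gc l k z * snd z $ k) = f z * dd (eY l) f z"
proof -
  assume z: "z \<in> \<Omega>"
  have h1: "hom U 1 (dd (eY i) E)" for i using hom_dy'[OF C_E hom_E] by simp
  show ?thesis
    using euler'[OF smooth_on_dd[OF C_E] h1 z, of l] dd_E[OF z, of "eY l"]
    by (simp add: gc_def sum_distrib_left ac_simps flip: sum_divide_distrib)
qed

lemma gi_fy: "z \<in> \<Omega> \<Longrightarrow> (\<Sum>l\<in>UNIV. gi k l z * dd (eY l) f z) = snd z $ k / f z"
  using gi_solve[OF _ gc_y, of z k] f_pos[of z]
  by (simp add: sum_distrib_left[symmetric] mult.left_commute[of _ "f z"] field_simps)

lemma gc_eq_ff: "z \<in> \<Omega> \<Longrightarrow> gc i j z = dd (eY i) f z * dd (eY j) f z + f z * dd (eY j) (dd (eY i) f) z"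
proof -
  assume z: "z \<in> \<Omega>"
  have "dd (eY j) (dd (eY i) E) z = dd (eY j) (\<lambda>w. 2 * (f w * dd (eY i) f w)) z"
    by (rule dd_cong[OF z open_\<Omega>]) (auto intro!: C_intros C_E simp: dd_E)
  also have "\<dots> = 2 * (dd (eY j) f z * dd (eY i) f z + f z * dd (eY j) (dd (eY i) f) z)"
    using z by (simp add: dd_cmult[OF z] dd_mult[OF z] C_intros C_f)
  finally show ?thesis by (simp add: gc_def)
qed

text \<open>In g = dF dF + F Hess F the trace of \<open>g\<close> is n, while |dF|^2 = 1 by
  \<open>gi_fy\<close> and Euler's relation. This is the origin of n - 1.\<close>

lemma tr_hess_f: "z \<in> \<Omega> \<Longrightarrow>
  f z * (\<Sum>k\<in>UNIV. \<Sum>l\<in>UNIV. gi k l z * dd (eY l) (dd (eY k) f) z) = real CARD('n) - 1"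
proof -
  assume z: "z \<in> \<Omega>"
  have "f z * (\<Sum>k\<in>UNIV. \<Sum>l\<in>UNIV. gi k l z * dd (eY l) (dd (eY k) f) z)
      = (\<Sum>k\<in>UNIV. (\<Sum>l\<in>UNIV. gi k l z * gc l k z) - (\<Sum>l\<in>UNIV. gi k l z * dd (eY l) f z) * dd (eY k) f z)"
    by (simp add: gc_eq_ff[OF z] dd_commute[OF open_\<Omega> C_f z, of "eY l" "eY k" for l k] algebra_simps sum_distrib_left sum_distrib_right sum_subtractf[symmetric])
  also have "\<dots> = real CARD('n) - (\<Sum>k\<in>UNIV. snd z $ k * dd (eY k) f z) / f z"
    by (simp add: gi_gc[OF z] gi_fy[OF z] sum_subtractf sum_divide_distrib)
  also have "\<dots> = real CARD('n) - 1"
    using f_pos[OF z] by (simp add: euler_f[OF z])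
  finally show ?thesis .
qed


subsection \<open>Euler--Lagrange equation and its derivatives\<close>

abbreviation Nc where "Nc i k z \<equiv> dd (eY k) (G i) z"

lemma nonlin_eq: "nonlin f i k = Nc i k" by (rule ext) (simp add: nonlin_def py_dd)

lemma euler_lagrange:
  assumes z: "z \<in> \<Omega>"
  shows "4 * (\<Sum>l\<in>UNIV. gc i l z * G l z) =
    (\<Sum>k\<in>UNIV. dd (eY i) (dd (eX k) E) z * snd z $ k) - dd (eX i) E z"
proof -
  define b where "b l = (\<Sum>k\<in>UNIV. dd (eY l) (dd (eX k) E) z * snd z $ k) - dd (eX l) E z" for l
  have "4 * (\<Sum>l\<in>UNIV. gc i l z * G l z) = (\<Sum>l\<in>UNIV. \<Sum>m\<in>UNIV. gc i l z * gi l m z * b m)"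
    unfolding spray_eq b_def[symmetric] by (simp add: sum_distrib_left ac_simps)
  also have "\<dots> = (\<Sum>m\<in>UNIV. (\<Sum>l\<in>UNIV. gc i l z * gi l m z) * b m)"
    by (subst sum.swap) (simp add: sum_distrib_right)
  also have "\<dots> = b i" by (simp add: gc_gi[OF z] sum_delta_mult)
  finally show ?thesis by (simp add: b_def)
qed

text \<open>Since \<open>g\<close> is invertible, the equation determines the spray; this is how the
  spray is recognised after a change of coordinates.\<close>

lemma euler_lagrange_unique:
  assumes z: "z \<in> \<Omega>" and b: "\<And>i. 4 * (\<Sum>l\<in>UNIV. gc i l z * b l) =
    (\<Sum>k\<in>UNIV. dd (eY i) (dd (eX k) E) z * snd z $ k) - dd (eX i) E z"
  shows "b l = G l z"
proof -
  have "(\<Sum>l\<in>UNIV. gc i l z * b l) = (\<Sum>l\<in>UNIV. gc i l z * G l z)" for i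
    using euler_lagrange[OF z, of i] b[of i] by linarith
  from gi_solve[OF z this, of l] gi_solve[OF z refl, of "\<lambda>l. G l z" l] show ?thesis by simp
qed

lemma dd_gc:
  assumes z: "z \<in> \<Omega>"
  shows "dd v (gc i j) z = 1/2 * dd v (dd (eY j) (dd (eY i) E)) z"
  using dd_cmult[OF z smooth_on_dd[OF smooth_on_dd[OF C_E]], where c = "1/2"] by (simp add: gc_def[abs_def])

lemma dd_comm:
  fixes a :: "(real^'n) \<times> (real^'n) \<Rightarrow> real"
  shows "z \<in> \<Omega> \<Longrightarrow> C a \<Longrightarrow> dd v (dd w a) z = dd w (dd v a) z"
  using dd_commute[OF open_\<Omega>] by blast

lemma dd_comm2:
  fixes a :: "(real^'n) \<times> (real^'n) \<Rightarrow> real"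
  shows "z \<in> \<Omega> \<Longrightarrow> C a \<Longrightarrow> dd u (dd v (dd w a)) z = dd u (dd w (dd v a)) z"
  by (rule dd_cong[OF _ open_\<Omega>]) (auto intro: smooth_on_dd dd_comm)

text \<open>A vertical derivative of \<open>g\<close> is half a third derivative of F^2, hence
  totally symmetric; these two transpositions generate all the symmetries.\<close>

lemma dd_gc_cycle: "z \<in> \<Omega> \<Longrightarrow> dd (eY k) (gc i j) z = dd (eY i) (gc k j) z"
  and dd_gc_swap: "z \<in> \<Omega> \<Longrightarrow> dd v (gc i j) z = dd v (gc j i) z"
proof -
  assume z: "z \<in> \<Omega>"
  show 1: "dd v (gc i j) z = dd v (gc j i) z" for v i j
    by (rule dd_cong[OF z open_\<Omega> C_gc]) (rule gc_sym)
  have "dd (eY k) (gc j i) z = dd (eY i) (gc j k) z"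
    unfolding dd_gc[OF z] using dd_comm[OF z smooth_on_dd[OF C_E], where v = "eY k" and w = "eY i"] by simp
  then show "dd (eY k) (gc i j) z = dd (eY i) (gc k j) z" using 1 by simp
qed

text \<open>The Euler-Lagrange equation differentiated in y^j. The last two terms are antisymmetric
  in i and j, so they will drop out of a trace with g^ij.\<close>

lemma dd_euler_lagrange:
  assumes z: "z \<in> \<Omega>"
  shows "4 * (\<Sum>l\<in>UNIV. dd (eY j) (gc i l) z * G l z) + 4 * (\<Sum>l\<in>UNIV. gc i l z * Nc l j z) =
    (\<Sum>k\<in>UNIV. dd (eY j) (dd (eY i) (dd (eX k) E)) z * snd z $ k)
      + dd (eY i) (dd (eX j) E) z - dd (eY j) (dd (eX i) E) z"
proof -
  let ?a = "\<lambda>w. 4 * (\<Sum>l\<in>UNIV. gc i l w * G l w)"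
  let ?b = "\<lambda>w. (\<Sum>k\<in>UNIV. dd (eY i) (dd (eX k) E) w * snd w $ k) - dd (eX i) E w"
  have "dd (eY j) ?a z = dd (eY j) ?b z"
    by (rule dd_cong[OF z open_\<Omega>]) (auto intro!: C_intros C_gc C_G simp: euler_lagrange)
  moreover have "dd (eY j) ?a z
      = 4 * (\<Sum>l\<in>UNIV. dd (eY j) (gc i l) z * G l z) + 4 * (\<Sum>l\<in>UNIV. gc i l z * Nc l j z)"
    by (simp add: dd_cmult[OF z] dd_sum[OF z] dd_mult[OF z] C_intros C_gc C_G sum.distrib)
  moreover have "dd (eY j) ?b z = (\<Sum>k\<in>UNIV. dd (eY j) (dd (eY i) (dd (eX k) E)) z * snd z $ k
        + dd (eY i) (dd (eX k) E) z * (if k = j then 1 else 0)) - dd (eY j) (dd (eX i) E) z"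
    by (simp add: dd_diff[OF z] dd_sum[OF z] dd_mult[OF z] C_intros C_E dd_snd axis_def eq_commute)
  moreover have "(\<Sum>k\<in>UNIV. dd (eY i) (dd (eX k) E) z * (if k = j then 1 else 0)) = dd (eY i) (dd (eX j) E) z"
    by (simp add: if_distrib cong: if_cong)
  ultimately show ?thesis by (simp add: sum.distrib)
qed

text \<open>Contract \<open>dd_euler_lagrange\<close> with y^i. The derivatives of \<open>g\<close>
  disappear because \<open>g\<close> is 0-homogeneous and the mixed terms cancel, leaving 2 E_x on
  the right. The result means that horizontal vectors annihilate F^2.\<close>

lemma horizontal_E:
  assumes z: "z \<in> \<Omega>"
  shows "dd (eX j) E z = (\<Sum>l\<in>UNIV. Nc l j z * dd (eY l) E z)"
proof -
  let ?y = "\<lambda>i. snd z $ i"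
  have "(\<Sum>i\<in>UNIV. ?y i * (4 * (\<Sum>l\<in>UNIV. dd (eY j) (gc i l) z * G l z) + 4 * (\<Sum>l\<in>UNIV. gc i l z * Nc l j z)))
    = (\<Sum>i\<in>UNIV. ?y i * ((\<Sum>k\<in>UNIV. dd (eY j) (dd (eY i) (dd (eX k) E)) z * ?y k)
      + dd (eY i) (dd (eX j) E) z - dd (eY j) (dd (eX i) E) z))"
    by (simp only: dd_euler_lagrange[OF z])
  moreover have "(\<Sum>i\<in>UNIV. ?y i * (4 * (\<Sum>l\<in>UNIV. dd (eY j) (gc i l) z * G l z) + 4 * (\<Sum>l\<in>UNIV. gc i l z * Nc l j z)))
    = 4 * (\<Sum>l\<in>UNIV. (\<Sum>i\<in>UNIV. ?y i * dd (eY j) (gc i l) z) * G l z)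
      + 4 * (\<Sum>l\<in>UNIV. (\<Sum>i\<in>UNIV. gc i l z * ?y i) * Nc l j z)"
    unfolding distrib_left sum.distrib sum_distrib_left sum_distrib_right
    by (intro arg_cong2[where f = "(+)"]; subst sum.swap; simp add: ac_simps)
  moreover have "(\<Sum>i\<in>UNIV. ?y i * dd (eY j) (gc i l) z) = 0" for l
    using euler'[OF C_gc hom_gc z, of j l] by (simp add: dd_gc_cycle[OF z, of j])
  moreover have "(\<Sum>i\<in>UNIV. gc i l z * ?y i) = f z * dd (eY l) f z" for l
    using gc_y[OF z, of l] by (simp add: gc_sym[OF z])
  moreover have "(\<Sum>i\<in>UNIV. ?y i * ((\<Sum>k\<in>UNIV. dd (eY j) (dd (eY i) (dd (eX k) E)) z * ?y k)
      + dd (eY i) (dd (eX j) E) z - dd (eY j) (dd (eX i) E) z))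
    = (\<Sum>k\<in>UNIV. (\<Sum>i\<in>UNIV. ?y i * dd (eY j) (dd (eY i) (dd (eX k) E)) z) * ?y k)
      + (\<Sum>i\<in>UNIV. ?y i * dd (eY i) (dd (eX j) E) z) - (\<Sum>i\<in>UNIV. ?y i * dd (eY j) (dd (eX i) E) z)"
    unfolding distrib_left right_diff_distrib sum.distrib sum_subtractf sum_distrib_left sum_distrib_right
    by (intro arg_cong2[where f = "(-)"] arg_cong2[where f = "(+)"] refl; subst sum.swap; simp add: ac_simps)
  moreover have "(\<Sum>i\<in>UNIV. ?y i * dd (eY j) (dd (eY i) (dd (eX k) E)) z) = dd (eY j) (dd (eX k) E) z" for k
    using euler'[OF smooth_on_dd[OF smooth_on_dd[OF C_E]] hom_dy'[OF smooth_on_dd[OF C_E] hom_dx'[OF C_E hom_E]] z, of k j]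
    by (simp add: dd_comm[OF z smooth_on_dd[OF C_E], where v = "eY j" and w = "eY i" for i])
  moreover have "(\<Sum>i\<in>UNIV. ?y i * dd (eY i) (dd (eX j) E) z) = 2 * dd (eX j) E z"
    using euler'[OF smooth_on_dd[OF C_E] hom_dx'[OF C_E hom_E] z, of j] by simp
  ultimately have "4 * (\<Sum>l\<in>UNIV. f z * dd (eY l) f z * Nc l j z) = 2 * dd (eX j) E z"
    by (simp add: ac_simps)
  moreover have "(\<Sum>l\<in>UNIV. Nc l j z * dd (eY l) E z) = 2 * (\<Sum>l\<in>UNIV. f z * dd (eY l) f z * Nc l j z)"
    by (simp add: dd_E[OF z] sum_distrib_left ac_simps)
  ultimately show ?thesis by linarith
qed

lemma horizontal_f:
  assumes z: "z \<in> \<Omega>"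
  shows "dd (eX j) f z = (\<Sum>l\<in>UNIV. Nc l j z * dd (eY l) f z)"
proof -
  have "2 * f z * dd (eX j) f z = 2 * f z * (\<Sum>l\<in>UNIV. Nc l j z * dd (eY l) f z)"
    using horizontal_E[OF z, of j] by (simp add: dd_E[OF z] sum_distrib_left ac_simps)
  then show ?thesis using f_pos[OF z] by simp
qed

lemma euler_G: "z \<in> \<Omega> \<Longrightarrow> (\<Sum>i\<in>UNIV. snd z $ i * Nc k i z) = 2 * G k z"
  using euler'[OF C_G hom_G] by simp

lemma hom_trN: "hom U 1 trN"
proof -
  have "hom U 1 (dd (eY m) (G m))" for m using hom_dy'[OF C_G hom_G] by simp
  then show ?thesis by (simp add: hom_def trN_def sum_distrib_left)
qed

subsection \<open>The S-curvature\<close>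

text \<open>The geodesic spray, F times the Reeb field.\<close>

definition Gam where "Gam z = (snd z, - 2 *\<^sub>R (\<chi> k. G k z))"

lemma reeb_eq: "z \<in> \<Omega> \<Longrightarrow> reeb f z = (1 / f z) *\<^sub>R Gam z"
proof -
  assume z: "z \<in> \<Omega>"
  have "(\<Sum>i\<in>UNIV. nonlin f k i z * ((1 / f z) *\<^sub>R snd z) $ i) = 2 * G k z / f z" for k
    by (simp add: nonlin_eq euler_G[OF z, symmetric] sum_divide_distrib ac_simps)
  then show ?thesis by (simp add: reeb_def hlift_def Gam_def vec_eq_iff)
qed

text \<open>By Jacobi's formula the left side is the derivative of ln det g along the spray. The
  differentiated Euler-Lagrange equation turns \<open>Gam(g_ij)\<close> into 2 g_il N^l_j plus an
  antisymmetric term, which the trace kills.\<close>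

lemma tr_gc_Gam:
  assumes z: "z \<in> \<Omega>"
  shows "(\<Sum>i\<in>UNIV. \<Sum>j\<in>UNIV. gi i j z * dd (Gam z) (gc j i) z) = 2 * trN z"
proof -
  have 1: "dd (Gam z) (gc j i) z = 2 * (\<Sum>l\<in>UNIV. gc i l z * Nc l j z)
      + 1/2 * (dd (eY j) (dd (eX i) E) z - dd (eY i) (dd (eX j) E) z)" for i j
  proof -
    have "dd (Gam z) (gc j i) z = dd (Gam z) (gc i j) z" by (rule dd_gc_swap[OF z])
    also have "\<dots> = (\<Sum>k\<in>UNIV. snd z $ k * dd (eX k) (gc i j) z) - 2 * (\<Sum>l\<in>UNIV. G l z * dd (eY l) (gc i j) z)"
      by (subst dd_expand[OF C_gc z]) (simp add: Gam_def sum_negf sum_distrib_left ac_simps)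
    also have "(\<Sum>l\<in>UNIV. G l z * dd (eY l) (gc i j) z) = (\<Sum>l\<in>UNIV. dd (eY j) (gc i l) z * G l z)"
    proof (rule sum.cong[OF refl])
      fix l
      have "dd (eY l) (gc i j) z = dd (eY l) (gc j i) z" by (rule dd_gc_swap[OF z])
      also have "\<dots> = dd (eY j) (gc l i) z" by (rule dd_gc_cycle[OF z])
      also have "\<dots> = dd (eY j) (gc i l) z" by (rule dd_gc_swap[OF z])
      finally show "G l z * dd (eY l) (gc i j) z = dd (eY j) (gc i l) z * G l z" by simp
    qed
    also have "(\<Sum>k\<in>UNIV. snd z $ k * dd (eX k) (gc i j) z)
        = 1/2 * (\<Sum>k\<in>UNIV. dd (eY j) (dd (eY i) (dd (eX k) E)) z * snd z $ k)"
      by (simp add: dd_gc[OF z] sum_distrib_left ac_simps dd_comm[OF z, where v = "eX k" for k] smooth_on_dd C_E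
          dd_comm2[OF z C_E, where v = "eX k" for k])
    finally have 2: "dd (Gam z) (gc j i) z = 1/2 * (\<Sum>k\<in>UNIV. dd (eY j) (dd (eY i) (dd (eX k) E)) z * snd z $ k)
        - 2 * (\<Sum>l\<in>UNIV. dd (eY j) (gc i l) z * G l z)" .
    have arith: "x = 1/2 * K - 2 * P \<Longrightarrow> 4 * P + 4 * Q = K + b - a \<Longrightarrow> x = 2 * Q + 1/2 * (a - b)"
      for x K P Q a b :: real by (simp add: field_simps)
    show ?thesis by (rule arith[OF 2 dd_euler_lagrange[OF z, of i j]])
  qed
  have "(\<Sum>i\<in>UNIV. \<Sum>j\<in>UNIV. gi i j z * (dd (eY j) (dd (eX i) E) z - dd (eY i) (dd (eX j) E) z)) = 0"
  proof -
    have "(\<Sum>i\<in>UNIV. \<Sum>j\<in>UNIV. gi i j z * dd (eY i) (dd (eX j) E) z)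
        = (\<Sum>i\<in>UNIV. \<Sum>j\<in>UNIV. gi i j z * dd (eY j) (dd (eX i) E) z)"
      by (subst sum.swap) (simp add: gi_sym[OF z])
    then show ?thesis by (simp add: right_diff_distrib sum_subtractf)
  qed
  moreover have "(\<Sum>i\<in>UNIV. \<Sum>j\<in>UNIV. gi i j z * (\<Sum>l\<in>UNIV. gc i l z * Nc l j z)) = trN z"
  proof -
    have "(\<Sum>i\<in>UNIV. \<Sum>j\<in>UNIV. gi i j z * (\<Sum>l\<in>UNIV. gc i l z * Nc l j z))
        = (\<Sum>j\<in>UNIV. \<Sum>i\<in>UNIV. \<Sum>l\<in>UNIV. gi j i z * gc i l z * Nc l j z)"
      by (subst sum.swap) (simp add: gi_sym[OF z] sum_distrib_left ac_simps)
    also have "\<dots> = (\<Sum>j\<in>UNIV. \<Sum>l\<in>UNIV. (\<Sum>i\<in>UNIV. gi j i z * gc i l z) * Nc l j z)"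
      by (rule sum.cong[OF refl], subst sum.swap) (simp add: sum_distrib_right)
    also have "\<dots> = trN z" by (simp add: gi_gc[OF z] sum_delta_mult trN_def)
    finally show ?thesis .
  qed
  moreover have "(\<Sum>i\<in>UNIV. \<Sum>j\<in>UNIV. gi i j z * dd (Gam z) (gc j i) z)
    = 2 * (\<Sum>i\<in>UNIV. \<Sum>j\<in>UNIV. gi i j z * (\<Sum>l\<in>UNIV. gc i l z * Nc l j z))
      + 1/2 * (\<Sum>i\<in>UNIV. \<Sum>j\<in>UNIV. gi i j z * (dd (eY j) (dd (eX i) E) z - dd (eY i) (dd (eX j) E) z))"
    unfolding 1 by (simp only: distrib_left sum.distrib sum_distrib_left ac_simps)
  ultimately show ?thesis by simp
qed

lemma C_half: "C a \<Longrightarrow> C (\<lambda>z. a z / 2)" for a :: "_ \<Rightarrow> real"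
  using smooth_on_mult[OF open_\<Omega> smooth_on_const[of \<Omega> "1/2::real"], of a] by simp

lemma distortion_eq:
  assumes z: "z \<in> \<Omega>" and s: "s (fst z) > 0"
  shows "distortion f s z = 1/2 * ln (det (fund_tensor f z)) - ln (s (fst z))"
  using det_g[OF z] s by (simp add: distortion_def ln_div ln_sqrt)

lemma distortion_smooth:
  assumes "smooth_on U s" "\<And>x. x \<in> U \<Longrightarrow> s x > 0"
  shows "C (distortion f s)"
  by (rule smooth_on_cong[OF open_\<Omega>, of "\<lambda>z. 1/2 * ln (det (fund_tensor f z)) - ln (s (fst z))"])
    (use assms in \<open>auto intro!: C_intros C_half smooth_on_ln[OF open_\<Omega>] smooth_on_ln[OF U] C_det smooth_fst
        simp: det_g distortion_eq mem_\<Omega>\<close>)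

lemma S_curv_Gam:
  assumes z: "z \<in> \<Omega>" and s: "smooth_on U s" "\<And>x. x \<in> U \<Longrightarrow> s x > 0"
  shows "f z * S_curv f s z = dd (Gam z) (distortion f s) z"
  using f_pos[OF z] linear_scale[OF dd_linear[OF z distortion_smooth[OF s]]]
  by (simp add: S_curv_def reeb_eq[OF z])

text \<open>The square root in the distortion cancels the 2 of \<open>tr_gc_Gam\<close>; the density
  is independent of y, so only the horizontal coordinates y^m of the spray act on it.\<close>

lemma S_curv_eq:
  assumes z: "z \<in> \<Omega>" and s: "smooth_on U s" "\<And>x. x \<in> U \<Longrightarrow> s x > 0"
  shows "f z * S_curv f s z = trN z - (\<Sum>m\<in>UNIV. snd z $ m * dd (axis m 1) (\<lambda>x. ln (s x)) (fst z))"
proof -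
  have x: "fst z \<in> U" using z by (simp add: mem_\<Omega>)
  have sl: "smooth_on U (\<lambda>x. ln (s x))" using s U by (intro smooth_on_ln)
  have "f z * S_curv f s z = dd (Gam z) (distortion f s) z" by (rule S_curv_Gam[OF assms])
  also have "\<dots> = dd (Gam z) (\<lambda>z. 1/2 * ln (det (fund_tensor f z)) - ln (s (fst z))) z"
    by (rule dd_cong[OF z open_\<Omega> distortion_smooth[OF s]]) (auto simp: distortion_eq mem_\<Omega> s)
  also have "\<dots> = 1/2 * (dd (Gam z) (\<lambda>z. det (fund_tensor f z)) z / det (fund_tensor f z))
      - dd (Gam z) (\<lambda>z. ln (s (fst z))) z"
    by (subst dd_diff[OF z]; (subst dd_cmult[OF z])?; (subst dd_ln[OF z])?)
      (auto intro!: C_intros C_half smooth_on_ln[OF open_\<Omega>] C_det smooth_fst sl simp: det_g z)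
  also have "dd (Gam z) (\<lambda>z. det (fund_tensor f z)) z / det (fund_tensor f z)
      = (\<Sum>i\<in>UNIV. \<Sum>j\<in>UNIV. gi i j z * dd (Gam z) (gc j i) z)"
    using det_g[OF z] smooth_on_differentiable[OF C_gc z]
    by (subst dd_det) (auto simp: fund_gc gi_def)
  also have "\<dots> = 2 * trN z" by (rule tr_gc_Gam[OF z])
  also have "dd (Gam z) (\<lambda>z. ln (s (fst z))) z = dd (snd z) (\<lambda>x. ln (s x)) (fst z)"
    using dd_eqI[OF has_derivative_compose[OF has_derivative_fst[OF has_derivative_ident] smooth_on_has_derivative[OF sl]], of z]
      x by (simp add: Gam_def)
  also have "\<dots> = (\<Sum>m\<in>UNIV. snd z $ m * dd (axis m 1) (\<lambda>x. ln (s x)) (fst z))"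
    by (subst vec_expand[of "snd z"])
      (simp only: linear_sum[OF dd_linear[OF x sl]] linear_scale[OF dd_linear[OF x sl]] real_scaleR_def)
  finally show ?thesis by simp
qed


subsection \<open>Trace of the Berwald curvature\<close>

definition B where "B k z = dd (eY k) trN z"

lemma C_B: "C (B k)" unfolding B_def[abs_def] by (intro C_intros C_trN)

lemma dd_B:
  assumes z: "z \<in> \<Omega>"
  shows "dd v (B k) z = (\<Sum>a\<in>UNIV. dd v (dd (eY k) (dd (eY a) (G a))) z)"
proof -
  have "dd v (B k) z = dd v (\<lambda>w. \<Sum>a\<in>UNIV. dd (eY k) (dd (eY a) (G a)) w) z"
    by (rule dd_cong[OF z open_\<Omega> C_B]) (simp add: B_def trN_def[abs_def] dd_sum C_intros C_G)
  then show ?thesis by (simp add: dd_sum[OF z] C_intros C_G)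
qed

lemma berwald_form_eq: "berwald_form f i j z X = (\<Sum>k\<in>UNIV. dd (eY k) (dd (eY j) (G i)) z * fst X $ k)"
  by (simp add: berwald_form_def py_dd)

text \<open>The exterior derivative of \<open>B\<^sub>k dx\<^sup>k\<close>, written out.\<close>

definition tr_curv where
  "tr_curv z X Y = (\<Sum>k\<in>UNIV. dd X (B k) z * fst Y $ k) - (\<Sum>k\<in>UNIV. dd Y (B k) z * fst X $ k)"

text \<open>The quadratic terms of the curvature forms have trace 0.\<close>

lemma trace_berwald_curv:
  assumes z: "z \<in> \<Omega>"
  shows "(\<Sum>a\<in>UNIV. berwald_curv f a a z X Y) = tr_curv z X Y"
proof -
  have d: "dd v (\<lambda>w. berwald_form f a a w Y) z = (\<Sum>k\<in>UNIV. dd v (dd (eY k) (dd (eY a) (G a))) z * fst Y $ k)" for v a Y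
    unfolding berwald_form_eq[abs_def]
    by (simp add: dd_sum[OF z] dd_mult[OF z] C_intros C_G)
  have "(\<Sum>a\<in>UNIV. dd X (\<lambda>w. berwald_form f a a w Y) z) = (\<Sum>k\<in>UNIV. dd X (B k) z * fst Y $ k)" for X Y
    unfolding d dd_B[OF z] sum_distrib_right by (rule sum.swap)
  then have "(\<Sum>a\<in>UNIV. ext_deriv (berwald_form f a a) z X Y) = tr_curv z X Y"
    by (simp add: ext_deriv_def sum_subtractf tr_curv_def)
  moreover have "(\<Sum>a\<in>UNIV. \<Sum>k\<in>UNIV. wedge (berwald_form f k a z) (berwald_form f a k z) X Y) = 0"
  proof -
    have "(\<Sum>a\<in>UNIV. \<Sum>k\<in>UNIV. berwald_form f k a z Y * berwald_form f a k z X)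
        = (\<Sum>a\<in>UNIV. \<Sum>k\<in>UNIV. berwald_form f k a z X * berwald_form f a k z Y)"
      by (subst sum.swap) (simp add: mult.commute)
    then show ?thesis by (simp add: wedge_def sum_subtractf)
  qed
  ultimately show ?thesis by (simp add: berwald_curv_def sum_subtractf)
qed

lemma adapted_orth:
  "adapted f z u \<Longrightarrow> u i \<bullet> (fund_tensor f z *v u j) = (if i = j then 1 else 0)"
  unfolding adapted_def bilinear_sum_eq_inner by blast

lemma adapted_gi: "z \<in> \<Omega> \<Longrightarrow> adapted f z u \<Longrightarrow> (\<Sum>i\<in>UNIV. u i $ k * u i $ l) = gi k l z"
  unfolding gi_def by (rule posdef.orthonormal_frame_inv[OF posdef adapted_orth])

lemma coframe_eX: "coframe_h f z u i (eX a) = (\<Sum>k\<in>UNIV. fund_tensor f z $ k $ a * u i $ k)"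
  by (simp add: coframe_h_def axis_def if_distrib cong: if_cong)

lemma coframe_eq: "coframe_h f z u i X = (\<Sum>a\<in>UNIV. coframe_h f z u i (eX a) * fst X $ a)"
  unfolding coframe_eX coframe_h_def[of f z u i X] sum_distrib_right by (rule sum.swap)

lemma coframe_dual:
  "z \<in> \<Omega> \<Longrightarrow> adapted f z u \<Longrightarrow> (\<Sum>i\<in>UNIV. coframe_h f z u i (eX a) * u i $ b) = (if a = b then 1 else 0)"
  unfolding coframe_eX by (rule posdef.orthonormal_frame_dual[OF posdef adapted_orth])

lemma coframe_expand:
  assumes "z \<in> \<Omega>" "adapted f z u"
  shows "(\<Sum>i\<in>UNIV. coframe_h f z u i X *\<^sub>R u i) = fst X"
proof -
  have "(\<Sum>i\<in>UNIV. coframe_h f z u i X * u i $ b) = fst X $ b" for b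
  proof -
    have "(\<Sum>i\<in>UNIV. coframe_h f z u i X * u i $ b)
        = (\<Sum>a\<in>UNIV. (\<Sum>i\<in>UNIV. coframe_h f z u i (eX a) * u i $ b) * fst X $ a)"
      unfolding coframe_eq[of z u _ X] sum_distrib_right by (subst sum.swap) (simp add: ac_simps)
    also have "\<dots> = fst X $ b"
      by (simp add: coframe_dual[OF assms] sum_delta_mult[of b, simplified eq_commute[of b]])
    finally show ?thesis .
  qed
  then show ?thesis by (simp add: vec_eq_iff)
qed

text \<open>A trace does not depend on the frame: contracting the frame with its dual coframe leaves
  the coordinate trace.\<close>

lemma trace_frame:
  assumes "z \<in> \<Omega>" "adapted f z u"
  shows "(\<Sum>i\<in>UNIV. berwald_curv_frame f z u i i X Y) = tr_curv z X Y"
proof -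
  have "(\<Sum>i\<in>UNIV. berwald_curv_frame f z u i i X Y)
    = (\<Sum>i\<in>UNIV. \<Sum>a\<in>UNIV. \<Sum>b\<in>UNIV. (coframe_h f z u i (eX a) * u i $ b) * berwald_curv f a b z X Y)"
    by (simp add: berwald_curv_frame_def ac_simps)
  also have "\<dots> = (\<Sum>a\<in>UNIV. \<Sum>i\<in>UNIV. \<Sum>b\<in>UNIV. (coframe_h f z u i (eX a) * u i $ b) * berwald_curv f a b z X Y)"
    by (rule sum.swap)
  also have "\<dots> = (\<Sum>a\<in>UNIV. \<Sum>b\<in>UNIV. (\<Sum>i\<in>UNIV. coframe_h f z u i (eX a) * u i $ b) * berwald_curv f a b z X Y)"
    by (rule sum.cong[OF refl], subst sum.swap) (simp add: sum_distrib_right)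
  also have "\<dots> = (\<Sum>a\<in>UNIV. berwald_curv f a a z X Y)"
    by (simp add: coframe_dual[OF assms] sum_delta_mult)
  finally show ?thesis by (simp add: trace_berwald_curv assms)
qed

text \<open>A vertical second argument has no dx-component, so only the subtracted half of
  \<open>tr_curv\<close> survives; its sign cancels the one in \<open>frame_v\<close>.\<close>

lemma mean_berwald_eq:
  assumes z: "z \<in> \<Omega>" and u: "adapted f z u"
  shows "mean_berwald f z u \<gamma> \<mu> = f z * (\<Sum>k\<in>UNIV. \<Sum>l\<in>UNIV. u \<gamma> $ k * u \<mu> $ l * dd (eY l) (B k) z)"
proof -
  have "mean_berwald f z u \<gamma> \<mu> = - (\<Sum>k\<in>UNIV. dd (frame_v f z u \<mu>) (B k) z * u \<gamma> $ k)"
    unfolding mean_berwald_def berwald_P_def trace_frame[OF assms]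
    by (simp add: tr_curv_def frame_h_def frame_v_def hlift_def)
  moreover have "dd (frame_v f z u \<mu>) (B k) z = - (f z * (\<Sum>l\<in>UNIV. u \<mu> $ l * dd (eY l) (B k) z))" for k
    by (subst dd_expand[OF C_B z]) (simp add: frame_v_def sum_negf sum_distrib_left ac_simps)
  ultimately show ?thesis by (simp add: sum_negf sum_distrib_left ac_simps)
qed

lemma euler_B: "z \<in> \<Omega> \<Longrightarrow> (\<Sum>k\<in>UNIV. snd z $ k * dd (eY l) (B k) z) = 0"
proof -
  assume z: "z \<in> \<Omega>"
  have "hom U 0 (dd (eY l) trN)" using hom_dy'[OF C_trN hom_trN] by simp
  from euler'[OF smooth_on_dd[OF C_trN] this z] show ?thesis
    by (simp add: B_def[abs_def] dd_comm[OF z C_trN, where v = "eY l"])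
qed

definition es where "es z = f z * (\<Sum>k\<in>UNIV. \<Sum>l\<in>UNIV. gi k l z * dd (eY l) (B k) z)"

text \<open>The index \<open>ix_n\<close> may be included at no cost, since y lies in the kernel of
  the Hessian of N (\<open>euler_B\<close>); the full sum over an orthonormal frame produces the
  inverse metric.\<close>

lemma sum_mean_berwald:
  assumes z: "z \<in> \<Omega>" and u: "adapted f z u"
  shows "(\<Sum>\<gamma>\<in>UNIV - {ix_n}. mean_berwald f z u \<gamma> \<gamma>) = es z"
proof -
  have "mean_berwald f z u ix_n ix_n = f z * (\<Sum>l\<in>UNIV. u ix_n $ l * (1 / f z) * (\<Sum>k\<in>UNIV. snd z $ k * dd (eY l) (B k) z))"
    unfolding mean_berwald_eq[OF assms] using u
    by (subst sum.swap) (simp add: adapted_def sum_distrib_left ac_simps)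
  also have "\<dots> = 0" by (simp add: euler_B[OF z])
  finally have "(\<Sum>\<gamma>\<in>UNIV - {ix_n}. mean_berwald f z u \<gamma> \<gamma>) = (\<Sum>\<gamma>\<in>UNIV. mean_berwald f z u \<gamma> \<gamma>)"
    by (simp add: sum_diff1)
  also have "\<dots> = f z * (\<Sum>\<gamma>\<in>UNIV. \<Sum>k\<in>UNIV. \<Sum>l\<in>UNIV. u \<gamma> $ k * u \<gamma> $ l * dd (eY l) (B k) z)"
    by (simp add: mean_berwald_eq[OF assms] sum_distrib_left)
  also have "(\<Sum>\<gamma>\<in>UNIV. \<Sum>k\<in>UNIV. \<Sum>l\<in>UNIV. u \<gamma> $ k * u \<gamma> $ l * dd (eY l) (B k) z)
      = (\<Sum>k\<in>UNIV. \<Sum>\<gamma>\<in>UNIV. \<Sum>l\<in>UNIV. u \<gamma> $ k * u \<gamma> $ l * dd (eY l) (B k) z)"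
    by (rule sum.swap)
  also have "\<dots> = (\<Sum>k\<in>UNIV. \<Sum>l\<in>UNIV. (\<Sum>\<gamma>\<in>UNIV. u \<gamma> $ k * u \<gamma> $ l) * dd (eY l) (B k) z)"
    by (rule sum.cong[OF refl], subst sum.swap) (simp add: sum_distrib_right)
  finally show ?thesis by (simp add: es_def adapted_gi[OF assms])
qed

lemma adapted_exists: "z \<in> \<Omega> \<Longrightarrow> \<exists>u. adapted f z u"
proof -
  assume z: "z \<in> \<Omega>"
  let ?a = "(1 / f z) *\<^sub>R snd z"
  have "snd z \<bullet> (fund_tensor f z *v snd z) = (\<Sum>k\<in>UNIV. snd z $ k * (\<Sum>l\<in>UNIV. gc k l z * snd z $ l))"
    unfolding bilinear_sum_eq_inner[symmetric] by (simp add: fund_gc sum_distrib_left ac_simps)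
  also have "\<dots> = f z * (\<Sum>k\<in>UNIV. snd z $ k * dd (eY k) f z)"
    by (simp only: gc_y[OF z]) (simp add: sum_distrib_left ac_simps)
  also have "\<dots> = f z * f z" by (simp add: euler_f[OF z])
  finally have "?a \<bullet> (fund_tensor f z *v ?a) = 1"
    using f_pos[OF z] by (simp add: matrix_vector_mult_scaleR)
  from posdef.gram_schmidt[OF posdef[OF z] this, of ix_n] show ?thesis
    unfolding adapted_def bilinear_sum_eq_inner by blast
qed

text \<open>The definite description needs both facts: the sum is the same for all adapted frames,
  and some adapted frame exists, without which every number would qualify.\<close>

lemma berwald_scalar_eq:
  assumes z: "z \<in> \<Omega>" shows "berwald_scalar f z = es z"
  unfolding berwald_scalar_def
  by (rule the_equality) (use sum_mean_berwald[OF z] adapted_exists[OF z] in auto)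

text \<open>The degrees 1 of F, 0 of the inverse metric and -1 of the Hessian of N add up to 0. Thus
  information on the sphere bundle extends to the slit tangent bundle.\<close>

lemma hom_es: "hom U 0 es"
  unfolding hom_def
proof (intro ballI allI impI)
  fix x y t assume a: "x \<in> U" "y \<noteq> (0::real^'n)" "(t::real) > 0"
  have "hom U 0 (B k)" for k using hom_dy'[OF C_trN hom_trN] by (simp add: B_def[abs_def])
  from hom_dy'[OF C_B this] have "dd (eY l) (B k) (x, t *\<^sub>R y) = dd (eY l) (B k) (x, y) / t" for l k
    using a by (simp add: hom_def powr_minus_divide)
  moreover have "gi k l (x, t *\<^sub>R y) = gi k l (x, y)" for k l using hom_gi a by (simp add: hom_def)
  ultimately show "es (x, t *\<^sub>R y) = t powr 0 * es (x, y)"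
    using a scale by (simp add: es_def flip: sum_divide_distrib)
qed

lemma dd_fst: "z \<in> \<Omega> \<Longrightarrow> smooth_on U a \<Longrightarrow> dd v (\<lambda>z. a (fst z)) z = dd (fst v) a (fst z)" for a :: "_ \<Rightarrow> real"
  using dd_eqI[OF has_derivative_compose[OF has_derivative_fst[OF has_derivative_ident] smooth_on_has_derivative], of U a z v]
  by (simp add: mem_\<Omega>)

lemma fst_zero_dd: "z \<in> \<Omega> \<Longrightarrow> smooth_on U a \<Longrightarrow> dd (0, v) (\<lambda>z. a (fst z)) z = 0" for a :: "_ \<Rightarrow> real"
  using linear_0[OF dd_linear[of "fst z" U a]] by (simp add: dd_fst mem_\<Omega>)

section \<open>Consequences of a decomposition of N; here \<open>c\<close> already includes the
  factor 1/(n - 1)\<close>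

context
  fixes c :: "real^'n \<Rightarrow> real" and \<eta> :: "'n \<Rightarrow> real^'n \<Rightarrow> real"
  assumes c: "smooth_on U c" and \<eta>: "\<And>i. smooth_on U (\<eta> i)"
    and trN: "\<And>z. z \<in> \<Omega> \<Longrightarrow> trN z = c (fst z) * f z + (\<Sum>i\<in>UNIV. \<eta> i (fst z) * snd z $ i)"
begin

lemma B_decomp:
  assumes z: "z \<in> \<Omega>"
  shows "B k z = c (fst z) * dd (eY k) f z + \<eta> k (fst z)"
proof -
  have "B k z = dd (eY k) (\<lambda>z. c (fst z) * f z + (\<Sum>i\<in>UNIV. \<eta> i (fst z) * snd z $ i)) z"
    unfolding B_def by (rule dd_cong[OF z open_\<Omega> C_trN trN])
  also have "\<dots> = c (fst z) * dd (eY k) f z + (\<Sum>i\<in>UNIV. \<eta> i (fst z) * (axis k 1 $ i))"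
    by (simp add: dd_add[OF z] dd_mult[OF z] dd_sum[OF z] C_intros smooth_fst c \<eta> C_f dd_snd fst_zero_dd[OF z])
  also have "(\<Sum>i\<in>UNIV. \<eta> i (fst z) * (axis k 1 $ i)) = \<eta> k (fst z)"
    by (simp add: axis_def if_distrib cong: if_cong)
  finally show ?thesis .
qed

lemma dd_B_decomp:
  assumes z: "z \<in> \<Omega>"
  shows "dd v (B k) z = dd (fst v) c (fst z) * dd (eY k) f z + c (fst z) * dd v (dd (eY k) f) z
    + dd (fst v) (\<eta> k) (fst z)"
proof -
  have "dd v (B k) z = dd v (\<lambda>z. c (fst z) * dd (eY k) f z + \<eta> k (fst z)) z"
    by (rule dd_cong[OF z open_\<Omega> C_B B_decomp])
  then show ?thesis
    by (simp add: dd_add[OF z] dd_mult[OF z] C_intros smooth_fst c \<eta> C_f dd_fst[OF z])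
qed

lemma dd_B_decomp_vert:
  assumes z: "z \<in> \<Omega>"
  shows "dd (eY l) (B k) z = c (fst z) * dd (eY l) (dd (eY k) f) z"
proof -
  have x: "fst z \<in> U" using z by (simp add: mem_\<Omega>)
  show ?thesis
    using linear_0[OF dd_linear[OF x c]] linear_0[OF dd_linear[OF x \<eta>[of k]]] by (simp add: dd_B_decomp[OF z])
qed

lemma es_decomp:
  assumes z: "z \<in> \<Omega>"
  shows "es z = (real CARD('n) - 1) * c (fst z)"
proof -
  have "es z = c (fst z) * (f z * (\<Sum>k\<in>UNIV. \<Sum>l\<in>UNIV. gi k l z * dd (eY l) (dd (eY k) f) z))"
    by (simp add: es_def dd_B_decomp_vert[OF z] sum_distrib_left ac_simps)
  then show ?thesis by (simp add: tr_hess_f[OF z])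
qed

text \<open>F Hess F = g - dF dF, and the frame vectors other than the one at \<open>ix_n\<close>
  are g-orthogonal to y, hence annihilated by dF (\<open>uf\<close>); what remains is g on an
  orthonormal frame.\<close>

lemma mean_berwald_decomp:
  assumes z: "z \<in> \<Omega>" and u: "adapted f z u" and g: "\<gamma> \<noteq> ix_n" "\<mu> \<noteq> ix_n"
  shows "mean_berwald f z u \<gamma> \<mu> = c (fst z) * (if \<gamma> = \<mu> then 1 else 0)"
proof -
  have uf: "(\<Sum>k\<in>UNIV. u \<gamma> $ k * dd (eY k) f z) = 0" if "\<gamma> \<noteq> ix_n" for \<gamma>
  proof -
    have "0 = (\<Sum>k\<in>UNIV. \<Sum>l\<in>UNIV. gc k l z * u \<gamma> $ k * u ix_n $ l)"
      using conjunct1[OF u[unfolded adapted_def], rule_format, of \<gamma> ix_n] that by (simp add: fund_gc)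
    also have "\<dots> = (1 / f z) * (\<Sum>k\<in>UNIV. u \<gamma> $ k * (\<Sum>l\<in>UNIV. gc k l z * snd z $ l))"
      using u by (simp add: adapted_def sum_distrib_left ac_simps)
    also have "\<dots> = (\<Sum>k\<in>UNIV. u \<gamma> $ k * dd (eY k) f z)"
      using f_pos[OF z] by (simp only: gc_y[OF z]) (simp add: sum_distrib_left ac_simps)
    finally show ?thesis ..
  qed
  have "mean_berwald f z u \<gamma> \<mu>
    = c (fst z) * (\<Sum>k\<in>UNIV. \<Sum>l\<in>UNIV. u \<gamma> $ k * u \<mu> $ l * (f z * dd (eY l) (dd (eY k) f) z))"
    by (simp add: mean_berwald_eq[OF z u] dd_B_decomp_vert[OF z] sum_distrib_left ac_simps)
  also have "(\<Sum>k\<in>UNIV. \<Sum>l\<in>UNIV. u \<gamma> $ k * u \<mu> $ l * (f z * dd (eY l) (dd (eY k) f) z))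
    = (\<Sum>k\<in>UNIV. \<Sum>l\<in>UNIV. gc k l z * u \<gamma> $ k * u \<mu> $ l)
      - (\<Sum>k\<in>UNIV. u \<gamma> $ k * dd (eY k) f z) * (\<Sum>l\<in>UNIV. u \<mu> $ l * dd (eY l) f z)"
    by (simp add: gc_eq_ff[OF z] algebra_simps sum_product sum_subtractf sum.distrib)
  also have "\<dots> = (if \<gamma> = \<mu> then 1 else 0)"
    using u uf[OF g(1)] by (simp add: adapted_def fund_gc)
  finally show ?thesis .
qed

text \<open>Differentiating \<open>horizontal_f\<close> in y^k gives two terms by the product rule,
  and the vertical part of the lift cancels the one with the Hessian of F.\<close>

lemma dd_hlift:
  assumes z: "z \<in> \<Omega>"
  shows "dd (hlift f z a) (dd (eY k) f) z = (\<Sum>i\<in>UNIV. a $ i * (\<Sum>l\<in>UNIV. dd (eY k) (dd (eY i) (G l)) z * dd (eY l) f z))"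
proof -
  have "dd (eX i) (dd (eY k) f) z = (\<Sum>l\<in>UNIV. dd (eY k) (dd (eY i) (G l)) z * dd (eY l) f z)
      + (\<Sum>l\<in>UNIV. Nc l i z * dd (eY l) (dd (eY k) f) z)" for i
  proof -
    have "dd (eX i) (dd (eY k) f) z = dd (eY k) (dd (eX i) f) z" by (rule dd_comm[OF z C_f])
    also have "\<dots> = dd (eY k) (\<lambda>w. \<Sum>l\<in>UNIV. Nc l i w * dd (eY l) f w) z"
      by (rule dd_cong[OF z open_\<Omega>]) (auto intro!: C_intros C_f simp: horizontal_f)
    finally show ?thesis
      by (simp add: dd_sum[OF z] dd_mult[OF z] C_intros C_G C_f sum.distrib dd_comm[OF z C_f, where v = "eY k"])
  qed
  then have "(\<Sum>i\<in>UNIV. a $ i * dd (eX i) (dd (eY k) f) z)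
    = (\<Sum>i\<in>UNIV. a $ i * (\<Sum>l\<in>UNIV. dd (eY k) (dd (eY i) (G l)) z * dd (eY l) f z))
      + (\<Sum>i\<in>UNIV. \<Sum>l\<in>UNIV. a $ i * Nc l i z * dd (eY l) (dd (eY k) f) z)"
    by (simp add: distrib_left sum.distrib sum_distrib_left ac_simps)
  moreover have "(\<Sum>i\<in>UNIV. \<Sum>l\<in>UNIV. a $ i * Nc l i z * dd (eY l) (dd (eY k) f) z)
    = (\<Sum>l\<in>UNIV. (\<Sum>i\<in>UNIV. Nc l i z * a $ i) * dd (eY l) (dd (eY k) f) z)"
    by (subst sum.swap) (simp add: sum_distrib_right ac_simps)
  moreover have "dd (hlift f z a) (dd (eY k) f) z = (\<Sum>i\<in>UNIV. a $ i * dd (eX i) (dd (eY k) f) z)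
      - (\<Sum>l\<in>UNIV. (\<Sum>i\<in>UNIV. Nc l i z * a $ i) * dd (eY l) (dd (eY k) f) z)"
    by (subst dd_expand[OF smooth_on_dd[OF C_f] z]) (simp add: hlift_def nonlin_eq sum_negf)
  ultimately show ?thesis by simp
qed

text \<open>This is the symmetry of the second y-derivatives of G. It means that the differential of
  the Hilbert form vanishes on pairs of horizontal vectors, so that c times the Hilbert form
  contributes only dc wedge \<open>\<omega>\<^sup>n\<close>.\<close>

lemma hlift_f_symmetric:
  assumes z: "z \<in> \<Omega>"
  shows "(\<Sum>k\<in>UNIV. dd (hlift f z a) (dd (eY k) f) z * b $ k) = (\<Sum>k\<in>UNIV. dd (hlift f z b) (dd (eY k) f) z * a $ k)"
proof -
  have "(\<Sum>k\<in>UNIV. dd (hlift f z a) (dd (eY k) f) z * b $ k)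
    = (\<Sum>k\<in>UNIV. \<Sum>i\<in>UNIV. b $ k * (a $ i * (\<Sum>l\<in>UNIV. dd (eY k) (dd (eY i) (G l)) z * dd (eY l) f z)))" for a b
    by (simp add: dd_hlift[OF z] sum_distrib_left ac_simps)
  note e = this
  show ?thesis unfolding e
    by (subst sum.swap) (simp add: ac_simps dd_comm[OF z C_G, where v = "eY i" and w = "eY k" for i k])
qed

lemma hilbert_eq: "hilbert_form f z X = (\<Sum>k\<in>UNIV. dd (eY k) f z * fst X $ k)"
  by (simp add: hilbert_form_def py_dd)

lemma tr_curv_hlift:
  assumes z: "z \<in> \<Omega>"
  shows "tr_curv z (hlift f z (fst X)) (hlift f z (fst Y))
    = wedge (\<lambda>X. dd (fst X) c (fst z)) (hilbert_form f z) X Y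
      + ((\<Sum>k\<in>UNIV. dd (fst X) (\<eta> k) (fst z) * fst Y $ k) - (\<Sum>k\<in>UNIV. dd (fst Y) (\<eta> k) (fst z) * fst X $ k))"
proof -
  have fh: "fst (hlift f z a) = a" for a by (simp add: hlift_def)
  have "(\<Sum>k\<in>UNIV. dd (hlift f z (fst X)) (B k) z * fst Y $ k)
    = dd (fst X) c (fst z) * hilbert_form f z Y
      + c (fst z) * (\<Sum>k\<in>UNIV. dd (hlift f z (fst X)) (dd (eY k) f) z * fst Y $ k)
      + (\<Sum>k\<in>UNIV. dd (fst X) (\<eta> k) (fst z) * fst Y $ k)" for X Y :: "(real^'n) \<times> (real^'n)"
    by (simp add: dd_B_decomp[OF z] fh hilbert_eq sum.distrib sum_distrib_left algebra_simps)
  then show ?thesis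
    unfolding tr_curv_def fh wedge_def using hlift_f_symmetric[OF z, of "fst X" "fst Y"] by simp
qed

end

lemma hlift_linear: "linear (hlift f z)"
  unfolding hlift_def
  by (rule linearI) (simp_all add: vec_eq_iff sum.distrib sum_distrib_left algebra_simps)

text \<open>The forms \<open>coframe_h\<close> ignore vertical components, so \<open>tr_R\<close> is
  the trace evaluated on the horizontal lifts of the projected vectors. The factor 1/2 compensates
  for counting each pair of indices twice.\<close>

lemma tr_R_eq:
  assumes z: "z \<in> \<Omega>" and u: "adapted f z u"
  shows "tr_R f z u X Y = tr_curv z (hlift f z (fst X)) (hlift f z (fst Y))"
proof -
  define Q where "Q a b = (\<Sum>m\<in>UNIV. dd (hlift f z a) (B m) z * b $ m)" for a b
  define \<theta> where "\<theta> k X = coframe_h f z u k X" for k X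
  have lin: "linear (\<lambda>a. dd (hlift f z a) (B m) z)" for m
    using linear_compose[OF hlift_linear dd_linear[OF z C_B]] by (simp add: o_def)
  have Q1: "Q (\<Sum>k\<in>UNIV. s k *\<^sub>R u k) b = (\<Sum>k\<in>UNIV. s k * Q (u k) b)" for s b
    unfolding Q_def linear_sum[OF lin] linear_scale[OF lin] sum_distrib_right sum_distrib_left
    by (subst sum.swap) (simp add: ac_simps)
  have Q2: "Q a (\<Sum>k\<in>UNIV. s k *\<^sub>R u k) = (\<Sum>k\<in>UNIV. s k * Q a (u k))" for s a
  proof -
    have "Q a (\<Sum>k\<in>UNIV. s k *\<^sub>R u k) = (\<Sum>m\<in>UNIV. \<Sum>k\<in>UNIV. s k * (dd (hlift f z a) (B m) z * u k $ m))"
      by (simp add: Q_def sum_distrib_left sum_distrib_right ac_simps)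
    also have "\<dots> = (\<Sum>k\<in>UNIV. \<Sum>m\<in>UNIV. s k * (dd (hlift f z a) (B m) z * u k $ m))"
      by (rule sum.swap)
    finally show ?thesis by (simp add: Q_def sum_distrib_left)
  qed
  have Q: "(\<Sum>k\<in>UNIV. \<Sum>l\<in>UNIV. \<theta> k X * \<theta> l Y * Q (u k) (u l)) = Q (fst X) (fst Y)" for X Y
    unfolding coframe_expand[OF z u, of X, symmetric] coframe_expand[OF z u, of Y, symmetric] Q1 Q2 \<theta>_def
    by (subst sum.swap) (simp add: sum_distrib_left ac_simps)
  have Q': "(\<Sum>k\<in>UNIV. \<Sum>l\<in>UNIV. \<theta> k X * \<theta> l Y * Q (u l) (u k)) = Q (fst Y) (fst X)" for X Y
    unfolding Q[symmetric, of Y X] by (subst sum.swap) (simp add: ac_simps)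
  have tc: "tr_curv z (hlift f z a) (hlift f z b) = Q a b - Q b a" for a b
    by (simp add: tr_curv_def Q_def hlift_def)
  have "tr_R f z u X Y = 1/2 * (\<Sum>k\<in>UNIV. \<Sum>l\<in>UNIV. (Q (u k) (u l) - Q (u l) (u k)) * (\<theta> k X * \<theta> l Y - \<theta> k Y * \<theta> l X))"
    unfolding tr_R_def berwald_R_def trace_frame[OF z u] frame_h_def tc wedge_def \<theta>_def by simp
  also have "(\<Sum>k\<in>UNIV. \<Sum>l\<in>UNIV. (Q (u k) (u l) - Q (u l) (u k)) * (\<theta> k X * \<theta> l Y - \<theta> k Y * \<theta> l X))
    = (\<Sum>k\<in>UNIV. \<Sum>l\<in>UNIV. \<theta> k X * \<theta> l Y * Q (u k) (u l)) - (\<Sum>k\<in>UNIV. \<Sum>l\<in>UNIV. \<theta> k Y * \<theta> l X * Q (u k) (u l))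
      - ((\<Sum>k\<in>UNIV. \<Sum>l\<in>UNIV. \<theta> k X * \<theta> l Y * Q (u l) (u k)) - (\<Sum>k\<in>UNIV. \<Sum>l\<in>UNIV. \<theta> k Y * \<theta> l X * Q (u l) (u k)))"
    by (simp add: sum_subtractf[symmetric] algebra_simps)
  also have "\<dots> = 2 * (Q (fst X) (fst Y) - Q (fst Y) (fst X))"
    unfolding Q Q' by simp
  finally show ?thesis by (simp add: tc)
qed

end

section \<open>Index algebra for the divergence identity\<close>

lemma sum5_permute:
  fixes X :: "'n::finite \<Rightarrow> 'n \<Rightarrow> 'n \<Rightarrow> 'n \<Rightarrow> 'n \<Rightarrow> real"
  shows "(\<Sum>k\<in>UNIV. \<Sum>p\<in>UNIV. \<Sum>q\<in>UNIV. \<Sum>a\<in>UNIV. \<Sum>b\<in>UNIV. X k p q a b)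
    = (\<Sum>a\<in>UNIV. \<Sum>p\<in>UNIV. \<Sum>q\<in>UNIV. \<Sum>k\<in>UNIV. \<Sum>b\<in>UNIV. X k p q a b)"
  unfolding sum.cartesian_product
  by (rule sum.reindex_bij_witness[where i = "\<lambda>(a, p, q, k, b). (k, p, q, a, b)" and j = "\<lambda>(k, p, q, a, b). (a, p, q, k, b)"])
    auto

lemma sum6_permute:
  fixes X :: "'n::finite \<Rightarrow> 'n \<Rightarrow> 'n \<Rightarrow> 'n \<Rightarrow> 'n \<Rightarrow> 'n \<Rightarrow> real"
  shows "(\<Sum>k\<in>UNIV. \<Sum>l\<in>UNIV. \<Sum>p\<in>UNIV. \<Sum>q\<in>UNIV. \<Sum>i\<in>UNIV. \<Sum>j\<in>UNIV. X k l p q i j)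
    = (\<Sum>i\<in>UNIV. \<Sum>j\<in>UNIV. \<Sum>k\<in>UNIV. \<Sum>l\<in>UNIV. \<Sum>p\<in>UNIV. \<Sum>q\<in>UNIV. X k l p q i j)"
  unfolding sum.cartesian_product
  by (rule sum.reindex_bij_witness[where i = "\<lambda>(i, j, k, l, p, q). (k, l, p, q, i, j)"
        and j = "\<lambda>(k, l, p, q, i, j). (i, j, k, l, p, q)"]) auto

text \<open>Here \<open>\<gamma>\<close> plays the role of the inverse of a metric \<open>g\<close> that is the Hessian of some function,
  \<open>c\<close> that of the derivatives of \<open>g\<close>, and \<open>b\<close>, \<open>b3\<close> those of the second and third derivatives of a
  function \<open>h\<close>; \<open>trace\<close> is the derivative of the equation \<open>\<gamma>\<^sup>k\<^sup>p h\<^sub>k\<^sub>p = 0\<close>. The conclusion is that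
  \<open>det g \<gamma>\<^sup>k\<^sup>p \<gamma>\<^sup>l\<^sup>q h\<^sub>p\<^sub>q\<close> has divergence 0.\<close>

lemma cofactor_divergence:
  fixes \<gamma> b :: "'n::finite \<Rightarrow> 'n \<Rightarrow> real" and c b3 :: "'n \<Rightarrow> 'n \<Rightarrow> 'n \<Rightarrow> real"
  assumes \<gamma>: "\<And>k p. \<gamma> k p = \<gamma> p k"
    and c: "\<And>i j k. c i j k = c j i k" "\<And>i j k. c i j k = c k j i"
    and b3: "\<And>i j k. b3 i j k = b3 k i j"
    and d\<gamma>: "\<And>i j k. d\<gamma> i j k = - (\<Sum>p\<in>UNIV. \<Sum>q\<in>UNIV. \<gamma> i p * \<gamma> j q * c p q k)"
    and trace: "\<And>m. (\<Sum>k\<in>UNIV. \<Sum>p\<in>UNIV. d\<gamma> k p m * b k p + \<gamma> k p * b3 k p m) = 0"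
  shows "(\<Sum>k\<in>UNIV. (\<Sum>i\<in>UNIV. \<Sum>j\<in>UNIV. \<gamma> i j * c j i k) * (\<Sum>p\<in>UNIV. \<Sum>q\<in>UNIV. \<gamma> k p * \<gamma> l q * b p q)
    + (\<Sum>p\<in>UNIV. \<Sum>q\<in>UNIV. d\<gamma> k p k * \<gamma> l q * b p q + \<gamma> k p * d\<gamma> l q k * b p q + \<gamma> k p * \<gamma> l q * b3 p q k)) = 0"
proof -
  have c3: "c i j k = c i k j" for i j k using c by metis
  \<comment> \<open>By Jacobi's formula this is the k-th derivative of ln det g.\<close>
  define V where "V k = (\<Sum>i\<in>UNIV. \<Sum>j\<in>UNIV. \<gamma> i j * c j i k)" for k
  define A where "A p = (\<Sum>q\<in>UNIV. \<gamma> l q * b p q)" for p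
  have contract1: "(\<Sum>p\<in>UNIV. \<Sum>q\<in>UNIV. \<gamma> k p * \<gamma> l q * b p q) = (\<Sum>p\<in>UNIV. \<gamma> k p * A p)" for k
    by (simp add: A_def sum_distrib_left ac_simps)
  have contract2: "(\<Sum>q\<in>UNIV. d\<gamma> k p k * \<gamma> l q * b p q) = d\<gamma> k p k * A p" for k p
    by (simp add: A_def sum_distrib_left ac_simps)
  have 1: "(\<Sum>k\<in>UNIV. V k * (\<Sum>p\<in>UNIV. \<Sum>q\<in>UNIV. \<gamma> k p * \<gamma> l q * b p q)) = (\<Sum>p\<in>UNIV. (\<Sum>k\<in>UNIV. V k * \<gamma> k p) * A p)"
    unfolding contract1 sum_distrib_left sum_distrib_right by (subst sum.swap) (simp add: ac_simps)
  have 2: "(\<Sum>k\<in>UNIV. \<Sum>p\<in>UNIV. \<Sum>q\<in>UNIV. d\<gamma> k p k * \<gamma> l q * b p q) = (\<Sum>p\<in>UNIV. (\<Sum>k\<in>UNIV. d\<gamma> k p k) * A p)"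
    unfolding contract2 sum_distrib_right by (rule sum.swap)
  \<comment> \<open>The derivative of det g cancels that of the first inverse metric: the cofactor
    matrix of a Hessian is divergence free, by the total symmetry of \<open>c\<close>.\<close>
  have 3: "(\<Sum>k\<in>UNIV. d\<gamma> k p k) = - (\<Sum>k\<in>UNIV. V k * \<gamma> k p)" for p
  proof -
    have "(\<Sum>k\<in>UNIV. \<Sum>i\<in>UNIV. \<Sum>j\<in>UNIV. \<gamma> k i * \<gamma> p j * c i j k)
        = (\<Sum>k\<in>UNIV. \<Sum>j\<in>UNIV. \<Sum>i\<in>UNIV. \<gamma> k i * \<gamma> p j * c i j k)"
      by (intro sum.cong refl sum.swap)
    also have "\<dots> = (\<Sum>j\<in>UNIV. \<Sum>k\<in>UNIV. \<Sum>i\<in>UNIV. \<gamma> k i * \<gamma> p j * c i j k)"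
      by (rule sum.swap)
    also have "\<dots> = (\<Sum>j\<in>UNIV. V j * \<gamma> j p)"
      unfolding V_def sum_distrib_right by (intro sum.cong refl, subst c3, subst \<gamma>[of p]) simp
    finally show ?thesis by (simp add: d\<gamma> sum_negf)
  qed
  have 4: "(\<Sum>k\<in>UNIV. \<Sum>p\<in>UNIV. \<Sum>q\<in>UNIV. \<gamma> k p * d\<gamma> l q k * b p q)
      = - (\<Sum>a\<in>UNIV. \<Sum>p\<in>UNIV. \<Sum>q\<in>UNIV. \<Sum>k\<in>UNIV. \<Sum>j\<in>UNIV. \<gamma> l a * (\<gamma> k p * \<gamma> q j * c a j k * b p q))"
    (is "_ = - ?r")
  proof -
    have "(\<Sum>k\<in>UNIV. \<Sum>p\<in>UNIV. \<Sum>q\<in>UNIV. \<gamma> k p * d\<gamma> l q k * b p q)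
      = - (\<Sum>k\<in>UNIV. \<Sum>p\<in>UNIV. \<Sum>q\<in>UNIV. \<Sum>a\<in>UNIV. \<Sum>j\<in>UNIV. \<gamma> l a * (\<gamma> k p * \<gamma> q j * c a j k * b p q))"
      by (simp add: d\<gamma> sum_distrib_left sum_distrib_right sum_negf ac_simps)
    also have "(\<Sum>k\<in>UNIV. \<Sum>p\<in>UNIV. \<Sum>q\<in>UNIV. \<Sum>a\<in>UNIV. \<Sum>j\<in>UNIV. \<gamma> l a * (\<gamma> k p * \<gamma> q j * c a j k * b p q)) = ?r"
      by (rule sum5_permute)
    finally show ?thesis .
  qed
  have 5: "(\<Sum>k\<in>UNIV. \<Sum>p\<in>UNIV. \<Sum>q\<in>UNIV. \<gamma> k p * \<gamma> l q * b3 p q k)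
      = (\<Sum>q\<in>UNIV. \<gamma> l q * (\<Sum>k\<in>UNIV. \<Sum>p\<in>UNIV. \<gamma> k p * b3 k p q))"
  proof -
    have "(\<Sum>k\<in>UNIV. \<Sum>p\<in>UNIV. \<Sum>q\<in>UNIV. \<gamma> k p * \<gamma> l q * b3 p q k)
        = (\<Sum>k\<in>UNIV. \<Sum>q\<in>UNIV. \<Sum>p\<in>UNIV. \<gamma> k p * \<gamma> l q * b3 p q k)"
      by (intro sum.cong refl sum.swap)
    also have "\<dots> = (\<Sum>q\<in>UNIV. \<Sum>k\<in>UNIV. \<Sum>p\<in>UNIV. \<gamma> k p * \<gamma> l q * b3 p q k)"
      by (rule sum.swap)
    also have "\<dots> = (\<Sum>q\<in>UNIV. \<Sum>k\<in>UNIV. \<Sum>p\<in>UNIV. \<gamma> l q * (\<gamma> k p * b3 k p q))"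
      by (intro sum.cong refl, subst b3) simp
    finally show ?thesis by (simp only: sum_distrib_left)
  qed
  \<comment> \<open>The differentiated trace condition trades the third derivatives of h for second
    ones, so that term 5 cancels term 4.\<close>
  have 6: "(\<Sum>k\<in>UNIV. \<Sum>p\<in>UNIV. \<gamma> k p * b3 k p q)
      = (\<Sum>p\<in>UNIV. \<Sum>r\<in>UNIV. \<Sum>k\<in>UNIV. \<Sum>j\<in>UNIV. \<gamma> k p * \<gamma> r j * c q j k * b p r)" for q
  proof -
    have "(\<Sum>k\<in>UNIV. \<Sum>p\<in>UNIV. \<gamma> k p * b3 k p q) = - (\<Sum>p\<in>UNIV. \<Sum>r\<in>UNIV. d\<gamma> p r q * b p r)"
      using trace[of q] by (simp add: sum.distrib)
    also have "\<dots> = (\<Sum>p\<in>UNIV. \<Sum>r\<in>UNIV. \<Sum>k\<in>UNIV. \<Sum>j\<in>UNIV. \<gamma> p k * \<gamma> r j * c k j q * b p r)"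
      by (simp add: d\<gamma> sum_negf sum_distrib_right)
    also have "\<dots> = (\<Sum>p\<in>UNIV. \<Sum>r\<in>UNIV. \<Sum>k\<in>UNIV. \<Sum>j\<in>UNIV. \<gamma> k p * \<gamma> r j * c q j k * b p r)"
      by (intro sum.cong refl, subst \<gamma>, subst c(2), rule refl)
    finally show ?thesis .
  qed
  have "(\<Sum>k\<in>UNIV. V k * (\<Sum>p\<in>UNIV. \<Sum>q\<in>UNIV. \<gamma> k p * \<gamma> l q * b p q)
    + (\<Sum>p\<in>UNIV. \<Sum>q\<in>UNIV. d\<gamma> k p k * \<gamma> l q * b p q + \<gamma> k p * d\<gamma> l q k * b p q + \<gamma> k p * \<gamma> l q * b3 p q k))
    = (\<Sum>k\<in>UNIV. V k * (\<Sum>p\<in>UNIV. \<Sum>q\<in>UNIV. \<gamma> k p * \<gamma> l q * b p q))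
    + (\<Sum>k\<in>UNIV. \<Sum>p\<in>UNIV. \<Sum>q\<in>UNIV. d\<gamma> k p k * \<gamma> l q * b p q)
    + (\<Sum>k\<in>UNIV. \<Sum>p\<in>UNIV. \<Sum>q\<in>UNIV. \<gamma> k p * d\<gamma> l q k * b p q)
    + (\<Sum>k\<in>UNIV. \<Sum>p\<in>UNIV. \<Sum>q\<in>UNIV. \<gamma> k p * \<gamma> l q * b3 p q k)"
    by (simp add: sum.distrib)
  also have "\<dots> = 0"
    unfolding 1 2 3 4 5 6 by (simp add: sum_negf sum_distrib_left)
  finally show ?thesis by (simp add: V_def)
qed

text \<open>The squared norm of \<open>b\<close> becomes a sum of squares of frame components, which
  makes nonnegativity visible.\<close>

lemma sum4_frame:
  fixes u :: "'n::finite \<Rightarrow> 'n \<Rightarrow> real" and b :: "'n \<Rightarrow> 'n \<Rightarrow> real"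
  shows "(\<Sum>k\<in>UNIV. \<Sum>l\<in>UNIV. \<Sum>p\<in>UNIV. \<Sum>q\<in>UNIV. (\<Sum>i\<in>UNIV. u i k * u i p) * (\<Sum>j\<in>UNIV. u j l * u j q) * b p q * b k l)
    = (\<Sum>i\<in>UNIV. \<Sum>j\<in>UNIV. (\<Sum>k\<in>UNIV. \<Sum>l\<in>UNIV. u i k * u j l * b k l)\<^sup>2)" (is "?l = ?r")
proof -
  have "?l = (\<Sum>k\<in>UNIV. \<Sum>l\<in>UNIV. \<Sum>p\<in>UNIV. \<Sum>q\<in>UNIV. \<Sum>i\<in>UNIV. \<Sum>j\<in>UNIV. u i k * u i p * (u j l * u j q) * b p q * b k l)"
    unfolding sum_product unfolding sum_distrib_right ..
  also have "\<dots> = (\<Sum>i\<in>UNIV. \<Sum>j\<in>UNIV. \<Sum>k\<in>UNIV. \<Sum>l\<in>UNIV. \<Sum>p\<in>UNIV. \<Sum>q\<in>UNIV. u i k * u i p * (u j l * u j q) * b p q * b k l)"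
    by (rule sum6_permute)
  also have "\<dots> = (\<Sum>i\<in>UNIV. \<Sum>j\<in>UNIV. \<Sum>k\<in>UNIV. \<Sum>l\<in>UNIV. \<Sum>p\<in>UNIV. \<Sum>q\<in>UNIV. (u i k * u j l * b k l) * (u i p * u j q * b p q))"
    by (intro sum.cong refl) simp
  also have "\<dots> = ?r"
    by (simp only: power2_eq_square sum_distrib_right) (simp only: sum_distrib_left)
  finally show ?thesis .
qed

text \<open>Positive exactly on (1, 2), it keeps the field away from both the zero section and
  infinity. The square makes it continuously differentiable, which is all that the divergence
  theorem asks for.\<close>

definition cutoff :: "real \<Rightarrow> real" where "cutoff t = (max 0 ((t - 1) * (2 - t)))\<^sup>2"

definition cutoff' :: "real \<Rightarrow> real" where "cutoff' t = 2 * max 0 ((t - 1) * (2 - t)) * (3 - 2 * t)"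

lemma max0_square_deriv: "((\<lambda>s::real. (max 0 s)\<^sup>2) has_real_derivative 2 * max 0 s) (at s)"
proof -
  consider "s > 0" | "s < 0" | "s = 0" by linarith
  then show ?thesis
  proof cases
    case 1
    have "((\<lambda>s::real. s\<^sup>2) has_real_derivative 2 * max 0 s) (at s)"
      using 1 by (auto intro!: derivative_eq_intros simp: max_def)
    then show ?thesis
      
      by (rule has_field_derivative_transform_within_open[of "\<lambda>s. s\<^sup>2" _ _ "{0<..}"])
        (use 1 in auto)
  next
    case 2
    have "((\<lambda>s::real. 0) has_real_derivative 2 * max 0 s) (at s)" using 2 by (simp add: max_def)
    then show ?thesis
      by (rule has_field_derivative_transform_within_open[of "\<lambda>s. 0" _ _ "{..<0}"]) (use 2 in auto)
  next
    case 3
    \<comment> \<open>At the junction the difference quotient is bounded by |h|.\<close>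
    have "((\<lambda>h::real. h) \<longlongrightarrow> 0) (at 0)" by (rule tendsto_ident_at)
    then have "((\<lambda>h::real. (max 0 h)\<^sup>2 / h) \<longlongrightarrow> 0) (at 0)"
      by (rule Lim_null_comparison[rotated, OF tendsto_norm_zero])
        (auto simp: power2_eq_square max_def)
    then show ?thesis using 3 by (simp add: DERIV_def)
  qed
qed

lemma cutoff_deriv: "(cutoff has_real_derivative cutoff' t) (at t)"
proof -
  have "((\<lambda>t. (t - 1) * (2 - t)) has_real_derivative 3 - 2 * t) (at t)"
    by (auto intro!: derivative_eq_intros)
  from DERIV_chain2[OF max0_square_deriv this] show ?thesis
    by (simp add: cutoff_def[abs_def] cutoff'_def)
qed

lemma cutoff_zero: "t \<le> 1 \<or> t \<ge> 2 \<Longrightarrow> cutoff t = 0 \<and> cutoff' t = 0"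
proof -
  assume "t \<le> 1 \<or> t \<ge> 2"
  then have "(t - 1) * (2 - t) \<le> 0" by (auto simp: mult_le_0_iff)
  then show ?thesis by (simp add: cutoff_def cutoff'_def)
qed

lemma cutoff_pos: "1 < t \<Longrightarrow> t < 2 \<Longrightarrow> cutoff t > 0"
  by (simp add: cutoff_def max_def not_le)

lemma cutoff_nonneg: "cutoff t \<ge> 0" by (simp add: cutoff_def)

lemma cutoff_cont: "continuous_on UNIV cutoff" "continuous_on UNIV cutoff'"
  unfolding cutoff_def[abs_def] cutoff'_def[abs_def] by (intro continuous_intros)+

context finsler_chart begin

subsection \<open>Rigidity of trace-free Hessians\<close>

text \<open>Differentiate the product of \<open>g\<close> and its inverse, which is constant, and
  solve.\<close>

lemma dd_gi:
  assumes z: "z \<in> \<Omega>"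
  shows "dd v (gi i j) z = - (\<Sum>p\<in>UNIV. \<Sum>q\<in>UNIV. gi i p z * gi j q z * dd v (gc p q) z)"
proof -
  have "(\<Sum>b\<in>UNIV. gc a b z * dd v (gi b j) z) = - (\<Sum>b\<in>UNIV. dd v (gc a b) z * gi b j z)" for a
  proof -
    have "dd v (\<lambda>w. \<Sum>b\<in>UNIV. gc a b w * gi b j w) z = dd v (\<lambda>w. if a = j then 1 else 0 :: real) z"
      by (rule dd_cong[OF z open_\<Omega>]) (auto intro!: C_intros C_gc C_gi simp: gc_gi)
    then show ?thesis
      by (simp add: dd_sum[OF z] dd_mult[OF z] C_intros C_gc C_gi sum.distrib)
  qed
  from gi_solve[OF z this, of i] show ?thesis
    by (simp add: gi_sym[OF z, of _ j] sum_negf sum_distrib_left ac_simps)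
qed

lemma f_zero: "x \<in> U \<Longrightarrow> f (x, 0) = 0"
  using scale[of x 2 0] by simp

text \<open>By homogeneity \<open>f\<close> grows at least like its minimum on the unit sphere times
  |y|. The bound 2 is the upper end of the support of \<open>cutoff\<close>, so the truncated field
  has bounded support.\<close>

lemma fibre_bound:
  assumes x: "x \<in> U"
  obtains R where "\<And>y. norm y > R \<Longrightarrow> f (x, y) \<ge> 2"
proof -
  have cf: "continuous_on UNIV (\<lambda>y. f (x, y))"
    by (rule continuous_on_compose2[OF cont]) (use x in \<open>auto intro!: continuous_intros\<close>)
  have "compact (sphere (0::real^'n) 1)" "sphere (0::real^'n) 1 \<noteq> {}" by auto
  from continuous_attains_inf[OF this continuous_on_subset[OF cf]]
  obtain y0 where y0: "y0 \<in> sphere 0 1" "\<And>y. y \<in> sphere 0 1 \<Longrightarrow> f (x, y0) \<le> f (x, y)" by auto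
  have m: "f (x, y0) > 0" using y0 x by (intro f_pos) (auto simp: mem_\<Omega>)
  have "f (x, y) \<ge> 2" if "norm y > 2 / f (x, y0)" for y
  proof -
    have n: "norm y > 0" using that m by (smt (verit) divide_pos_pos)
    have "f (x, y) = norm y * f (x, (1 / norm y) *\<^sub>R y)"
      using scale[OF x n, of "(1 / norm y) *\<^sub>R y"] n by simp
    also have "\<dots> \<ge> norm y * f (x, y0)"
      using n by (intro mult_left_mono y0) auto
    also have "norm y * f (x, y0) \<ge> 2" using that m by (simp add: field_simps)
    finally show ?thesis by simp
  qed
  then show thesis by (rule that)
qed

context
  fixes h :: "(real^'n) \<times> (real^'n) \<Rightarrow> real"
  assumes h: "C h" and hom_h: "hom U 1 h"
    and tr_h: "\<And>z. z \<in> \<Omega> \<Longrightarrow> (\<Sum>k\<in>UNIV. \<Sum>l\<in>UNIV. gi k l z * dd (eY l) (dd (eY k) h) z) = 0"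
begin

abbreviation h2 where "h2 k l z \<equiv> dd (eY l) (dd (eY k) h) z"

abbreviation \<rho> where "\<rho> z \<equiv> det (fund_tensor f z)"

text \<open>The Hessian of h with both indices raised; the weight det g is what makes its divergence
  vanish.\<close>

definition T where "T k l z = \<rho> z * (\<Sum>p\<in>UNIV. \<Sum>q\<in>UNIV. gi k p z * gi l q z * h2 p q z)"

definition V where "V k z = (\<Sum>l\<in>UNIV. T k l z * dd (eY l) h z)"

lemma C_T: "C (T k l)" unfolding T_def[abs_def] by (intro C_intros C_gi C_det h)

lemma C_V: "C (V k)" unfolding V_def[abs_def] by (intro C_intros C_T h)

text \<open>Jacobi's formula lets det g be factored out, and the rest is an instance of
  \<open>cofactor_divergence\<close>.\<close>

lemma div_T:
  assumes z: "z \<in> \<Omega>"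
  shows "(\<Sum>k\<in>UNIV. dd (eY k) (T k l) z) = 0"
proof -
  have \<rho>': "dd (eY k) \<rho> z = \<rho> z * (\<Sum>i\<in>UNIV. \<Sum>j\<in>UNIV. gi i j z * dd (eY k) (gc j i) z)" for k
    using det_g[OF z] smooth_on_differentiable[OF C_gc z]
    by (subst dd_det) (auto simp: fund_gc gi_def)
  have T': "dd (eY k) (T k l) z = \<rho> z *
      ((\<Sum>i\<in>UNIV. \<Sum>j\<in>UNIV. gi i j z * dd (eY k) (gc j i) z) * (\<Sum>p\<in>UNIV. \<Sum>q\<in>UNIV. gi k p z * gi l q z * h2 p q z)
       + (\<Sum>p\<in>UNIV. \<Sum>q\<in>UNIV. dd (eY k) (gi k p) z * gi l q z * h2 p q z + gi k p z * dd (eY k) (gi l q) z * h2 p q z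
          + gi k p z * gi l q z * dd (eY k) (dd (eY q) (dd (eY p) h)) z))" for k
  proof -
    have "dd (eY k) (T k l) z = dd (eY k) \<rho> z * (\<Sum>p\<in>UNIV. \<Sum>q\<in>UNIV. gi k p z * gi l q z * h2 p q z)
       + \<rho> z * (\<Sum>p\<in>UNIV. \<Sum>q\<in>UNIV. dd (eY k) (gi k p) z * gi l q z * h2 p q z + gi k p z * dd (eY k) (gi l q) z * h2 p q z
          + gi k p z * gi l q z * dd (eY k) (dd (eY q) (dd (eY p) h)) z)"
      unfolding T_def[abs_def]
      by (simp add: dd_mult[OF z] dd_sum[OF z] C_intros C_gi C_det h distrib_right)
    then show ?thesis unfolding \<rho>' by (simp only: distrib_left mult.assoc)
  qed
  have "(\<Sum>k\<in>UNIV. dd (eY k) (T k l) z) = \<rho> z * 0"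
    unfolding T' sum_distrib_left[symmetric]
  proof (rule arg_cong[OF cofactor_divergence])
    show "gi k p z = gi p k z" for k p by (rule gi_sym[OF z])
    show "dd (eY k) (gc i j) z = dd (eY k) (gc j i) z" for i j k by (rule dd_gc_swap[OF z])
    show "dd (eY k) (gc i j) z = dd (eY i) (gc k j) z" for i j k by (rule dd_gc_cycle[OF z])
    show "dd (eY k) (h2 i j) z = dd (eY j) (h2 k i) z" for i j k
      using dd_comm[OF z smooth_on_dd[OF h], where v = "eY k" and w = "eY j"]
        dd_comm2[OF z h, where v = "eY k" and w = "eY i"] by simp
    show "dd (eY k) (gi i j) z = - (\<Sum>p\<in>UNIV. \<Sum>q\<in>UNIV. gi i p z * gi j q z * dd (eY k) (gc p q) z)" for i j k
      by (rule dd_gi[OF z])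
    show "(\<Sum>k\<in>UNIV. \<Sum>p\<in>UNIV. dd (eY m) (gi k p) z * h2 k p z + gi k p z * dd (eY m) (h2 k p) z) = 0" for m
    proof -
      have "dd (eY m) (\<lambda>w. \<Sum>k\<in>UNIV. \<Sum>l\<in>UNIV. gi k l w * dd (eY l) (dd (eY k) h) w) z = dd (eY m) (\<lambda>w. 0::real) z"
        by (rule dd_cong[OF z open_\<Omega>]) (auto intro!: C_intros C_gi h simp: tr_h)
      then show ?thesis by (simp add: dd_sum[OF z] dd_mult[OF z] C_intros C_gi h)
    qed
  qed
  then show ?thesis by simp
qed

lemma euler_h2: "z \<in> \<Omega> \<Longrightarrow> (\<Sum>p\<in>UNIV. snd z $ p * h2 p q z) = 0"
proof -
  assume z: "z \<in> \<Omega>"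
  have "hom U 0 (dd (eY q) h)" using hom_dy'[OF h hom_h] by simp
  from euler'[OF smooth_on_dd[OF h] this z] show ?thesis
    by (simp add: dd_comm[OF z h, where v = "eY q"])
qed

text \<open>Raising the index of dF gives y/F, which lies in the kernel of the Hessian of the
  1-homogeneous h. Hence a function of F multiplied to \<open>V\<close> is not differentiated by the
  divergence.\<close>

lemma V_radial:
  assumes z: "z \<in> \<Omega>"
  shows "(\<Sum>k\<in>UNIV. dd (eY k) f z * V k z) = 0"
proof -
  have "(\<Sum>k\<in>UNIV. dd (eY k) f z * T k l z) = 0" for l
  proof -
    have "(\<Sum>k\<in>UNIV. dd (eY k) f z * T k l z)
        = (\<Sum>k\<in>UNIV. \<Sum>p\<in>UNIV. \<rho> z * ((gi p k z * dd (eY k) f z) * (\<Sum>q\<in>UNIV. gi l q z * h2 p q z)))"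
      by (simp add: T_def gi_sym[OF z, of k p for k p] sum_distrib_left ac_simps)
    also have "\<dots> = (\<Sum>p\<in>UNIV. \<rho> z * ((\<Sum>k\<in>UNIV. gi p k z * dd (eY k) f z) * (\<Sum>q\<in>UNIV. gi l q z * h2 p q z)))"
      by (subst sum.swap) (simp only: sum_distrib_left[symmetric] sum_distrib_right[symmetric])
    also have "\<dots> = \<rho> z / f z * (\<Sum>p\<in>UNIV. \<Sum>q\<in>UNIV. gi l q z * (snd z $ p * h2 p q z))"
      by (simp add: gi_fy[OF z] sum_distrib_left ac_simps)
    also have "(\<Sum>p\<in>UNIV. \<Sum>q\<in>UNIV. gi l q z * (snd z $ p * h2 p q z)) = 0"
      by (subst sum.swap) (simp add: sum_distrib_left[symmetric] euler_h2[OF z])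
    finally show ?thesis by simp
  qed
  then have "(\<Sum>l\<in>UNIV. (\<Sum>k\<in>UNIV. dd (eY k) f z * T k l z) * dd (eY l) h z) = 0" by simp
  moreover have "(\<Sum>k\<in>UNIV. dd (eY k) f z * V k z) = (\<Sum>l\<in>UNIV. (\<Sum>k\<in>UNIV. dd (eY k) f z * T k l z) * dd (eY l) h z)"
    unfolding V_def sum_distrib_left sum_distrib_right by (subst sum.swap) (simp add: ac_simps)
  ultimately show ?thesis by simp
qed

text \<open>As \<open>T\<close> is divergence free, the derivative falls on dh alone and leaves
  \<open>T\<close> contracted with the Hessian, det g times a squared norm.\<close>

lemma div_V:
  assumes z: "z \<in> \<Omega>" and u: "adapted f z u"
  shows "(\<Sum>k\<in>UNIV. dd (eY k) (V k) z)
    = \<rho> z * (\<Sum>i\<in>UNIV. \<Sum>j\<in>UNIV. (\<Sum>k\<in>UNIV. \<Sum>l\<in>UNIV. u i $ k * u j $ l * h2 k l z)\<^sup>2)"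
proof -
  have "(\<Sum>k\<in>UNIV. dd (eY k) (V k) z)
      = (\<Sum>k\<in>UNIV. \<Sum>l\<in>UNIV. dd (eY k) (T k l) z * dd (eY l) h z) + (\<Sum>k\<in>UNIV. \<Sum>l\<in>UNIV. T k l z * h2 l k z)"
    unfolding V_def[abs_def] by (simp add: dd_sum[OF z] dd_mult[OF z] C_intros C_T h sum.distrib)
  also have "(\<Sum>k\<in>UNIV. \<Sum>l\<in>UNIV. dd (eY k) (T k l) z * dd (eY l) h z) = 0"
    by (subst sum.swap) (simp add: sum_distrib_right[symmetric] div_T[OF z])
  also have "(\<Sum>k\<in>UNIV. \<Sum>l\<in>UNIV. T k l z * h2 l k z)
      = \<rho> z * (\<Sum>k\<in>UNIV. \<Sum>l\<in>UNIV. \<Sum>p\<in>UNIV. \<Sum>q\<in>UNIV. gi k p z * gi l q z * h2 p q z * h2 k l z)"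
    by (simp add: T_def sum_distrib_left sum_distrib_right ac_simps dd_comm[OF z h, where v = "eY k" and w = "eY l" for k l])
  finally show ?thesis
    using sum4_frame[of "\<lambda>i k. u i $ k" "\<lambda>k l. h2 k l z"] by (simp add: adapted_gi[OF z u])
qed

text \<open>Since det g > 0, all frame components of the Hessian vanish; contraction with the dual
  coframe returns to coordinates.\<close>

lemma h2_zero_of_div_V:
  assumes z: "z \<in> \<Omega>" and d: "(\<Sum>k\<in>UNIV. dd (eY k) (V k) z) = 0"
  shows "h2 a b z = 0"
proof -
  obtain u where u: "adapted f z u" using adapted_exists[OF z] by blast
  have "(\<Sum>i\<in>UNIV. \<Sum>j\<in>UNIV. (\<Sum>k\<in>UNIV. \<Sum>l\<in>UNIV. u i $ k * u j $ l * h2 k l z)\<^sup>2) = 0"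
    using d div_V[OF z u] det_g[OF z] by simp
  then have 0: "(\<Sum>k\<in>UNIV. \<Sum>l\<in>UNIV. u i $ k * u j $ l * h2 k l z) = 0" for i j
    by (simp add: sum_nonneg_eq_0_iff sum_nonneg)
  define \<theta> where "\<theta> i a = coframe_h f z u i (eX a)" for i a
  have "0 = (\<Sum>i\<in>UNIV. \<Sum>j\<in>UNIV. \<theta> i a * \<theta> j b * (\<Sum>k\<in>UNIV. \<Sum>l\<in>UNIV. u i $ k * u j $ l * h2 k l z))"
    by (simp only: 0) simp
  also have "\<dots> = (\<Sum>i\<in>UNIV. \<Sum>j\<in>UNIV. \<Sum>k\<in>UNIV. \<Sum>l\<in>UNIV. (\<theta> i a * u i $ k) * (\<theta> j b * u j $ l) * h2 k l z)"
    by (simp add: sum_distrib_left ac_simps)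
  also have "\<dots> = (\<Sum>k\<in>UNIV. \<Sum>l\<in>UNIV. \<Sum>i\<in>UNIV. \<Sum>j\<in>UNIV. (\<theta> i a * u i $ k) * (\<theta> j b * u j $ l) * h2 k l z)"
    unfolding sum.cartesian_product
    by (rule sum.reindex_bij_witness[where i = "\<lambda>(k, l, i, j). (i, j, k, l)" and j = "\<lambda>(i, j, k, l). (k, l, i, j)"]) auto
  also have "\<dots> = (\<Sum>k\<in>UNIV. \<Sum>l\<in>UNIV. (\<Sum>i\<in>UNIV. \<theta> i a * u i $ k) * (\<Sum>j\<in>UNIV. \<theta> j b * u j $ l) * h2 k l z)"
    unfolding sum_product unfolding sum_distrib_right ..
  also have "\<dots> = h2 a b z"
    by (simp add: \<theta>_def coframe_dual[OF z u] mult.assoc sum_distrib_left[symmetric] sum_delta_mult)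
  finally show ?thesis ..
qed

lemma div_V_eq_0:
  assumes x: "x \<in> U" and f12: "1 < f (x, y)" "f (x, y) < 2"
  shows "(\<Sum>k\<in>UNIV. dd (eY k) (V k) (x, y)) = 0"
proof -
  define W where "W k y = cutoff (f (x, y)) * V k (x, y)" for k y
  \<comment> \<open>The expected derivative of \<open>W\<close> on the whole fibre. At y = 0 the
    derivatives of \<open>f\<close> and \<open>V\<close> carry no information, but their cutoff
    factors are 0 there.\<close>
  define W' where "W' k v y = cutoff' (f (x, y)) * dd (0, v) f (x, y) * V k (x, y)
      + cutoff (f (x, y)) * dd (0, v) (V k) (x, y)" for k v y
  have cf: "continuous_on UNIV (\<lambda>y. f (x, y))"
    by (rule continuous_on_compose2[OF cont]) (use x in \<open>auto intro!: continuous_intros\<close>)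
  define N where "N = {y. f (x, y) < 1}"
  have N: "open N" "0 \<in> N"
    using f_zero[OF x] by (auto simp: N_def intro!: open_Collect_less cf)
  have W0: "W k y = 0" "W' k v y = 0" if "y \<in> N" for k v y
    using that cutoff_zero[of "f (x, y)"] by (simp_all add: W_def W'_def N_def)
  have der: "(W k has_derivative (\<lambda>v. W' k v y)) (at y)" for k y
  proof (cases "y = 0")
    case True
    have "(W k has_derivative (\<lambda>v. 0)) (at y)"
      by (rule has_derivative_transform_within_open[OF has_derivative_const N(1)]) (use True N W0 in auto)
    then show ?thesis using True N W0 by simp
  next
    case False
    then have z: "(x, y) \<in> \<Omega>" using x by (simp add: mem_\<Omega>)
    have slice: "((\<lambda>y. a (x, y)) has_derivative (\<lambda>v. dd (0, v) a (x, y))) (at y)" if "C a" for a :: "_ \<Rightarrow> real"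
      by (rule has_derivative_compose[where f = "\<lambda>y. (x, y)", OF _ smooth_on_has_derivative[OF that z]])
        (auto intro!: derivative_eq_intros)
    have "((\<lambda>y. cutoff (f (x, y))) has_derivative (\<lambda>v. cutoff' (f (x, y)) * dd (0, v) f (x, y))) (at y)"
      using has_derivative_compose[OF slice[OF C_f] cutoff_deriv[unfolded has_field_derivative_def]] by simp
    from has_derivative_mult[OF this slice[OF C_V]] show ?thesis
      unfolding W_def[abs_def] W'_def by (simp add: ac_simps)
  qed
  have ddW: "dd v (W k) y = W' k v y" for v k y
    by (rule dd_eqI[OF der])
  have contW': "continuous_on UNIV (W' k v)" for k v
  proof -
    have "continuous_on (UNIV - {0}) (W' k v)"
    proof -
      have s: "continuous_on (UNIV - {0}) (\<lambda>y. a (x, y))" if "C a" for a :: "_ \<Rightarrow> real"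
        by (rule continuous_on_compose2[OF smooth_on_continuous[OF that]])
          (use x in \<open>auto intro!: continuous_intros simp: mem_\<Omega>\<close>)
      have g: "continuous_on (UNIV - {0}) (\<lambda>y. g (f (x, y)))" if "continuous_on UNIV g" for g :: "real \<Rightarrow> real"
        by (rule continuous_on_compose2[OF that s[OF C_f]]) auto
      show ?thesis unfolding W'_def[abs_def]
        by (intro continuous_on_add continuous_on_mult g[OF cutoff_cont(1)] g[OF cutoff_cont(2)]
            s[OF C_V] s[OF smooth_on_dd[OF C_f]] s[OF smooth_on_dd[OF C_V]])
    qed
    moreover have "continuous_on N (W' k v)"
      using W0 continuous_on_cong[of N N "W' k v" "\<lambda>_. 0"] by simp
    ultimately have "continuous_on ((UNIV - {0}) \<union> N) (W' k v)"
      using N by (intro continuous_on_open_Un) auto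
    moreover have "(UNIV - {0}) \<union> N = UNIV" using N by auto
    ultimately show ?thesis by simp
  qed
  obtain R where R: "\<And>y. norm y > R \<Longrightarrow> f (x, y) \<ge> 2" using fibre_bound[OF x] by blast
  \<comment> \<open>The derivative of the cutoff is multiplied by dF(V) = 0.\<close>
  have div: "(\<Sum>k\<in>UNIV. W' k (axis k 1) y) = cutoff (f (x, y)) * (\<Sum>k\<in>UNIV. dd (eY k) (V k) (x, y))" if "y \<noteq> 0" for y
  proof -
    have "(x, y) \<in> \<Omega>" using that x by (simp add: mem_\<Omega>)
    have "(\<Sum>k\<in>UNIV. W' k (axis k 1) y) = cutoff' (f (x, y)) * (\<Sum>k\<in>UNIV. dd (eY k) f (x, y) * V k (x, y))
        + cutoff (f (x, y)) * (\<Sum>k\<in>UNIV. dd (eY k) (V k) (x, y))"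
      by (simp add: W'_def sum.distrib sum_distrib_left ac_simps)
    then show ?thesis using V_radial[OF \<open>(x, y) \<in> \<Omega>\<close>] by simp
  qed
  have "(\<Sum>k\<in>UNIV. dd (axis k 1) (W k) y) = 0"
  proof (rule nonneg_divergence_eq_0[where R = R and I = UNIV])
    show "W k differentiable at y" for k y using der by (auto simp: differentiable_def)
    show "continuous_on UNIV (dd (axis k 1) (W k))" for k by (simp add: ddW contW')
    show "W k y = 0" if "norm y > R" for k y
      using R[OF that] cutoff_zero[of "f (x, y)"] by (simp add: W_def)
    show "0 \<le> (\<Sum>k\<in>UNIV. dd (axis k 1) (W k) y)" for y
    proof (cases "y = 0")
      case True
      then show ?thesis using N W0 by (simp add: ddW)
    next
      case False
      then have z: "(x, y) \<in> \<Omega>" using x by (simp add: mem_\<Omega>)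
      obtain u where u: "adapted f (x, y) u" using adapted_exists[OF z] by blast
      show ?thesis unfolding ddW div[OF False] div_V[OF z u]
        using det_g[OF z] by (intro mult_nonneg_nonneg cutoff_nonneg sum_nonneg) auto
    qed
  qed auto
  moreover have "y \<noteq> 0" using f12 f_zero[OF x] by auto
  ultimately show ?thesis using div[of y] cutoff_pos[OF f12] by (simp add: ddW)
qed

lemma trace_free_hessian_rigidity:
  assumes z: "z \<in> \<Omega>"
  shows "dd (eY l) (dd (eY k) h) z = 0"
proof -
  have x: "fst z \<in> U" "snd z \<noteq> 0" using z by (simp_all add: mem_\<Omega>)
  \<comment> \<open>This scaling puts the point on the level F = 3/2, inside the shell 1 < F < 2;
    the Hessian of h is homogeneous of degree -1, so it vanishes at \<open>z\<close> as
    well.\<close>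
  define t where "t = 3 / 2 / f z"
  have t: "t > 0" using f_pos[OF z] by (simp add: t_def)
  have "f (fst z, t *\<^sub>R snd z) = 3 / 2" using scale[OF x(1) t, of "snd z"] f_pos[OF z] by (simp add: t_def)
  then have "h2 k l (fst z, t *\<^sub>R snd z) = 0"
    using x t by (intro h2_zero_of_div_V div_V_eq_0) (auto simp: mem_\<Omega>)
  moreover have "h2 k l (fst z, t *\<^sub>R snd z) = t powr (1 - 1 - 1) * h2 k l (fst z, snd z)"
    using hom_dy'[OF smooth_on_dd[OF h] hom_dy'[OF h hom_h], unfolded hom_def, rule_format, OF x t] .
  ultimately show ?thesis using t by simp
qed

end

end

subsection \<open>Change of coordinates\<close>

lemma smooth_on_component:
  fixes \<Phi> :: "'a::real_normed_vector \<Rightarrow> real^'n::finite"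
  assumes "open W" "smooth_on W \<Phi>"
  shows "smooth_on W (\<lambda>x. \<Phi> x $ m)"
    and "x \<in> W \<Longrightarrow> dd v (\<lambda>x. \<Phi> x $ m) x = dd v \<Phi> x $ m"
proof -
  have d: "((\<lambda>x. \<Phi> x $ m) has_derivative (\<lambda>h. dd h \<Phi> x $ m)) (at x)"
    if "\<Phi> differentiable (at x)" for \<Phi> :: "'a \<Rightarrow> real^'n" and x
    by (rule bounded_linear.has_derivative[OF bounded_linear_vec_nth])
      (use that in \<open>simp add: frechet_derivative_works\<close>)
  have "diff_upto k W \<Phi> \<Longrightarrow> diff_upto k W (\<lambda>x. \<Phi> x $ m)" for k and \<Phi> :: "'a \<Rightarrow> real^'n"
  proof (induction k arbitrary: \<Phi>)
    case 0
    then show ?case by (auto intro!: continuous_intros)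
  next
    case (Suc k)
    have "diff_upto k W (dd v (\<lambda>x. \<Phi> x $ m))" for v
      by (rule diff_upto_cong[OF assms(1), of "\<lambda>x. dd v \<Phi> x $ m"])
        (use Suc dd_eqI[OF d] in auto)
    moreover have "(\<lambda>x. \<Phi> x $ m) differentiable (at x)" if "x \<in> W" for x
      using d[of \<Phi> x] Suc.prems that differentiableI by auto
    ultimately show ?case by auto
  qed
  then show "smooth_on W (\<lambda>x. \<Phi> x $ m)" using assms(2) by (simp add: smooth_on_def)
  show "dd v (\<lambda>x. \<Phi> x $ m) x = dd v \<Phi> x $ m" if "x \<in> W"
    using dd_eqI[OF d[OF smooth_on_differentiable[OF assms(2) that]]] .
qed

context finsler_chart begin

text \<open>A form of the Euler-Lagrange equation suited to coordinate changes: it involves only a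
  vector on TM applied to E_y, with no reference to the coefficients of the metric.\<close>

lemma spray_vector_iff:
  assumes z: "z \<in> \<Omega>"
  shows "dd (snd z, -2 *\<^sub>R (\<chi> l. b l)) (dd (eY i) E) z = dd (eX i) E z \<longleftrightarrow>
    4 * (\<Sum>l\<in>UNIV. gc i l z * b l) = (\<Sum>k\<in>UNIV. dd (eY i) (dd (eX k) E) z * snd z $ k) - dd (eX i) E z"
proof -
  have "dd (snd z, -2 *\<^sub>R (\<chi> l. b l)) (dd (eY i) E) z
    = (\<Sum>k\<in>UNIV. dd (eY i) (dd (eX k) E) z * snd z $ k) - 4 * (\<Sum>l\<in>UNIV. gc i l z * b l)"
    by (subst dd_expand[OF smooth_on_dd[OF C_E] z])
      (simp add: gc_def sum_negf sum_distrib_left ac_simps dd_comm[OF z C_E, where w = "eY i"])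
  then show ?thesis by linarith
qed

end

locale chart_change = src: finsler_chart U f + dst: finsler_chart V f'
  for U :: "(real^'n::finite) set" and f and V :: "(real^'n) set" and f' +
  fixes W :: "(real^'n) set" and \<Phi> :: "real^'n \<Rightarrow> real^'n"
  assumes W: "open W" "W \<subseteq> U"
    and \<Phi>: "smooth_on W \<Phi>" "\<Phi> ` W \<subseteq> V"
    and f_eq: "x \<in> W \<Longrightarrow> f (x, y) = f' (\<Phi> x, dd y \<Phi> x)"
    and regular: "x \<in> W \<Longrightarrow> det (matrix (frechet_derivative \<Phi> (at x))) \<noteq> 0"
begin

definition P where "P m i x = dd (axis i 1) (\<lambda>x. \<Phi> x $ m) x"

definition T where "T z = (\<Phi> (fst z), \<chi> m. \<Sum>i\<in>UNIV. P m i (fst z) * snd z $ i)"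

text \<open>The second derivatives of \<open>\<Phi>\<close> enter the vertical component; because of
  them the coefficients G^i are not tensorial.\<close>

definition DT where "DT z v = (\<chi> m. \<Sum>i\<in>UNIV. P m i (fst z) * fst v $ i,
  \<chi> m. (\<Sum>i\<in>UNIV. dd (fst v) (P m i) (fst z) * snd z $ i) + (\<Sum>i\<in>UNIV. P m i (fst z) * snd v $ i))"

lemma smooth_P: "smooth_on W (P m i)"
  unfolding P_def[abs_def] by (intro smooth_on_dd smooth_on_component(1) W \<Phi>)

lemma P_sym: "x \<in> W \<Longrightarrow> dd (axis k 1) (P m i) x = dd (axis i 1) (P m k) x"
  unfolding P_def[abs_def] using dd_commute[OF W(1) smooth_on_component(1)[OF W(1) \<Phi>(1)]] by blast

lemma P_matrix: "x \<in> W \<Longrightarrow> matrix (frechet_derivative \<Phi> (at x)) = (\<chi> m i. P m i x)"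
  by (simp add: matrix_def P_def smooth_on_component(2)[OF W(1) \<Phi>(1)] vec_eq_iff)

lemma jacobian: "x \<in> W \<Longrightarrow> dd y \<Phi> x = (\<chi> m. \<Sum>i\<in>UNIV. P m i x * y $ i)"
  using matrix_works[of "frechet_derivative \<Phi> (at x)" y] dd_linear[OF _ \<Phi>(1), of x]
  by (simp add: P_matrix matrix_vector_mult_def linear_matrix_vector_mul_eq)

lemma P_inj:
  assumes x: "x \<in> W" and "\<And>i. (\<Sum>m\<in>UNIV. P m i x * a m) = 0"
  shows "a m = 0"
proof -
  let ?P = "\<chi> m i. P m i x"
  have "det (transpose ?P) \<noteq> 0" using regular[OF x] by (simp add: P_matrix[OF x])
  then obtain Q where "Q ** transpose ?P = mat 1"
    using matrix_inv_mult(2) by blast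
  moreover have "transpose ?P *v (\<chi> m. a m) = 0"
    using assms(2) by (simp add: vec_eq_iff matrix_vector_mult_def transpose_def)
  ultimately have "(\<chi> m. a m) = 0"
    by (metis matrix_vector_mul_assoc matrix_vector_mul_lid matrix_vector_mult_0_right)
  then show ?thesis by (simp add: vec_eq_iff)
qed

lemma src_dst:
  assumes "fst z \<in> W" "snd z \<noteq> 0"
  shows "z \<in> src.\<Omega>" "T z \<in> dst.\<Omega>"
proof -
  show "z \<in> src.\<Omega>" using assms W by (auto simp: src.mem_\<Omega>)
  have "snd (T z) \<noteq> 0"
  proof
    assume "snd (T z) = 0"
    then have 0: "dd (snd z) \<Phi> (fst z) = 0" using assms by (simp add: T_def jacobian)
    let ?M = "matrix (frechet_derivative \<Phi> (at (fst z)))"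
    have "?M *v snd z = 0"
      using 0 matrix_works[of "frechet_derivative \<Phi> (at (fst z))" "snd z"] dd_linear[OF assms(1) \<Phi>(1)]
      by (simp add: linear_matrix_vector_mul_eq)
    then have "matrix_inv ?M *v (?M *v snd z) = 0" by simp
    then show False
      using assms by (simp add: matrix_vector_mul_assoc matrix_inv_mult(2) regular)
  qed
  then show "T z \<in> dst.\<Omega>" using assms \<Phi>(2) by (auto simp: dst.mem_\<Omega> T_def)
qed

lemma T_deriv:
  assumes z: "fst z \<in> W"
  shows "(T has_derivative DT z) (at z)"
proof -
  have P: "((\<lambda>z. P m i (fst z)) has_derivative (\<lambda>v. dd (fst v) (P m i) (fst z))) (at z)" for m i
    by (rule has_derivative_compose[OF has_derivative_fst[OF has_derivative_ident] smooth_on_has_derivative[OF smooth_P z]])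
  have "((\<lambda>z. \<Phi> (fst z)) has_derivative (\<lambda>v. dd (fst v) \<Phi> (fst z))) (at z)"
    by (rule has_derivative_compose[OF has_derivative_fst[OF has_derivative_ident] smooth_on_has_derivative[OF \<Phi>(1) z]])
  then have 1: "((\<lambda>z. \<Phi> (fst z)) has_derivative (\<lambda>v. \<chi> m. \<Sum>i\<in>UNIV. P m i (fst z) * fst v $ i)) (at z)"
    by (simp add: jacobian[OF z])
  have s: "((\<lambda>z. snd z $ i) has_derivative (\<lambda>v. snd v $ i)) (at z)" for i
    by (intro bounded_linear_imp_has_derivative bounded_linear_compose[OF bounded_linear_vec_nth bounded_linear_snd])
  have "((\<lambda>z. \<chi> m. \<Sum>i\<in>UNIV. P m i (fst z) * snd z $ i) has_derivative
      (\<lambda>v. \<chi> m. \<Sum>i\<in>UNIV. P m i (fst z) * snd v $ i + dd (fst v) (P m i) (fst z) * snd z $ i)) (at z)"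
    by (subst has_derivative_componentwise_within)
      (auto simp: Basis_vec_def inner_axis intro!: has_derivative_sum has_derivative_mult P s)
  from has_derivative_Pair[OF 1 this] show ?thesis
    unfolding T_def[abs_def] DT_def by (simp add: sum.distrib add.commute)
qed

lemma chain:
  fixes a a' :: "(real^'n) \<times> (real^'n) \<Rightarrow> real"
  assumes z: "fst z \<in> W" "snd z \<noteq> 0"
    and a': "dst.C a'" and eq: "\<And>w. fst w \<in> W \<Longrightarrow> snd w \<noteq> 0 \<Longrightarrow> a w = a' (T w)"
  shows "(a has_derivative (\<lambda>v. dd (DT z v) a' (T z))) (at z)"
proof (rule has_derivative_transform_within_open)
  show "((\<lambda>w. a' (T w)) has_derivative (\<lambda>v. dd (DT z v) a' (T z))) (at z)"
    by (rule has_derivative_compose[OF T_deriv[OF z(1)] smooth_on_has_derivative[OF a' src_dst(2)[OF z]]])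
  show "open (W \<times> (UNIV - {0::real^'n}))" using W by (intro open_Times) auto
qed (use z eq in \<open>auto simp: mem_Times_iff\<close>)

lemma dd_chain:
  fixes a a' :: "(real^'n) \<times> (real^'n) \<Rightarrow> real"
  assumes "fst z \<in> W" "snd z \<noteq> 0" "dst.C a'" "\<And>w. fst w \<in> W \<Longrightarrow> snd w \<noteq> 0 \<Longrightarrow> a w = a' (T w)"
  shows "dd v a z = dd (DT z v) a' (T z)"
  by (rule dd_eqI[OF chain[OF assms]])

lemma f_T: "fst w \<in> W \<Longrightarrow> f w = f' (T w)"
  using f_eq[of "fst w" "snd w"] by (simp add: jacobian T_def)

lemma E_T: "fst w \<in> W \<Longrightarrow> src.E w = dst.E (T w)"
  by (simp add: src.E_def dst.E_def f_T)

lemma DT_eY: "fst z \<in> W \<Longrightarrow> DT z (eY i) = (0, \<chi> m. P m i (fst z))"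
  using linear_0[OF dd_linear[OF _ smooth_P], of "fst z"]
  by (simp add: DT_def zero_vec_def axis_def if_distrib cong: if_cong)

lemma dd_vertical:
  fixes a' :: "(real^'n) \<times> (real^'n) \<Rightarrow> real"
  assumes "fst z \<in> W" "snd z \<noteq> 0" "dst.C a'"
  shows "dd (DT z (eY i)) a' (T z) = (\<Sum>m\<in>UNIV. P m i (fst z) * dd (eY m) a' (T z))"
  by (subst dd_expand[OF assms(3) src_dst(2)[OF assms(1,2)]]) (simp add: DT_eY assms)

lemma E_y:
  assumes z: "fst z \<in> W" "snd z \<noteq> 0"
  shows "dd (eY i) src.E z = (\<Sum>m\<in>UNIV. P m i (fst z) * dd (eY m) dst.E (T z))"
  using dd_chain[OF z dst.C_E E_T] dd_vertical[OF z dst.C_E] by simp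

lemma dd_E_y:
  assumes z: "fst z \<in> W" "snd z \<noteq> 0"
  shows "dd v (dd (eY i) src.E) z = (\<Sum>m\<in>UNIV. dd (fst v) (P m i) (fst z) * dd (eY m) dst.E (T z)
    + P m i (fst z) * dd (DT z v) (dd (eY m) dst.E) (T z))"
proof -
  have P: "((\<lambda>z. P m i (fst z)) has_derivative (\<lambda>v. dd (fst v) (P m i) (fst z))) (at z)" for m i
    by (rule has_derivative_compose[OF has_derivative_fst[OF has_derivative_ident] smooth_on_has_derivative[OF smooth_P z(1)]])
  have "((\<lambda>z. \<Sum>m\<in>UNIV. P m i (fst z) * dd (eY m) dst.E (T z)) has_derivative
      (\<lambda>v. \<Sum>m\<in>UNIV. P m i (fst z) * dd (DT z v) (dd (eY m) dst.E) (T z)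
        + dd (fst v) (P m i) (fst z) * dd (eY m) dst.E (T z))) (at z)"
    by (intro has_derivative_sum has_derivative_mult P chain[OF z smooth_on_dd[OF dst.C_E]]) simp
  then have "(dd (eY i) src.E has_derivative
      (\<lambda>v. \<Sum>m\<in>UNIV. P m i (fst z) * dd (DT z v) (dd (eY m) dst.E) (T z)
        + dd (fst v) (P m i) (fst z) * dd (eY m) dst.E (T z))) (at z)"
    by (rule has_derivative_transform_within_open[of _ _ _ _ "W \<times> (UNIV - {0::real^'n})"])
      (use z W in \<open>auto simp: mem_Times_iff E_y intro!: open_Times\<close>)
  from dd_eqI[OF this, of v] show ?thesis by (simp add: add.commute)
qed

lemma gc_T:
  assumes z: "fst z \<in> W" "snd z \<noteq> 0"
  shows "src.gc i j z = (\<Sum>m\<in>UNIV. \<Sum>l\<in>UNIV. P m i (fst z) * dst.gc m l (T z) * P l j (fst z))"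
proof -
  have 0: "dd 0 (P m i) (fst z) = 0" for m
    using linear_0[OF dd_linear[OF z(1) smooth_P]] .
  show ?thesis
    by (simp add: src.gc_def dst.gc_def dd_E_y[OF z] 0 dd_vertical[OF z smooth_on_dd[OF dst.C_E]] sum_distrib_left ac_simps)
qed

text \<open>The squared Jacobian becomes, under the square root of the distortion, exactly the
  factor picked up by the density.\<close>

lemma det_T:
  assumes z: "fst z \<in> W" "snd z \<noteq> 0"
  shows "det (fund_tensor f z)
    = (det (matrix (frechet_derivative \<Phi> (at (fst z)))))\<^sup>2 * det (fund_tensor f' (T z))"
proof -
  let ?P = "\<chi> m i. P m i (fst z)"
  have "fund_tensor f z = transpose ?P ** (fund_tensor f' (T z) ** ?P)"
    by (simp add: vec_eq_iff src.fund_gc gc_T[OF z] matrix_matrix_mult_def transpose_def dst.fund_gc sum_distrib_left ac_simps)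
  then show ?thesis by (simp add: det_mul P_matrix[OF z(1)] power2_eq_square)
qed

text \<open>The image of the spray has the right horizontal part. It satisfies the Euler-Lagrange
  equation in the new coordinates once the invertible Jacobian is removed by \<open>P_inj\<close>,
  so uniqueness identifies it.\<close>

lemma Gam_T:
  assumes z: "fst z \<in> W" "snd z \<noteq> 0"
  shows "DT z (src.Gam z) = dst.Gam (T z)"
proof -
  let ?x = "fst z"
  define b where "b m = - (1/2) * snd (DT z (src.Gam z)) $ m" for m
  have G: "DT z (src.Gam z) = (snd (T z), -2 *\<^sub>R (\<chi> m. b m))"
    by (simp add: prod_eq_iff vec_eq_iff b_def) (simp add: DT_def T_def src.Gam_def)
  have el: "dd (src.Gam z) (dd (eY i) src.E) z = dd (eX i) src.E z" for i
    using src.spray_vector_iff[OF src_dst(1)[OF z], where b = "\<lambda>l. src.G l z" and i = i] src.euler_lagrange[OF src_dst(1)[OF z]]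
    by (simp add: src.Gam_def)
  have "(\<Sum>m\<in>UNIV. P m i ?x * (dd (DT z (src.Gam z)) (dd (eY m) dst.E) (T z) - dd (eX m) dst.E (T z))) = 0" for i
  proof -
    have "dd (DT z (eX i)) dst.E (T z) = (\<Sum>m\<in>UNIV. P m i ?x * dd (eX m) dst.E (T z))
        + (\<Sum>m\<in>UNIV. (\<Sum>k\<in>UNIV. dd (axis i 1) (P m k) ?x * snd z $ k) * dd (eY m) dst.E (T z))"
      by (subst dd_expand[OF dst.C_E src_dst(2)[OF z]]) (simp add: DT_def axis_def if_distrib cong: if_cong)
    \<comment> \<open>By the symmetry of the second derivatives of \<open>\<Phi>\<close>, the
      inhomogeneous terms on the two sides agree and cancel.\<close>
    moreover have "dd (fst (src.Gam z)) (P m i) ?x = (\<Sum>k\<in>UNIV. dd (axis i 1) (P m k) ?x * snd z $ k)" for m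
    proof -
      note l = dd_linear[OF z(1) smooth_P]
      have "dd (snd z) (P m i) ?x = dd (\<Sum>k\<in>UNIV. snd z $ k *\<^sub>R axis k 1) (P m i) ?x"
        using vec_expand[of "snd z"] by simp
      also have "\<dots> = (\<Sum>k\<in>UNIV. snd z $ k * dd (axis k 1) (P m i) ?x)"
        by (simp only: linear_sum[OF l] linear_scale[OF l] real_scaleR_def)
      finally show ?thesis by (simp add: src.Gam_def P_sym[OF z(1), where m = m and i = i] ac_simps)
    qed
    ultimately show ?thesis
      using el[of i] dd_E_y[OF z, where v = "src.Gam z" and i = i] dd_chain[OF z dst.C_E E_T, where v = "eX i"]
      by (simp add: sum.distrib right_diff_distrib sum_subtractf)
  qed
  then have "dd (DT z (src.Gam z)) (dd (eY m) dst.E) (T z) - dd (eX m) dst.E (T z) = 0" for m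
    by (rule P_inj[OF z(1)])
  then have "b l = dst.G l (T z)" for l
    unfolding G
    by (intro dst.euler_lagrange_unique[OF src_dst(2)[OF z]])
      (use dst.spray_vector_iff[OF src_dst(2)[OF z], where b = b] in auto)
  then show ?thesis by (simp add: G dst.Gam_def)
qed

text \<open>The distortion is an invariant function, and the spray and F are invariant too, hence so
  is S.\<close>

lemma S_curv_invariant:
  assumes s: "smooth_on U s" "\<And>x. x \<in> U \<Longrightarrow> s x > 0" and s': "smooth_on V s'" "\<And>x. x \<in> V \<Longrightarrow> s' x > 0"
    and ss': "\<And>x. x \<in> W \<Longrightarrow> s x = s' (\<Phi> x) * \<bar>det (matrix (frechet_derivative \<Phi> (at x)))\<bar>"
    and z: "fst z \<in> W" "snd z \<noteq> 0"
  shows "S_curv f s z = S_curv f' s' (\<Phi> (fst z), dd (snd z) \<Phi> (fst z))"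
proof -
  have Tz: "T z = (\<Phi> (fst z), dd (snd z) \<Phi> (fst z))" by (simp add: T_def jacobian[OF z(1)])
  have "distortion f s w = distortion f' s' (T w)" if w: "fst w \<in> W" "snd w \<noteq> 0" for w
  proof -
    let ?D = "det (matrix (frechet_derivative \<Phi> (at (fst w))))"
    have 1: "fst w \<in> U" "fst (T w) \<in> V" using w W \<Phi>(2) by (auto simp: T_def)
    have "distortion f s w = 1/2 * ln (?D\<^sup>2 * det (fund_tensor f' (T w))) - ln (s' (\<Phi> (fst w)) * \<bar>?D\<bar>)"
      using src.distortion_eq[OF src_dst(1)[OF w], of s] s(2)[OF 1(1)] by (simp add: det_T[OF w] ss'[OF w(1)])
    also have "ln (?D\<^sup>2 * det (fund_tensor f' (T w))) = 2 * ln \<bar>?D\<bar> + ln (det (fund_tensor f' (T w)))"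
    proof -
      have "ln (?D\<^sup>2) = 2 * ln \<bar>?D\<bar>" using regular[OF w(1)] by (metis ln_realpow of_nat_numeral power2_abs zero_less_abs_iff)
      then show ?thesis using regular[OF w(1)] dst.det_g[OF src_dst(2)[OF w]] by (simp add: ln_mult_pos)
    qed
    also have "ln (s' (\<Phi> (fst w)) * \<bar>?D\<bar>) = ln (s' (fst (T w))) + ln \<bar>?D\<bar>"
      using regular[OF w(1)] s'(2)[OF 1(2)] by (simp add: T_def ln_mult_pos)
    finally show ?thesis
      using dst.distortion_eq[OF src_dst(2)[OF w], of s'] s'(2)[OF 1(2)] by (simp add: field_simps)
  qed
  from dd_chain[OF z dst.distortion_smooth[OF s'] this]
  have "f z * S_curv f s z = f' (T z) * S_curv f' s' (T z)"
    using src.S_curv_Gam[OF src_dst(1)[OF z] s] dst.S_curv_Gam[OF src_dst(2)[OF z] s']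
    by (simp add: Gam_T[OF z])
  then show ?thesis
    using f_T[OF z(1)] dst.f_pos[OF src_dst(2)[OF z]] by (simp add: Tz)
qed

end

section \<open>From the level F = 1 to the decomposition of N, and back to S\<close>

context finsler_chart begin

lemma hom_zero_on_sphere:
  assumes "hom U d h" "\<And>z. z \<in> \<Omega> \<Longrightarrow> f z = 1 \<Longrightarrow> h z = 0" "z \<in> \<Omega>"
  shows "h z = 0"
proof -
  define w where "w = (fst z, (1 / f z) *\<^sub>R snd z)"
  have z: "fst z \<in> U" "snd z \<noteq> 0" using assms(3) by (simp_all add: mem_\<Omega>)
  have p: "1 / f z > 0" using f_pos[OF assms(3)] by simp
  have "w \<in> \<Omega>" using z p by (simp add: w_def mem_\<Omega>)
  moreover have "f w = 1" using scale[OF z(1) p, of "snd z"] p by (simp add: w_def)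
  ultimately have "h w = 0" by (rule assms(2))
  moreover have "h w = (1 / f z) powr d * h z"
    using assms(1)[unfolded hom_def, rule_format, OF z p] by (simp add: w_def)
  ultimately show ?thesis using p by simp
qed

lemma es_on_sphere:
  assumes "\<And>z. z \<in> \<Omega> \<Longrightarrow> f z = 1 \<Longrightarrow> es z = c (fst z)" "z \<in> \<Omega>"
  shows "es z = c (fst z)"
proof -
  have "hom U 0 (\<lambda>z. es z - c (fst z))" using hom_es by (simp add: hom_def)
  from hom_zero_on_sphere[OF this, of z] assms show ?thesis by simp
qed

text \<open>The difference of the two sides is 1-homogeneous and vanishes where F = 1. The
  derivatives of ln s are absorbed into the linear form.\<close>

lemma trN_of_S_curv:
  assumes s: "smooth_on U s" "\<And>x. x \<in> U \<Longrightarrow> s x > 0"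
    and S: "\<And>z. z \<in> \<Omega> \<Longrightarrow> f z = 1 \<Longrightarrow> S_curv f s z = c (fst z) + (\<Sum>i\<in>UNIV. \<xi> i (fst z) * snd z $ i)"
    and z: "z \<in> \<Omega>"
  shows "trN z = c (fst z) * f z + (\<Sum>i\<in>UNIV. (\<xi> i (fst z) + dd (axis i 1) (\<lambda>x. ln (s x)) (fst z)) * snd z $ i)"
proof -
  let ?l = "\<lambda>i x. dd (axis i 1) (\<lambda>x. ln (s x)) x"
  define h where "h z = trN z - c (fst z) * f z - (\<Sum>i\<in>UNIV. (\<xi> i (fst z) + ?l i (fst z)) * snd z $ i)" for z
  have "hom U 1 h"
    using hom_trN hom_f by (simp add: hom_def h_def sum_distrib_left right_diff_distrib ac_simps)
  moreover have "h z = 0" if "z \<in> \<Omega>" "f z = 1" for z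
    using S_curv_eq[OF that(1) s] S[OF that] that(2)
    by (simp add: h_def algebra_simps sum.distrib)
  ultimately have "h z = 0" using z hom_zero_on_sphere by blast
  then show ?thesis by (simp add: h_def)
qed

text \<open>N - c F is 1-homogeneous with trace-free Hessian, because the trace of F Hess F is n -
  1. Rigidity makes its vertical gradient constant on each fibre, and Euler's relation turns that
  into linearity.\<close>

lemma trN_of_es:
  assumes n: "CARD('n) \<ge> 2" and c: "smooth_on U c" and es: "\<And>z. z \<in> \<Omega> \<Longrightarrow> es z = (real CARD('n) - 1) * c (fst z)"
  shows "\<exists>\<eta>. (\<forall>i. smooth_on U (\<eta> i)) \<and>
    (\<forall>z\<in>\<Omega>. trN z = c (fst z) * f z + (\<Sum>i\<in>UNIV. \<eta> i (fst z) * snd z $ i))"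
proof -
  define h where "h z = trN z - c (fst z) * f z" for z
  have Ch: "C h" unfolding h_def[abs_def] by (intro C_intros C_trN smooth_fst c C_f)
  have hom_h: "hom U 1 h"
    using hom_trN hom_f by (simp add: hom_def h_def right_diff_distrib)
  have h1: "dd (eY k) h z = B k z - c (fst z) * dd (eY k) f z" if z: "z \<in> \<Omega>" for z k
    unfolding h_def[abs_def] B_def
    by (simp add: dd_diff[OF z] dd_mult[OF z] C_intros C_trN smooth_fst c C_f fst_zero_dd[OF z])
  have h2: "dd (eY l) (dd (eY k) h) z = dd (eY l) (B k) z - c (fst z) * dd (eY l) (dd (eY k) f) z"
    if z: "z \<in> \<Omega>" for z k l
  proof -
    have "dd (eY l) (dd (eY k) h) z = dd (eY l) (\<lambda>z. B k z - c (fst z) * dd (eY k) f z) z"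
      by (rule dd_cong[OF z open_\<Omega> smooth_on_dd[OF Ch] h1])
    then show ?thesis
      by (simp add: dd_diff[OF z] dd_mult[OF z] C_intros C_B smooth_fst c C_f fst_zero_dd[OF z])
  qed
  have tr0: "(\<Sum>k\<in>UNIV. \<Sum>l\<in>UNIV. gi k l z * dd (eY l) (dd (eY k) h) z) = 0" if z: "z \<in> \<Omega>" for z
  proof -
    have "f z * (\<Sum>k\<in>UNIV. \<Sum>l\<in>UNIV. gi k l z * dd (eY l) (dd (eY k) h) z)
      = es z - c (fst z) * (f z * (\<Sum>k\<in>UNIV. \<Sum>l\<in>UNIV. gi k l z * dd (eY l) (dd (eY k) f) z))"
      by (simp add: h2[OF z] es_def sum_subtractf sum_distrib_left algebra_simps)
    also have "\<dots> = 0" by (simp add: tr_hess_f[OF z] es[OF z])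
    finally show ?thesis using f_pos[OF z] by simp
  qed
  have rigid: "dd (eY l) (dd (eY k) h) z = 0" if "z \<in> \<Omega>" for z k l
    by (rule trace_free_hessian_rigidity[OF Ch hom_h tr0 that])
  \<comment> \<open>Any nonzero vector serves. Reading off the gradient at a fixed \<open>y0\<close>
    reduces smoothness in x to restriction to a slice.\<close>
  define y0 :: "real^'n" where "y0 = axis undefined 1"
  have y0: "y0 \<noteq> 0" by (simp add: y0_def)
  define \<eta> where "\<eta> k x = dd (eY k) h (x, y0)" for k x
  have const: "dd (eY k) h (x, y) = \<eta> k x" if x: "x \<in> U" and y: "y \<noteq> 0" for k x y
  proof -
    have dz: "((\<lambda>y. dd (eY k) h (x, y)) has_derivative (\<lambda>v. 0)) (at y)" if "y \<noteq> 0" for y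
    proof -
      have z: "(x, y) \<in> \<Omega>" using x that by (simp add: mem_\<Omega>)
      have "((\<lambda>y. dd (eY k) h (x, y)) has_derivative (\<lambda>v. dd (0, v) (dd (eY k) h) (x, y))) (at y)"
        by (rule has_derivative_compose[where f = "\<lambda>y. (x, y)", OF _ smooth_on_has_derivative[OF smooth_on_dd[OF Ch] z]])
          (auto intro!: derivative_eq_intros)
      moreover have "dd (0, v) (dd (eY k) h) (x, y) = 0" for v
        by (subst dd_expand[OF smooth_on_dd[OF Ch] z]) (simp add: rigid[OF z])
      ultimately show ?thesis by simp
    qed
    \<comment> \<open>Here n >= 2 is indispensable: a punctured line is disconnected, and the
      gradient could differ on its two halves.\<close>
    have "connected (- {0::real^'n})" using n by (intro connected_punctured_universe) simp
    moreover have "open (- {0::real^'n})" by auto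
    ultimately show ?thesis unfolding \<eta>_def
      using has_derivative_zero_unique_connected[of "- {0}" "\<lambda>y. dd (eY k) h (x, y)" y y0] dz y y0 by simp
  qed
  have "smooth_on U (\<eta> k)" for k
    unfolding \<eta>_def[abs_def]
    using smooth_on_slice[OF U, of "UNIV - {0}" "dd (eY k) h" y0] smooth_on_dd[OF Ch] y0 by (simp add: \<Omega>_def)
  moreover have "trN z = c (fst z) * f z + (\<Sum>i\<in>UNIV. \<eta> i (fst z) * snd z $ i)" if z: "z \<in> \<Omega>" for z
  proof -
    have "h z = (\<Sum>i\<in>UNIV. snd z $ i * dd (eY i) h z)" using euler'[OF Ch hom_h z] by simp
    also have "\<dots> = (\<Sum>i\<in>UNIV. \<eta> i (fst z) * snd z $ i)"
      using const[of "fst z" "snd z"] z by (simp add: mem_\<Omega> mult.commute)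
    finally show ?thesis by (simp add: h_def)
  qed
  ultimately show ?thesis by blast
qed

text \<open>The linear part of N and the derivatives of ln s depend on the chart separately; the
  left side, which combines them, does not.\<close>

lemma linear_form_of_es:
  assumes n: "CARD('n) \<ge> 2" and c: "smooth_on U c" and es: "\<And>z. z \<in> \<Omega> \<Longrightarrow> es z = (real CARD('n) - 1) * c (fst z)"
    and s: "smooth_on U s" "\<And>x. x \<in> U \<Longrightarrow> s x > 0"
  shows "\<exists>\<xi>. (\<forall>i. smooth_on U (\<xi> i)) \<and>
    (\<forall>z\<in>\<Omega>. f z * (S_curv f s z - c (fst z)) = (\<Sum>i\<in>UNIV. \<xi> i (fst z) * snd z $ i))"
proof -
  obtain \<eta> where \<eta>: "\<And>i. smooth_on U (\<eta> i)"
    "\<And>z. z \<in> \<Omega> \<Longrightarrow> trN z = c (fst z) * f z + (\<Sum>i\<in>UNIV. \<eta> i (fst z) * snd z $ i)"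
    using trN_of_es[OF n c es] by blast
  let ?\<xi> = "\<lambda>i x. \<eta> i x - dd (axis i 1) (\<lambda>x. ln (s x)) x"
  have "smooth_on U (?\<xi> i)" for i
    using s U by (intro smooth_on_diff \<eta> smooth_on_dd smooth_on_ln)
  moreover have "f z * (S_curv f s z - c (fst z)) = (\<Sum>i\<in>UNIV. ?\<xi> i (fst z) * snd z $ i)" if z: "z \<in> \<Omega>" for z
    using S_curv_eq[OF z s] \<eta>(2)[OF z] by (simp add: algebra_simps sum_subtractf)
  ultimately show ?thesis by (intro exI[of _ ?\<xi>] conjI allI ballI)
qed

text \<open>The linear forms of N and of S differ by the exact form d ln s, whose exterior
  derivative vanishes; hence the density leaves no trace in the result.\<close>

lemma trace_eq_of_S_curv:
  assumes c: "smooth_on U c" and \<xi>: "\<And>i. smooth_on U (\<xi> i)" and s: "smooth_on U s" "\<And>x. x \<in> U \<Longrightarrow> s x > 0"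
    and S: "\<And>z. z \<in> \<Omega> \<Longrightarrow> f z = 1 \<Longrightarrow> S_curv f s z = c (fst z) + (\<Sum>i\<in>UNIV. \<xi> i (fst z) * snd z $ i)"
    and z: "z \<in> \<Omega>" and u: "adapted f z u"
  shows "tr_R f z u X Y = ext_deriv (\<lambda>x v. \<Sum>i\<in>UNIV. \<xi> i x * v $ i) (fst z) (fst X) (fst Y)
    + wedge (\<lambda>X. dd (fst X) c (fst z)) (hilbert_form f z) X Y"
proof -
  have x: "fst z \<in> U" using z by (simp add: mem_\<Omega>)
  let ?l = "\<lambda>x. ln (s x)"
  let ?\<eta> = "\<lambda>i x. \<xi> i x + dd (axis i 1) ?l x"
  have l: "smooth_on U ?l" using s U by (intro smooth_on_ln)
  have \<eta>: "smooth_on U (?\<eta> i)" for i using U by (intro smooth_on_add \<xi> smooth_on_dd l)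
  have tc: "tr_R f z u X Y = wedge (\<lambda>X. dd (fst X) c (fst z)) (hilbert_form f z) X Y
      + ((\<Sum>k\<in>UNIV. dd (fst X) (?\<eta> k) (fst z) * fst Y $ k) - (\<Sum>k\<in>UNIV. dd (fst Y) (?\<eta> k) (fst z) * fst X $ k))"
    unfolding tr_R_eq[OF z u] by (rule tr_curv_hlift[OF c \<eta> trN_of_S_curv[OF s S] z])
  have e: "dd v (\<lambda>x. \<Sum>i\<in>UNIV. \<xi> i x * w $ i) (fst z) = (\<Sum>i\<in>UNIV. dd v (\<xi> i) (fst z) * w $ i)" for v w
    by (simp add: dd_sum[OF x] dd_mult[OF x] smooth_on_mult[OF U] smooth_on_const \<xi>)
  have ll: "(\<Sum>k\<in>UNIV. dd v (dd (axis k 1) ?l) (fst z) * w $ k)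
      = (\<Sum>k\<in>UNIV. \<Sum>i\<in>UNIV. dd (axis i 1) (dd (axis k 1) ?l) (fst z) * v $ i * w $ k)" for v w :: "real^'n"
  proof -
    have "dd v (dd (axis k 1) ?l) (fst z) = (\<Sum>i\<in>UNIV. v $ i * dd (axis i 1) (dd (axis k 1) ?l) (fst z))" for k
    proof -
      note lin = dd_linear[OF x smooth_on_dd[OF l, of "axis k 1"]]
      have "dd v (dd (axis k 1) ?l) (fst z) = dd (\<Sum>i\<in>UNIV. v $ i *\<^sub>R axis i 1) (dd (axis k 1) ?l) (fst z)"
        using vec_expand[of v] by simp
      then show ?thesis by (simp only: linear_sum[OF lin] linear_scale[OF lin] real_scaleR_def)
    qed
    then show ?thesis by (simp add: sum_distrib_left sum_distrib_right ac_simps)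
  qed
  have "(\<Sum>k\<in>UNIV. dd (fst X) (dd (axis k 1) ?l) (fst z) * fst Y $ k)
      = (\<Sum>k\<in>UNIV. dd (fst Y) (dd (axis k 1) ?l) (fst z) * fst X $ k)"
    unfolding ll by (subst sum.swap) (simp add: ac_simps dd_commute[OF U l x, where v = "axis i 1" and w = "axis k 1" for i k])
  then show ?thesis
    unfolding tc ext_deriv_def e
    by (simp add: dd_add[OF x] \<xi> smooth_on_dd l distrib_right sum.distrib)
qed

end

subsection \<open>From charts to the manifold\<close>

locale finsler_manifold =
  fixes A :: "('m::{t2_space, second_countable_topology}, 'n::finite) chart set"
    and F :: "'m \<Rightarrow> ('m, 'n) tvec \<Rightarrow> real"
    and \<sigma> :: "('m, 'n) chart \<Rightarrow> real^'n \<Rightarrow> real"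
  assumes dim: "CARD('n) \<ge> 2"
    and atlas: "smooth_atlas A"
    and fins: "finsler A F"
    and vol: "volume_density A \<sigma>"
begin

lemma chart: "\<kappa> \<in> A \<Longrightarrow> is_chart \<kappa>"
  using atlas by (simp add: smooth_atlas_def)

lemma inv_left: "\<kappa> \<in> A \<Longrightarrow> p \<in> fst \<kappa> \<Longrightarrow> chart_inv \<kappa> (snd \<kappa> p) = p"
  and inv_right: "\<kappa> \<in> A \<Longrightarrow> x \<in> chart_img \<kappa> \<Longrightarrow> snd \<kappa> (chart_inv \<kappa> x) = x"
  and inv_dom: "\<kappa> \<in> A \<Longrightarrow> x \<in> chart_img \<kappa> \<Longrightarrow> chart_inv \<kappa> x \<in> fst \<kappa>"
  and img: "p \<in> fst \<kappa> \<Longrightarrow> snd \<kappa> p \<in> chart_img \<kappa>"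
  and open_img: "\<kappa> \<in> A \<Longrightarrow> open (chart_img \<kappa>)"
  using chart[of \<kappa>] by (auto simp: is_chart_def homeomorphism_def chart_img_def)

lemma open_overlap:
  assumes "\<kappa> \<in> A" "\<kappa>' \<in> A" shows "open (snd \<kappa> ` (fst \<kappa> \<inter> fst \<kappa>'))"
proof -
  have h: "homeomorphism (fst \<kappa>) (chart_img \<kappa>) (snd \<kappa>) (chart_inv \<kappa>)" "open (fst \<kappa>')"
    using chart assms by (auto simp: is_chart_def)
  then have "openin (top_of_set (fst \<kappa>)) (fst \<kappa> \<inter> fst \<kappa>')" by (simp add: openin_open_Int)
  then have "openin (top_of_set (chart_img \<kappa>)) (snd \<kappa> ` (fst \<kappa> \<inter> fst \<kappa>'))"
    by (rule homeomorphism_imp_open_map[OF h(1)])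
  then show ?thesis using open_img[OF assms(1)] by (rule openin_open_trans)
qed

lemma smooth_transition:
  "\<kappa> \<in> A \<Longrightarrow> \<kappa>' \<in> A \<Longrightarrow> smooth_on (snd \<kappa> ` (fst \<kappa> \<inter> fst \<kappa>')) (transition \<kappa> \<kappa>')"
  using atlas by (simp add: smooth_atlas_def)

lemma tvec_of_linear:
  assumes "\<kappa> \<in> A" "p \<in> fst \<kappa>"
  shows "tvec_of A \<kappa> p (a *\<^sub>R y + b *\<^sub>R y') = (\<lambda>\<kappa>'. a *\<^sub>R tvec_of A \<kappa> p y \<kappa>' + b *\<^sub>R tvec_of A \<kappa> p y' \<kappa>')"
proof
  fix \<kappa>'
  show "tvec_of A \<kappa> p (a *\<^sub>R y + b *\<^sub>R y') \<kappa>' = a *\<^sub>R tvec_of A \<kappa> p y \<kappa>' + b *\<^sub>R tvec_of A \<kappa> p y' \<kappa>'"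
  proof (cases "\<kappa>' \<in> A \<and> p \<in> fst \<kappa>'")
    case True
    then have "snd \<kappa> p \<in> snd \<kappa> ` (fst \<kappa> \<inter> fst \<kappa>')" and k': "\<kappa>' \<in> A" using assms by blast+
    then have "linear (frechet_derivative (transition \<kappa> \<kappa>') (at (snd \<kappa> p)))"
      by (rule dd_linear[OF _ smooth_transition[OF assms(1)]])
    then show ?thesis using True by (simp add: tvec_of_def linear_add linear_scale)
  next
    case False
    then show ?thesis by (auto simp: tvec_of_def)
  qed
qed

lemma tvec_of_tangent:
  "\<kappa> \<in> A \<Longrightarrow> p \<in> fst \<kappa> \<Longrightarrow> tvec_of A \<kappa> p y \<in> tangent_space A p"
  "\<kappa> \<in> A \<Longrightarrow> p \<in> fst \<kappa> \<Longrightarrow> tvec_of A \<kappa> p y \<kappa> = y"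
  by (rule tvec_of_in_tangent_space[OF atlas]; assumption)+

lemma tm_rep_tangent:
  assumes "\<kappa> \<in> A" "p \<in> fst \<kappa>" "v \<in> tangent_space A p"
  shows "H p v = tm_rep A H \<kappa> (snd \<kappa> p, v \<kappa>)"
  using tangent_space_eq_tvec_of[OF assms] by (simp add: tm_rep_def inv_left assms)

lemma chart_finsler: "\<kappa> \<in> A \<Longrightarrow> finsler_chart (chart_img \<kappa>) (tm_rep A F \<kappa>)"
proof
  assume k: "\<kappa> \<in> A"
  show "open (chart_img \<kappa>)" by (rule open_img[OF k])
  show "continuous_on (chart_img \<kappa> \<times> UNIV) (tm_rep A F \<kappa>)"
    "smooth_on (chart_img \<kappa> \<times> (UNIV - {0})) (tm_rep A F \<kappa>)"
    using fins k by (auto simp: finsler_def)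
  fix x y w :: "real^'n" and t :: real
  assume x: "x \<in> chart_img \<kappa>"
  let ?v = "tvec_of A \<kappa> (chart_inv \<kappa> x) y"
  have F: "F (chart_inv \<kappa> x) ?v \<ge> 0" "t > 0 \<Longrightarrow> F (chart_inv \<kappa> x) (\<lambda>\<kappa>. t *\<^sub>R ?v \<kappa>) = t * F (chart_inv \<kappa> x) ?v"
    using fins tvec_of_tangent(1)[OF k inv_dom[OF k x]] unfolding finsler_def by blast+
  show "tm_rep A F \<kappa> (x, y) \<ge> 0" using F by (simp add: tm_rep_def)
  show "tm_rep A F \<kappa> (x, t *\<^sub>R y) = t * tm_rep A F \<kappa> (x, y)" if "t > 0"
    using F(2)[OF that] tvec_of_linear[OF k inv_dom[OF k x], of t y 0 0] by (simp add: tm_rep_def)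
  show "w \<bullet> (fund_tensor (tm_rep A F \<kappa>) (x, y) *v w) > 0" if "y \<noteq> 0" "w \<noteq> 0"
    using fins k x that by (auto simp: finsler_def)
qed

lemma density: "\<kappa> \<in> A \<Longrightarrow> smooth_on (chart_img \<kappa>) (\<sigma> \<kappa>)" "\<kappa> \<in> A \<Longrightarrow> x \<in> chart_img \<kappa> \<Longrightarrow> \<sigma> \<kappa> x > 0"
  using vol by (auto simp: volume_density_def)

text \<open>F vanishes at zero vectors, so the level F = 1 avoids the zero section.\<close>

lemma sphere_iff:
  assumes "\<kappa> \<in> A"
  shows "z \<in> sphere_bundle A F \<kappa> \<longleftrightarrow> z \<in> finsler_chart.\<Omega> (chart_img \<kappa>) \<and> tm_rep A F \<kappa> z = 1"
proof -
  interpret finsler_chart "chart_img \<kappa>" "tm_rep A F \<kappa>" by (rule chart_finsler[OF assms])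
  have "snd z \<noteq> 0" if "fst z \<in> chart_img \<kappa>" "tm_rep A F \<kappa> z = 1"
    using f_zero[OF that(1)] that(2) by (metis prod.collapse zero_neq_one)
  then show ?thesis by (auto simp: sphere_bundle_def mem_\<Omega>)
qed

text \<open>The compatibility condition in \<open>tangent_space\<close> carries \<open>y\<close>
  from one chart to the other and back, so the Jacobian is injective.\<close>

lemma transition_regular:
  assumes k: "\<kappa> \<in> A" "\<kappa>' \<in> A" and x: "x \<in> snd \<kappa> ` (fst \<kappa> \<inter> fst \<kappa>')"
  shows "det (matrix (frechet_derivative (transition \<kappa> \<kappa>') (at x))) \<noteq> 0"
proof -
  obtain p where p: "p \<in> fst \<kappa>" "p \<in> fst \<kappa>'" "x = snd \<kappa> p" using x by blast
  let ?D = "frechet_derivative (transition \<kappa> \<kappa>') (at x)"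
  let ?D' = "frechet_derivative (transition \<kappa>' \<kappa>) (at (snd \<kappa>' p))"
  have lin: "linear ?D" by (rule dd_linear[OF x smooth_transition[OF k]])
  have "?D' (?D y) = y" for y
  proof -
    have "tvec_of A \<kappa> p y \<kappa> = ?D' (tvec_of A \<kappa> p y \<kappa>')"
      using tvec_of_tangent(1)[OF k(1) p(1), of y] k p unfolding tangent_space_def by blast
    then show ?thesis using k p by (simp add: tvec_of_tangent(2)) (simp add: tvec_of_def)
  qed
  then have "inj ?D" by (metis injI)
  then show ?thesis
    using lin by (simp add: det_nz_iff_inj)
qed

lemma overlap_chart_change:
  assumes k: "\<kappa> \<in> A" "\<kappa>' \<in> A"
  shows "chart_change (chart_img \<kappa>) (tm_rep A F \<kappa>) (chart_img \<kappa>') (tm_rep A F \<kappa>')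
    (snd \<kappa> ` (fst \<kappa> \<inter> fst \<kappa>')) (transition \<kappa> \<kappa>')"
proof (intro chart_change.intro chart_change_axioms.intro chart_finsler k)
  let ?W = "snd \<kappa> ` (fst \<kappa> \<inter> fst \<kappa>')"
  show "open ?W" "smooth_on ?W (transition \<kappa> \<kappa>')"
    by (rule open_overlap[OF k], rule smooth_transition[OF k])
  show "?W \<subseteq> chart_img \<kappa>" by (auto simp: chart_img_def)
  show "transition \<kappa> \<kappa>' ` ?W \<subseteq> chart_img \<kappa>'"
    using k by (auto simp: transition_def inv_left chart_img_def)
  fix x assume x: "x \<in> ?W"
  then obtain p where p: "p \<in> fst \<kappa>" "p \<in> fst \<kappa>'" "x = snd \<kappa> p" by blast
  show "det (matrix (frechet_derivative (transition \<kappa> \<kappa>') (at x))) \<noteq> 0"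
    by (rule transition_regular[OF k x])
  fix y
  have "tm_rep A F \<kappa> (x, y) = F p (tvec_of A \<kappa> p y)" using k p by (simp add: tm_rep_def inv_left)
  also have "\<dots> = tm_rep A F \<kappa>' (snd \<kappa>' p, tvec_of A \<kappa> p y \<kappa>')"
    by (rule tm_rep_tangent[OF k(2) p(2) tvec_of_tangent(1)[OF k(1) p(1)]])
  finally show "tm_rep A F \<kappa> (x, y) = tm_rep A F \<kappa>' (transition \<kappa> \<kappa>' x, dd y (transition \<kappa> \<kappa>') x)"
    using k p by (simp add: tvec_of_def transition_def inv_left)
qed

abbreviation S\<kappa> where "S\<kappa> \<kappa> \<equiv> S_curv (tm_rep A F \<kappa>) (\<sigma> \<kappa>)"

lemma S_curv_chart:
  assumes k: "\<kappa> \<in> A" "\<kappa>' \<in> A" and p: "p \<in> fst \<kappa>" "p \<in> fst \<kappa>'" and y: "y \<noteq> 0"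
  shows "S\<kappa> \<kappa> (snd \<kappa> p, y) = S\<kappa> \<kappa>' (snd \<kappa>' p, tvec_of A \<kappa> p y \<kappa>')"
proof -
  have "S\<kappa> \<kappa> (snd \<kappa> p, y) = S\<kappa> \<kappa>' (transition \<kappa> \<kappa>' (fst (snd \<kappa> p, y)),
      dd (snd (snd \<kappa> p, y)) (transition \<kappa> \<kappa>') (fst (snd \<kappa> p, y)))"
    by (rule chart_change.S_curv_invariant[OF overlap_chart_change[OF k]])
      (use k p y vol density in \<open>auto simp: volume_density_def\<close>)
  then show ?thesis using k p by (simp add: tvec_of_def transition_def inv_left)
qed

lemma one_form_rep:
  assumes k: "\<kappa> \<in> A" and x: "x \<in> chart_img \<kappa>" and \<xi>: "one_form A \<xi>"
  shows "tm_rep A \<xi> \<kappa> (x, v) = (\<Sum>i\<in>UNIV. tm_rep A \<xi> \<kappa> (x, axis i 1) * v $ i)"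
proof -
  let ?p = "chart_inv \<kappa> x"
  note p = inv_dom[OF k x]
  have "\<xi> ?p (\<lambda>\<kappa>'. a *\<^sub>R tvec_of A \<kappa> ?p v \<kappa>' + b *\<^sub>R tvec_of A \<kappa> ?p w \<kappa>')
      = a * \<xi> ?p (tvec_of A \<kappa> ?p v) + b * \<xi> ?p (tvec_of A \<kappa> ?p w)" for a b v w
    using \<xi> tvec_of_tangent(1)[OF k p] unfolding one_form_def by blast
  then have l: "tm_rep A \<xi> \<kappa> (x, a *\<^sub>R v + b *\<^sub>R w) = a * tm_rep A \<xi> \<kappa> (x, v) + b * tm_rep A \<xi> \<kappa> (x, w)" for a b v w
    by (simp add: tm_rep_def tvec_of_linear[OF k p])
  have lin: "linear (\<lambda>v. tm_rep A \<xi> \<kappa> (x, v))"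
    using l[of 1 _ 1] l[of _ _ 0 0] by (intro linearI) simp_all
  have "tm_rep A \<xi> \<kappa> (x, v) = tm_rep A \<xi> \<kappa> (x, \<Sum>i\<in>UNIV. v $ i *\<^sub>R axis i 1)"
    by (rule arg_cong[OF vec_expand])
  also have "\<dots> = (\<Sum>i\<in>UNIV. tm_rep A \<xi> \<kappa> (x, axis i 1) * v $ i)"
    by (simp add: linear_sum[OF lin] linear_scale[OF lin] mult.commute)
  finally show ?thesis .
qed

text \<open>Since F = 1, the Reeb field projects to y itself.\<close>

lemma pull1_reeb:
  assumes k: "\<kappa> \<in> A" and z: "z \<in> sphere_bundle A F \<kappa>"
  shows "pull1 (form_rep A \<xi> \<kappa>) z (reeb (tm_rep A F \<kappa>) z) = tm_rep A \<xi> \<kappa> z"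
  using z by (simp add: sphere_bundle_def pull1_def form_rep_def reeb_def hlift_def)

lemma smooth_fun_chart: "smooth_fun A c \<Longrightarrow> \<kappa> \<in> A \<Longrightarrow> smooth_on (chart_img \<kappa>) (\<lambda>x. 1 / (real CARD('n) - 1) * c (chart_inv \<kappa> x))"
  using open_img by (intro smooth_on_mult smooth_on_const) (auto simp: smooth_fun_def o_def)

lemma n1: "real CARD('n) - 1 \<noteq> 0" using dim by simp

lemma n1_cancel: "(real CARD('n) - 1) * (1 / (real CARD('n) - 1) * a) = a"
  using n1 by (metis mult.assoc mult_1 nonzero_mult_div_cancel_left times_divide_eq_right mult.right_neutral)

lemma one_form_smooth: "one_form A \<xi> \<Longrightarrow> \<kappa> \<in> A \<Longrightarrow> smooth_on (chart_img \<kappa>) (\<lambda>x. tm_rep A \<xi> \<kappa> (x, axis i 1))"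
  by (simp add: one_form_def)

section \<open>Consequences of the form of S in one chart\<close>

context
  fixes \<kappa> c \<xi>
  assumes k: "\<kappa> \<in> A" and c: "smooth_fun A c" and \<xi>: "one_form A \<xi>"
    and S: "\<And>z. z \<in> sphere_bundle A F \<kappa> \<Longrightarrow> S\<kappa> \<kappa> z
      = 1 / (real CARD('n) - 1) * c (chart_inv \<kappa> (fst z)) + tm_rep A \<xi> \<kappa> z"
begin

interpretation finsler_chart "chart_img \<kappa>" "tm_rep A F \<kappa>" by (rule chart_finsler[OF k])

lemma S_chart:
  assumes "z \<in> \<Omega>" "tm_rep A F \<kappa> z = 1"
  shows "S\<kappa> \<kappa> z = 1 / (real CARD('n) - 1) * c (chart_inv \<kappa> (fst z))
    + (\<Sum>i\<in>UNIV. tm_rep A \<xi> \<kappa> (fst z, axis i 1) * snd z $ i)"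
  using S[of z] one_form_rep[OF k _ \<xi>, of "fst z" "snd z"] assms by (simp add: sphere_iff[OF k] mem_\<Omega>)

lemma smooth_\<eta>: "smooth_on (chart_img \<kappa>)
    (\<lambda>x. tm_rep A \<xi> \<kappa> (x, axis i 1) + dd (axis i 1) (\<lambda>x. ln (\<sigma> \<kappa> x)) x)"
  using open_img[OF k] density[OF k]
  by (intro smooth_on_add one_form_smooth \<xi> k smooth_on_dd smooth_on_ln)

lemmas trN_chart = trN_of_S_curv[OF density[OF k] S_chart]

lemma berwald_scalar_chart:
  assumes "z \<in> \<Omega>"
  shows "berwald_scalar (tm_rep A F \<kappa>) z = c (chart_inv \<kappa> (fst z))"
  unfolding berwald_scalar_eq[OF assms]
  by (rule trans[OF es_decomp[OF smooth_fun_chart[OF c k] smooth_\<eta> trN_chart assms] n1_cancel])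

lemma mean_berwald_chart:
  assumes "z \<in> \<Omega>" "adapted (tm_rep A F \<kappa>) z u" "\<gamma> \<noteq> ix_n" "\<mu> \<noteq> ix_n"
  shows "mean_berwald (tm_rep A F \<kappa>) z u \<gamma> \<mu>
    = 1 / (real CARD('n) - 1) * c (chart_inv \<kappa> (fst z)) * (if \<gamma> = \<mu> then 1 else 0)"
  by (rule mean_berwald_decomp[OF smooth_fun_chart[OF c k] smooth_\<eta> trN_chart assms])

text \<open>The identity holds for arbitrary vectors at points of the slit tangent bundle; tangency
  to the sphere bundle is a special case.\<close>

lemma trace_chart:
  assumes z: "z \<in> \<Omega>" and u: "adapted (tm_rep A F \<kappa>) z u"
  shows "tr_R (tm_rep A F \<kappa>) z u X Y = pull2 (ext_deriv (form_rep A \<xi> \<kappa>)) z X Y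
    + 1 / (real CARD('n) - 1) * wedge (frechet_derivative (berwald_scalar (tm_rep A F \<kappa>)) (at z))
        (hilbert_form (tm_rep A F \<kappa>) z) X Y"
proof -
  let ?c = "\<lambda>x. c (chart_inv \<kappa> x)"
  have x: "fst z \<in> chart_img \<kappa>" using z by (simp add: mem_\<Omega>)
  have sc: "smooth_on (chart_img \<kappa>) ?c" using c k by (simp add: smooth_fun_def o_def)
  \<comment> \<open>The scalar is the pullback of \<open>c\<close> on an open set, so its full
    differential sees only the projection of \<open>v\<close>.\<close>
  have 1: "dd v (berwald_scalar (tm_rep A F \<kappa>)) z = dd (fst v) ?c (fst z)" for v
    using dd_cong[OF z open_\<Omega> smooth_fst[OF sc] berwald_scalar_chart[symmetric], of v] dd_fst[OF z sc] by simp
  have 2: "dd v (\<lambda>x. 1 / (real CARD('n) - 1) * ?c x) (fst z) = 1 / (real CARD('n) - 1) * dd v ?c (fst z)" for v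
    by (rule dd_cmult[OF x sc])
  have 3: "dd v (\<lambda>x. form_rep A \<xi> \<kappa> x w) (fst z) = dd v (\<lambda>x. \<Sum>i\<in>UNIV. tm_rep A \<xi> \<kappa> (x, axis i 1) * w $ i) (fst z)" for v w
  proof (rule dd_cong[OF x open_img[OF k], symmetric])
    show "smooth_on (chart_img \<kappa>) (\<lambda>x. \<Sum>i\<in>UNIV. tm_rep A \<xi> \<kappa> (x, axis i 1) * w $ i)"
      using open_img[OF k] by (intro smooth_on_sum smooth_on_mult one_form_smooth \<xi> k smooth_on_const)
  qed (simp add: form_rep_def one_form_rep[OF k _ \<xi>, symmetric])
  have 4: "ext_deriv (form_rep A \<xi> \<kappa>) (fst z) a b
      = ext_deriv (\<lambda>x v. \<Sum>i\<in>UNIV. tm_rep A \<xi> \<kappa> (x, axis i 1) * v $ i) (fst z) a b" for a b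
    unfolding ext_deriv_def 3 ..
  have 5: "wedge (\<lambda>X. dd (fst X) (\<lambda>x. 1 / (real CARD('n) - 1) * ?c x) (fst z)) (hilbert_form (tm_rep A F \<kappa>) z) X Y
    = 1 / (real CARD('n) - 1) * wedge (frechet_derivative (berwald_scalar (tm_rep A F \<kappa>)) (at z))
        (hilbert_form (tm_rep A F \<kappa>) z) X Y"
    unfolding wedge_def 1 2 by (simp only: right_diff_distrib mult.assoc)
  show ?thesis
    unfolding pull2_def 4 5[symmetric]
    by (rule trace_eq_of_S_curv[OF smooth_fun_chart[OF c k] one_form_smooth[OF \<xi> k] density[OF k] S_chart z u])
qed

end

lemma isotropic_of_weakly_isotropic_S:
  assumes "weakly_isotropic_S A F \<sigma>" shows "isotropic_berwald_scalar A F"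
proof -
  obtain c \<xi> where c: "smooth_fun A c" and \<xi>: "one_form A \<xi>" and
    S: "\<And>\<kappa> z. \<kappa> \<in> A \<Longrightarrow> z \<in> sphere_bundle A F \<kappa> \<Longrightarrow> S\<kappa> \<kappa> z
      = 1 / (real CARD('n) - 1) * c (chart_inv \<kappa> (fst z)) + tm_rep A \<xi> \<kappa> z"
    using assms unfolding weakly_isotropic_S_def by (metis (no_types, lifting) pull1_reeb)
  show ?thesis unfolding isotropic_berwald_scalar_def
    using c berwald_scalar_chart[OF _ c \<xi> S] sphere_iff by blast
qed

section \<open>Construction of the 1-form from an isotropic Berwald scalar curvature\<close>

context
  fixes c
  assumes c: "smooth_fun A c"
    and e: "\<And>\<kappa> z. \<kappa> \<in> A \<Longrightarrow> z \<in> sphere_bundle A F \<kappa> \<Longrightarrow> berwald_scalar (tm_rep A F \<kappa>) z = c (chart_inv \<kappa> (fst z))"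
begin

text \<open>The decomposition of S solved for the 1-form and extended 1-homogeneously. The chart is
  an arbitrary choice, harmless by invariance of S; at zero vectors the factor F makes the value of
  S immaterial.\<close>

definition \<xi>0 :: "'m \<Rightarrow> ('m, 'n) tvec \<Rightarrow> real" where
  "\<xi>0 p v = (let \<kappa> = (SOME \<kappa>. \<kappa> \<in> A \<and> p \<in> fst \<kappa>) in
     F p v * (S\<kappa> \<kappa> (snd \<kappa> p, v \<kappa>) - 1 / (real CARD('n) - 1) * c p))"

lemma \<xi>0_rep:
  assumes k: "\<kappa> \<in> A" and x: "x \<in> chart_img \<kappa>"
  shows "tm_rep A \<xi>0 \<kappa> (x, y)
    = tm_rep A F \<kappa> (x, y) * (S\<kappa> \<kappa> (x, y) - 1 / (real CARD('n) - 1) * c (chart_inv \<kappa> x))"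
proof -
  interpret finsler_chart "chart_img \<kappa>" "tm_rep A F \<kappa>" by (rule chart_finsler[OF k])
  let ?p = "chart_inv \<kappa> x"
  note p = inv_dom[OF k x]
  define \<kappa>' where "\<kappa>' = (SOME \<kappa>. \<kappa> \<in> A \<and> ?p \<in> fst \<kappa>)"
  have "\<kappa>' \<in> A \<and> ?p \<in> fst \<kappa>'"
    unfolding \<kappa>'_def by (rule someI[of _ \<kappa>]) (rule conjI[OF k p])
  then have k': "\<kappa>' \<in> A" "?p \<in> fst \<kappa>'" by blast+
  have "tm_rep A \<xi>0 \<kappa> (x, y) = tm_rep A F \<kappa> (x, y)
      * (S\<kappa> \<kappa>' (snd \<kappa>' ?p, tvec_of A \<kappa> ?p y \<kappa>') - 1 / (real CARD('n) - 1) * c ?p)"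
    by (simp add: tm_rep_def \<xi>0_def Let_def \<kappa>'_def)
  then show ?thesis
    using S_curv_chart[OF k k'(1) p k'(2), of y] f_zero[OF x] inv_right[OF k x] by (cases "y = 0") simp_all
qed

text \<open>Linearity on each fibre is not visible in the definition of \<open>\<xi>0\<close>; this
  is where the rigidity argument enters.\<close>

lemma \<xi>0_chart:
  assumes k: "\<kappa> \<in> A"
  shows "\<exists>\<eta>. (\<forall>i. smooth_on (chart_img \<kappa>) (\<eta> i)) \<and>
    (\<forall>x\<in>chart_img \<kappa>. \<forall>y. tm_rep A \<xi>0 \<kappa> (x, y) = (\<Sum>i\<in>UNIV. \<eta> i x * y $ i))"
proof -
  interpret finsler_chart "chart_img \<kappa>" "tm_rep A F \<kappa>" by (rule chart_finsler[OF k])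
  have "es z = c (chart_inv \<kappa> (fst z))" if "z \<in> \<Omega>" for z
    by (rule es_on_sphere[where c = "\<lambda>x. c (chart_inv \<kappa> x)", OF _ that])
      (use e[OF k] in \<open>simp add: sphere_iff[OF k] berwald_scalar_eq\<close>)
  then have "es z = (real CARD('n) - 1) * (1 / (real CARD('n) - 1) * c (chart_inv \<kappa> (fst z)))" if "z \<in> \<Omega>" for z
    using that by (simp only: n1_cancel)
  from linear_form_of_es[OF dim smooth_fun_chart[OF c k] this density[OF k]]
  obtain \<eta> where \<eta>: "\<And>i. smooth_on (chart_img \<kappa>) (\<eta> i)"
    "\<And>z. z \<in> \<Omega> \<Longrightarrow> tm_rep A F \<kappa> z * (S\<kappa> \<kappa> z - 1 / (real CARD('n) - 1) * c (chart_inv \<kappa> (fst z)))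
      = (\<Sum>i\<in>UNIV. \<eta> i (fst z) * snd z $ i)" by blast
  show ?thesis
  proof (intro exI[of _ \<eta>] conjI allI ballI \<eta>(1))
    fix x y assume x: "x \<in> chart_img \<kappa>"
    show "tm_rep A \<xi>0 \<kappa> (x, y) = (\<Sum>i\<in>UNIV. \<eta> i x * y $ i)"
      unfolding \<xi>0_rep[OF k x] using \<eta>(2)[of "(x, y)"] x f_zero[OF x] by (cases "y = 0") (simp_all add: mem_\<Omega>)
  qed
qed

lemma \<xi>0_one_form: "one_form A \<xi>0"
  unfolding one_form_def
proof (intro conjI allI ballI)
  fix p v w a b assume v: "v \<in> tangent_space A p" "w \<in> tangent_space A p"
  have "p \<in> (\<Union>\<kappa>\<in>A. fst \<kappa>)" using atlas by (simp add: smooth_atlas_def)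
  then obtain \<kappa> where k: "\<kappa> \<in> A" "p \<in> fst \<kappa>" by blast
  obtain \<eta> where "\<And>i. smooth_on (chart_img \<kappa>) (\<eta> i)"
    and \<eta>: "\<And>x y. x \<in> chart_img \<kappa> \<Longrightarrow> tm_rep A \<xi>0 \<kappa> (x, y) = (\<Sum>i\<in>UNIV. \<eta> i x * y $ i)"
    using \<xi>0_chart[OF k(1)] by auto
  have "(\<lambda>\<kappa>. a *\<^sub>R v \<kappa> + b *\<^sub>R w \<kappa>) = tvec_of A \<kappa> p (a *\<^sub>R v \<kappa> + b *\<^sub>R w \<kappa>)"
    unfolding tvec_of_linear[OF k] using tangent_space_eq_tvec_of[OF k v(1)] tangent_space_eq_tvec_of[OF k v(2)]
    by simp
  then have "\<xi>0 p (\<lambda>\<kappa>. a *\<^sub>R v \<kappa> + b *\<^sub>R w \<kappa>) = tm_rep A \<xi>0 \<kappa> (snd \<kappa> p, a *\<^sub>R v \<kappa> + b *\<^sub>R w \<kappa>)"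
    using k by (simp add: tm_rep_def inv_left)
  then show "\<xi>0 p (\<lambda>\<kappa>. a *\<^sub>R v \<kappa> + b *\<^sub>R w \<kappa>) = a * \<xi>0 p v + b * \<xi>0 p w"
    unfolding tm_rep_tangent[OF k v(1), of \<xi>0] tm_rep_tangent[OF k v(2), of \<xi>0] \<eta>[OF img[OF k(2)]]
    by (simp add: sum.distrib sum_distrib_left algebra_simps)
next
  fix \<kappa> i assume k: "\<kappa> \<in> A"
  obtain \<eta> where \<eta>: "\<And>i. smooth_on (chart_img \<kappa>) (\<eta> i)"
    "\<And>x y. x \<in> chart_img \<kappa> \<Longrightarrow> tm_rep A \<xi>0 \<kappa> (x, y) = (\<Sum>i\<in>UNIV. \<eta> i x * y $ i)"
    using \<xi>0_chart[OF k] by auto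
  show "smooth_on (chart_img \<kappa>) (\<lambda>x. tm_rep A \<xi>0 \<kappa> (x, axis i 1))"
    by (rule smooth_on_cong[OF open_img[OF k] \<eta>(1)[of i]])
      (simp add: \<eta>(2) axis_def if_distrib cong: if_cong)
qed

lemma \<xi>0_S:
  assumes k: "\<kappa> \<in> A" and z: "z \<in> sphere_bundle A F \<kappa>"
  shows "S\<kappa> \<kappa> z = 1 / (real CARD('n) - 1) * c (chart_inv \<kappa> (fst z)) + tm_rep A \<xi>0 \<kappa> z"
  using \<xi>0_rep[OF k, of "fst z" "snd z"] z by (simp add: sphere_bundle_def)

lemma \<xi>0_decomposition: "S_decomposition A F \<sigma> \<xi>0"
  unfolding S_decomposition_def by (intro ballI) (simp only: \<xi>0_S e pull1_reeb)

lemma weakly_isotropic_S: "weakly_isotropic_S A F \<sigma>"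
  unfolding weakly_isotropic_S_def
  by (intro exI[of _ c] exI[of _ \<xi>0] conjI c \<xi>0_one_form ballI) (simp only: \<xi>0_S pull1_reeb)

lemma isotropic_mean_berwald: "isotropic_mean_berwald A F"
  unfolding isotropic_mean_berwald_def
proof (intro exI[of _ c] conjI c ballI allI impI)
  fix \<kappa> z u and \<gamma> \<mu> :: 'n
  assume "\<kappa> \<in> A" "z \<in> sphere_bundle A F \<kappa>" "adapted (tm_rep A F \<kappa>) z u"
    and "\<gamma> \<in> UNIV - {ix_n}" "\<mu> \<in> UNIV - {ix_n}"
  then show "mean_berwald (tm_rep A F \<kappa>) z u \<gamma> \<mu>
      = 1 / (real CARD('n) - 1) * c (chart_inv \<kappa> (fst z)) * (if \<gamma> = \<mu> then 1 else 0)"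
    using mean_berwald_chart[OF _ c \<xi>0_one_form \<xi>0_S] by (simp add: sphere_iff)
qed

lemma trace_equation:
  assumes \<xi>: "one_form A \<xi>" "S_decomposition A F \<sigma> \<xi>"
  shows "trace_equation A F \<xi>"
  unfolding trace_equation_def
proof (intro ballI allI impI)
  fix \<kappa> z u X Y
  assume k: "\<kappa> \<in> A" and z: "z \<in> sphere_bundle A F \<kappa>" and u: "adapted (tm_rep A F \<kappa>) z u"
  have S: "S\<kappa> \<kappa> z = 1 / (real CARD('n) - 1) * c (chart_inv \<kappa> (fst z)) + tm_rep A \<xi> \<kappa> z"
    if "z \<in> sphere_bundle A F \<kappa>" for z
    using \<xi>(2)[unfolded S_decomposition_def, rule_format, OF k that] by (simp only: e[OF k that] pull1_reeb[OF k that])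
  show "tr_R (tm_rep A F \<kappa>) z u X Y = pull2 (ext_deriv (form_rep A \<xi> \<kappa>)) z X Y
    + 1 / (real CARD('n) - 1) * wedge (frechet_derivative (berwald_scalar (tm_rep A F \<kappa>)) (at z))
        (hilbert_form (tm_rep A F \<kappa>) z) X Y"
    using z by (intro trace_chart[OF k c \<xi>(1) S _ u]) (simp_all add: sphere_iff[OF k])
qed

end

end

theorem theorem1:
  fixes A :: "('m::{t2_space, second_countable_topology}, 'n::finite) chart set"
    and F :: "'m \<Rightarrow> ('m, 'n) tvec \<Rightarrow> real"
    and \<sigma> :: "('m, 'n) chart \<Rightarrow> real^'n \<Rightarrow> real"
  assumes "CARD('n) \<ge> 2"
    and "smooth_atlas A"
    and "finsler A F"
    and "volume_density A \<sigma>"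
  shows "(isotropic_berwald_scalar A F \<longleftrightarrow> weakly_isotropic_S A F \<sigma>) \<and>
    (isotropic_berwald_scalar A F \<or> weakly_isotropic_S A F \<sigma> \<longrightarrow>
       (\<exists>\<xi>. one_form A \<xi> \<and> S_decomposition A F \<sigma> \<xi>) \<and>
       isotropic_mean_berwald A F \<and>
       (\<forall>\<xi>. one_form A \<xi> \<and> S_decomposition A F \<sigma> \<xi> \<longrightarrow> trace_equation A F \<xi>))"
proof -
  interpret finsler_manifold A F \<sigma> by unfold_locales (rule assms)+
  have "weakly_isotropic_S A F \<sigma> \<and> (\<exists>\<xi>. one_form A \<xi> \<and> S_decomposition A F \<sigma> \<xi>) \<and>
      isotropic_mean_berwald A F \<and>
      (\<forall>\<xi>. one_form A \<xi> \<and> S_decomposition A F \<sigma> \<xi> \<longrightarrow> trace_equation A F \<xi>)"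
    if "isotropic_berwald_scalar A F"
  proof -
    from that obtain c where c: "smooth_fun A c" "\<And>\<kappa> z. \<kappa> \<in> A \<Longrightarrow> z \<in> sphere_bundle A F \<kappa> \<Longrightarrow>
        berwald_scalar (tm_rep A F \<kappa>) z = c (chart_inv \<kappa> (fst z))"
      unfolding isotropic_berwald_scalar_def by blast
    show ?thesis
      using weakly_isotropic_S[OF c] \<xi>0_one_form[OF c] \<xi>0_decomposition[OF c]
        isotropic_mean_berwald[OF c] trace_equation[OF c] by blast
  qed
  \<comment> \<open>Weak isotropy of S leads back to an isotropic scalar, so it suffices to have
    derived all conclusions from the latter.\<close>
  then show ?thesis using isotropic_of_weakly_isotropic_S by blast
qed

end
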